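(* Let $\phi\in\mathcal S_d$ with $\sup_\xi|\widehat\phi(\xi)|=1$ such that every point of $\Omega(\phi)$ is of positive homogeneous or imaginary homogeneous type for $\widehat\phi$; let $\Omega_p(\phi)$, $\Omega_i(\phi)$ be the sets of points of positive, respectively imaginary, homogeneous type, and $\mu_\phi=\min_{\xi\in\Omega(\phi)}\mu_\xi$. If $\Omega_i(\phi)\ne\emptyset$ assume moreover: (i) $\mu_\xi<1$ for all $\xi\in\Omega_i(\phi)$; (ii) $\mu_\xi=\mu_\phi$ for some $\xi\in\Omega_i(\phi)$; (iii) there is $\alpha\in\mathbb{R}^d$ with $\alpha_\xi=\alpha$ for all $\xi\in\Omega_i(\phi)$. Then: Case 1: If $\Omega(\phi)=\Omega_p(\phi)$, let $\xi_1,\dots,\xi_A$ be the points of $\Omega(\phi)$ with $\mu_{\xi_k}=\mu_\phi$, $\alpha_k=\alpha_{\xi_k}$, $P_k=P_{\xi_k}$. Then $\phi^{(n)}(x)=\sum_{k=1}^A\widehat\phi(\xi_k)^ne^{-ix\cdot\xi_k}H^n_{P_k}(x-n\alpha_k)+o(n^{-\mu_\phi})$ uniformly for $x\in\mathbb{Z}^d$. Case 2a: If $\Omega_i(\phi)\neq\emptyset$ and either $\Omega(\phi)=\Omega_i(\phi)$ or $\mu_\xi>\mu_\phi$ for all $\xi\in\Omega_p(\phi)$, let $\xi_1,\dots,\xi_A$ (all in $\Omega_i(\phi)$) be the points with $\mu_{\xi_k}=\mu_\phi$ and $Q_k=Q_{\xi_k}$. Then for each compact $K\subseteq\mathbb{R}^d$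 there is a nested increasing sequence of compact sets $K_n$, each containing $K$, with $\bigcup_nK_n=\mathbb{R}^d$, such that $\phi^{(n)}(x)=\sum_{k=1}^A\widehat\phi(\xi_k)^ne^{-ix\cdot\xi_k}H^n_{iQ_k}(x-n\alpha)+o(n^{-\mu_\phi})$ uniformly for $x\in(n\alpha+K_n)\cap\mathbb{Z}^d$. Case 2b: If both $\Omega_i(\phi)$ and $\Omega_p(\phi)$ contain points of order $\mu_\phi$, let $\xi_1,\dots,\xi_{A_i}$ be those in $\Omega_i(\phi)$ (with $Q_k=Q_{\xi_k}$) and $\zeta_1,\dots,\zeta_{A_p}$ those in $\Omega_p(\phi)$ (with $\alpha_j=\alpha_{\zeta_j}$, $P_j=P_{\zeta_j}$). Then for each compact $K$ there is a nested increasing sequence of compact sets $K_n\supseteq K$ with union $\mathbb{R}^d$ such that $\phi^{(n)}(x)=\sum_{k=1}^{A_i}\widehat\phi(\xi_k)^ne^{-ix\cdot\xi_k}H^n_{iQ_k}(x-n\alpha)+\sum_{j=1}^{A_p}\widehat\phi(\zeta_j)^ne^{-ix\cdot\zeta_j}H^n_{P_j}(x-n\alpha_j)+o(n^{-\mu_\phi})$ uniformly for $x\in(n\alpha+K_n)\cap\mathbb{Z}^d$.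
   Context: Notation: $t^E:=\exp(\log(t)E)$. $P$ homogeneous w.r.t. $E$: $P(t^E\xi)=tP(\xi)$; $\mathrm{Exp}(P)$ = set of such $E$. Positive homogeneous: real, continuous, positive definite ($\ge0$, zero only at $0$), $\mathrm{Exp}(P)\ne\emptyset$, $\{P=1\}$ compact; homogeneous order $\mu_P=\mathrm{tr}E$, $E\in\mathrm{Exp}(P)$. For $E$ with $\|t^E\|\to0$ as $t\to0$: subhomogeneous w.r.t. $E$ means for each $\epsilon>0$, compact $K$ there is $\tau>0$ with $|\widetilde P(t^E\xi)|\le\epsilon t$, $0<t<\tau$, $\xi\in K$; strongly subhomogeneous of order $l$: $C^l$ near $0$ and $|t^k\partial_t^k\widetilde P(t^E\xi)|\le\epsilon t$ for $k\le l$. $\mathcal S_d$ = $\phi:\mathbb{Z}^d\to\mathbb{C}$ with $\sum_x|x^\beta\phi(x)|<\infty$ for all multi-indices $\beta$; $\widehat\phi(\xi)=\sum_x\phi(x)e^{ix\cdot\xi}$; $\phi^{(n)}$ is the $n$-fold convolution power; $\Omega(\phi)=\{\xi\in(-\pi,\pi]^d:|\widehat\phi(\xi)|=1\}$. For $\xi_0\in\Omega(\phi)$, $\Gamma_{\xi_0}(\xi)=\log(\widehat\phi(\xi+\xi_0)/\widehat\phi(\xi_0))$ near $0$, written $i\alpha\cdot\xi-i(Q+\widetilde Q)-(R+\widetilde R)$ ($\alpha\in\mathbb{R}^d$; $Q,R$ real polynomials vanishing at $0$ without linear terms; $\widetilde Q,\widetilde R$ real smooth vanishing at $0$). Positive homogeneous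 type: $R$ positive homogeneous and some $E\in\mathrm{Exp}(R)$ with $Q$ homogeneous w.r.t. $E$, $\widetilde Q,\widetilde R$ subhomogeneous w.r.t. $E$; $P_{\xi_0}=R+iQ$, $\mu_{\xi_0}=\mu_R$. Imaginary homogeneous type: $|Q|,R$ positive homogeneous, some $E\in\mathrm{Exp}(|Q|)$, $k>1$ with $R$ homogeneous w.r.t. $E/k$, $\widetilde Q$ strongly subhomogeneous w.r.t. $E$ of order 2, $\widetilde R$ strongly subhomogeneous w.r.t. $E/k$ of order 1; $Q_{\xi_0}=Q$, $\mu_{\xi_0}=\mu_{|Q|}$. Drift $\alpha_{\xi_0}=\alpha$. Attractors: $H^t_P(x)=(2\pi)^{-d}\int_{\mathbb{R}^d}e^{-tP(\xi)}e^{-ix\cdot\xi}d\xi$; for continuous real $Q$ with $|Q|$ positive homogeneous, $\mu_{|Q|}<1$, $H^t_{iQ}(x)=(2\pi)^{-d}\lim_{\tau\to\infty}\int_{\{|Q|<\tau\}}e^{-itQ(\xi)-ix\cdot\xi}d\xi$. *)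

theory Defs
  imports "HOL-Analysis.Analysis"
begin

definition realv :: "int^'n \<Rightarrow> real^'n" where
  "realv x = (\<chi> i. of_int (x $ i))"

definition monom :: "('n \<Rightarrow> nat) \<Rightarrow> real^'n \<Rightarrow> real" where
  "monom \<beta> x = (\<Prod>i\<in>UNIV. (x $ i) ^ (\<beta> i))"

definition in_Sd :: "(int^'n \<Rightarrow> complex) \<Rightarrow> bool" where
  "in_Sd \<phi> \<longleftrightarrow> (\<forall>\<beta>::'n \<Rightarrow> nat. (\<lambda>x. \<bar>monom \<beta> (realv x)\<bar> * norm (\<phi> x)) summable_on UNIV)"

definition fhat :: "(int^'n \<Rightarrow> complex) \<Rightarrow> real^'n \<Rightarrow> complex" where
  "fhat \<phi> \<xi> = (\<Sum>\<^sub>\<infinity>x. \<phi> x * exp (\<i> * of_real (realv x \<bullet> \<xi>)))"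

primrec convpow :: "(int^'n \<Rightarrow> complex) \<Rightarrow> nat \<Rightarrow> int^'n \<Rightarrow> complex" where
  "convpow \<phi> 0 = (\<lambda>x. if x = 0 then 1 else 0)"
| "convpow \<phi> (Suc n) = (\<lambda>x. \<Sum>\<^sub>\<infinity>y. convpow \<phi> n (x - y) * \<phi> y)"

definition Omega :: "(int^'n \<Rightarrow> complex) \<Rightarrow> (real^'n) set" where
  "Omega \<phi> = {\<xi>. (\<forall>i. - pi < \<xi> $ i \<and> \<xi> $ i \<le> pi) \<and> norm (fhat \<phi> \<xi>) = 1}"

text \<open>Gamma_{xi0}(xi) = log (phihat(xi+xi0)/phihat(xi0)) (principal branch; used near 0).\<close>
definition Gam :: "(int^'n \<Rightarrow> complex) \<Rightarrow> real^'n \<Rightarrow> real^'n \<Rightarrow> complex" where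
  "Gam \<phi> \<xi>0 \<xi> = Ln (fhat \<phi> (\<xi> + \<xi>0) / fhat \<phi> \<xi>0)"

primrec mpow :: "real^'n^'n \<Rightarrow> nat \<Rightarrow> real^'n^'n" where
  "mpow E 0 = mat 1"
| "mpow E (Suc k) = E ** mpow E k"

definition tpow :: "real \<Rightarrow> real^'n^'n \<Rightarrow> real^'n^'n" where
  "tpow t E = (\<Sum>k. ((ln t) ^ k / fact k) *\<^sub>R mpow E k)"

definition homog :: "real^'n^'n \<Rightarrow> (real^'n \<Rightarrow> 'a::real_normed_vector) \<Rightarrow> bool" where
  "homog E P \<longleftrightarrow> (\<forall>t>0. \<forall>\<xi>. P (tpow t E *v \<xi>) = t *\<^sub>R P \<xi>)"

definition Exps :: "(real^'n \<Rightarrow> 'a::real_normed_vector) \<Rightarrow> (real^'n^'n) set" where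
  "Exps P = {E. homog E P}"

definition pos_homog :: "(real^'n \<Rightarrow> real) \<Rightarrow> bool" where
  "pos_homog P \<longleftrightarrow> continuous_on UNIV P \<and> (\<forall>\<xi>. P \<xi> \<ge> 0) \<and> (\<forall>\<xi>. P \<xi> = 0 \<longleftrightarrow> \<xi> = 0)
     \<and> Exps P \<noteq> {} \<and> compact {\<xi>. P \<xi> = 1}"

definition hom_order :: "(real^'n \<Rightarrow> real) \<Rightarrow> real" where
  "hom_order P = trace (SOME E. E \<in> Exps P)"

definition contracting :: "real^'n^'n \<Rightarrow> bool" where
  "contracting E \<longleftrightarrow> ((\<lambda>t. norm (tpow t E)) \<longlongrightarrow> 0) (at_right 0)"

definition subhomog :: "real^'n^'n \<Rightarrow> (real^'n \<Rightarrow> real) \<Rightarrow> bool" where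
  "subhomog E P \<longleftrightarrow> contracting E \<and>
     (\<forall>\<epsilon>>0. \<forall>K. compact K \<longrightarrow>
        (\<exists>\<tau>>0. \<forall>t. 0 < t \<and> t < \<tau> \<longrightarrow> (\<forall>\<xi>\<in>K. \<bar>P (tpow t E *v \<xi>)\<bar> \<le> \<epsilon> * t)))"

definition partial :: "'n \<Rightarrow> (real^'n \<Rightarrow> real) \<Rightarrow> real^'n \<Rightarrow> real" where
  "partial i f \<xi> = frechet_derivative f (at \<xi>) (axis i 1)"

fun Ck_on :: "nat \<Rightarrow> (real^'n) set \<Rightarrow> (real^'n \<Rightarrow> real) \<Rightarrow> bool" where
  "Ck_on 0 U f \<longleftrightarrow> continuous_on U f"
| "Ck_on (Suc k) U f \<longleftrightarrow> continuous_on U f \<and> (\<forall>\<xi>\<in>U. f differentiable (at \<xi>))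
        \<and> (\<forall>i. Ck_on k U (partial i f))"

definition smooth_on :: "(real^'n) set \<Rightarrow> (real^'n \<Rightarrow> real) \<Rightarrow> bool" where
  "smooth_on U f \<longleftrightarrow> (\<forall>k. Ck_on k U f)"

definition strongly_subhomog :: "nat \<Rightarrow> real^'n^'n \<Rightarrow> (real^'n \<Rightarrow> real) \<Rightarrow> bool" where
  "strongly_subhomog l E P \<longleftrightarrow> contracting E \<and>
     (\<exists>U. open U \<and> 0 \<in> U \<and> Ck_on l U P) \<and>
     (\<forall>\<epsilon>>0. \<forall>K. compact K \<longrightarrow>
        (\<exists>\<tau>>0. \<forall>t. 0 < t \<and> t < \<tau> \<longrightarrow> (\<forall>\<xi>\<in>K. \<forall>k\<le>l.
            \<bar>t ^ k * (deriv ^^ k) (\<lambda>s. P (tpow s E *v \<xi>)) t\<bar> \<le> \<epsilon> * t)))"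

definition poly_nolin :: "(real^'n \<Rightarrow> real) \<Rightarrow> bool" where
  "poly_nolin Q \<longleftrightarrow> (\<exists>S c. finite S \<and> (\<forall>\<beta>\<in>S. 2 \<le> sum \<beta> UNIV) \<and>
      Q = (\<lambda>\<xi>. \<Sum>\<beta>\<in>S. c \<beta> * monom \<beta> \<xi>))"

definition decomp :: "(int^'n \<Rightarrow> complex) \<Rightarrow> real^'n \<Rightarrow> real^'n \<Rightarrow> (real^'n \<Rightarrow> real)
   \<Rightarrow> (real^'n \<Rightarrow> real) \<Rightarrow> (real^'n \<Rightarrow> real) \<Rightarrow> (real^'n \<Rightarrow> real) \<Rightarrow> bool" where
  "decomp \<phi> \<xi>0 \<alpha> R Q Rt Qt \<longleftrightarrow> poly_nolin R \<and> poly_nolin Q \<and>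
     (\<exists>U. open U \<and> 0 \<in> U \<and> smooth_on U Qt \<and> smooth_on U Rt \<and> Qt 0 = 0 \<and> Rt 0 = 0 \<and>
        (\<forall>\<xi>\<in>U. Gam \<phi> \<xi>0 \<xi> = \<i> * of_real (\<alpha> \<bullet> \<xi>) - \<i> * of_real (Q \<xi> + Qt \<xi>)
                                - of_real (R \<xi> + Rt \<xi>)))"

definition pos_type :: "(int^'n \<Rightarrow> complex) \<Rightarrow> real^'n \<Rightarrow> real^'n \<Rightarrow> (real^'n \<Rightarrow> real)
   \<Rightarrow> (real^'n \<Rightarrow> real) \<Rightarrow> bool" where
  "pos_type \<phi> \<xi>0 \<alpha> R Q \<longleftrightarrow> (\<exists>Rt Qt E. decomp \<phi> \<xi>0 \<alpha> R Q Rt Qt \<and>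
     pos_homog R \<and> E \<in> Exps R \<and> homog E Q \<and> subhomog E Qt \<and> subhomog E Rt)"

definition imag_type :: "(int^'n \<Rightarrow> complex) \<Rightarrow> real^'n \<Rightarrow> real^'n \<Rightarrow> (real^'n \<Rightarrow> real)
   \<Rightarrow> (real^'n \<Rightarrow> real) \<Rightarrow> bool" where
  "imag_type \<phi> \<xi>0 \<alpha> R Q \<longleftrightarrow> (\<exists>Rt Qt E k. decomp \<phi> \<xi>0 \<alpha> R Q Rt Qt \<and>
     pos_homog (\<lambda>\<xi>. \<bar>Q \<xi>\<bar>) \<and> pos_homog R \<and> E \<in> Exps (\<lambda>\<xi>. \<bar>Q \<xi>\<bar>) \<and> k > 1 \<and>
     homog ((1/k) *\<^sub>R E) R \<and> strongly_subhomog 2 E Qt \<and> strongly_subhomog 1 ((1/k) *\<^sub>R E) Rt)"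

definition attr_pos :: "(real^'n \<Rightarrow> complex) \<Rightarrow> real \<Rightarrow> real^'n \<Rightarrow> complex" where
  "attr_pos P t x = (1 / (2 * pi) ^ CARD('n)) *
     integral UNIV (\<lambda>\<xi>. exp (- (of_real t * P \<xi>)) * exp (- \<i> * of_real (x \<bullet> \<xi>)))"

definition attr_imag :: "(real^'n \<Rightarrow> real) \<Rightarrow> real \<Rightarrow> real^'n \<Rightarrow> complex" where
  "attr_imag Q t x = (1 / (2 * pi) ^ CARD('n)) *
     Lim at_top (\<lambda>\<tau>::real. integral {\<xi>. \<bar>Q \<xi>\<bar> < \<tau>}
        (\<lambda>\<xi>. exp (- \<i> * of_real (t * Q \<xi>) - \<i> * of_real (x \<bullet> \<xi>))))"


definition unif_o :: "real \<Rightarrow> (nat \<Rightarrow> int^'n \<Rightarrow> complex) \<Rightarrow> (nat \<Rightarrow> int^'n \<Rightarrow> bool) \<Rightarrow> bool" where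
  "unif_o \<mu> f X \<longleftrightarrow> (\<forall>\<epsilon>>0. \<forall>\<^sub>F n in sequentially. \<forall>x. X n x \<longrightarrow> norm (f n x) \<le> \<epsilon> * real n powr (- \<mu>))"

definition pos_term :: "(int^'n \<Rightarrow> complex) \<Rightarrow> real^'n \<Rightarrow> (real^'n \<Rightarrow> complex) \<Rightarrow> real^'n \<Rightarrow> nat \<Rightarrow> int^'n \<Rightarrow> complex" where
  "pos_term \<phi> \<xi> P \<alpha> n x = fhat \<phi> \<xi> ^ n * exp (- \<i> * of_real (realv x \<bullet> \<xi>)) * attr_pos P (real n) (realv x - real n *\<^sub>R \<alpha>)"

definition imag_term :: "(int^'n \<Rightarrow> complex) \<Rightarrow> real^'n \<Rightarrow> (real^'n \<Rightarrow> real) \<Rightarrow> real^'n \<Rightarrow> nat \<Rightarrow> int^'n \<Rightarrow> complex" where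
  "imag_term \<phi> \<xi> Q \<alpha> n x = fhat \<phi> \<xi> ^ n * exp (- \<i> * of_real (realv x \<bullet> \<xi>)) * attr_imag Q (real n) (realv x - real n *\<^sub>R \<alpha>)"

definition exhaustion :: "(real^'n) set \<Rightarrow> (nat \<Rightarrow> (real^'n) set) \<Rightarrow> bool" where
  "exhaustion K Kn \<longleftrightarrow> (\<forall>n. compact (Kn n) \<and> K \<subseteq> Kn n) \<and> incseq Kn \<and> (\<Union>n. Kn n) = UNIV"

end

theory Submission
  imports Defs "HOL-Real_Asymp.Real_Asymp"
begin

text \<open>
  By Fourier inversion, \<open>convpow \<phi> n x\<close> is the integral of \<open>fhat \<phi> \<xi> ^ n * exp (- \<i> x \<bullet> \<xi>)\<close> over a
  period box, chosen so that the finite set \<open>Omega \<phi>\<close> lies in its interior. Away from \<open>Omega \<phi>\<close> the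
  integrand is exponentially small. Near a point of positive type it is compared with the integrand
  of the attractor using only \<open>\<integral> exp (- n R) = O(n powr - \<mu>)\<close>, which follows from the scaling of
  sublevel sets. Near a point of imaginary type the sublevel set \<open>\<bar>Q\<bar> < T / n\<close> gives the main term.
  The tail \<open>\<bar>Q\<bar> \<ge> T / n\<close> is integrated first along the orbits \<open>u \<mapsto> exp u ^ E \<zeta>\<close> with weight \<open>exp (\<mu> u)\<close>,
  where one integration by parts against the phase \<open>n exp u Q \<zeta>\<close> gives \<open>O(T powr (\<mu> - 1) n powr - \<mu>)\<close>,
  small for large \<open>T\<close> since \<open>\<mu> < 1\<close>. The same estimate yields the conditional convergence of the
  attractor. As the compact sets \<open>K\<^sub>n\<close> may grow arbitrarily slowly, uniformity on each fixed ball of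
  \<open>x - n \<alpha>\<close> suffices.
\<close>

section \<open>Linear change of variables\<close>

text \<open>At an imaginary point the damping is too weak for absolute values: since
  \<open>R\<close> is homogeneous for \<open>E / k\<close>, they would only give the order
  \<open>n powr (- \<mu> / k)\<close>, and the limit integral converges only conditionally.
  Cancellation has to come from the orbits, on which \<open>Q\<close> is an exact multiple of
  \<open>exp u\<close>. Two things could spoil it. The linear phase \<open>y \<bullet> \<xi>\<close>
  with \<open>y = x - n \<alpha>\<close> is harmless because \<open>y\<close> stays in a ball, which
  is why the imaginary points must share one drift, and because \<open>Q\<close> has no linear
  terms: this forces orbits to grow at most like \<open>exp (u / 2)\<close>, a half power against
  \<open>exp u\<close>. The damping is kept in the amplitude; its contribution to the derivative
  along an orbit is at most a multiple of \<open>x * exp (- x / 2)\<close> with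
  \<open>x = n * R\<close>, hence bounded uniformly in \<open>n\<close>. Two points of bookkeeping
  remain. Orders are recovered from volumes of sublevel sets, so they do not depend on the exponent
  chosen, and the two types exclude each other, so that no point contributes twice.\<close>

text \<open>The library's \<open>measure_linear_image\<close> requires a well-ordered index type.\<close>

lemma measure_linear_vec:
  fixes A :: "real^'n^'n"
  assumes "S \<in> lmeasurable"
  shows "(*v) A ` S \<in> lmeasurable \<and> measure lebesgue ((*v) A ` S) = \<bar>det A\<bar> * measure lebesgue S"
  using assms
proof (induction A arbitrary: S rule: induct_matrix_elementary_alt)
  case (1 A B)
  then show ?case
    unfolding matrix_vector_mult_matrix_matrix_mult_compose image_comp [symmetric] det_mul abs_mult
    by (simp add: mult.assoc)
next
  case (2 A i)
  have "negligible ((*v) A ` S)"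
  proof (rule negligible_subset)
    show "negligible {x::real^'n. x $ i = 0}"
      by (rule negligible_standard_hyperplane_cart)
    have "(A *v x) $ i = 0" for x
      using 2(1) by (simp only: matrix_vector_mul_component row_def vec_lambda_eta inner_zero_left)
    then show "(*v) A ` S \<subseteq> {x. x $ i = 0}"
      by auto
  qed
  moreover have "det A = 0"
    using 2(1) by (rule det_zero_row)
  ultimately show ?case
    by (simp add: negligible_iff_measure)
next
  case (3 A)
  have eq: "(*v) A = (\<lambda>x. \<chi> k. A$k$k * x$k)"
  proof -
    have "(\<Sum>j\<in>UNIV. A$i$j * x$j) = A$i$i * x$i" for i and x :: "real^'n"
      using 3(1) by (subst sum.remove[of _ i]) auto
    then show ?thesis
      by (auto simp: fun_eq_iff matrix_vector_mult_def vec_eq_iff)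
  qed
  show ?case
    unfolding eq using measurable_stretch[OF 3(2)] measure_stretch[OF 3(2)]
    by (simp add: det_diagonal[OF 3(1)])
next
  case (4 m n)
  let ?A = "(\<chi> i j. mat 1 $ i $ Transposition.transpose m n j) :: real^'n^'n"
  define t where "t = Transposition.transpose m n"
  define h where "h = (\<lambda>v::real^'n. \<chi> i. v $ t i)"
  have tt: "t (t i) = i" for i
    unfolding t_def by simp
  have app: "(*v) ?A = h"
  proof -
    have "(\<Sum>j\<in>UNIV. (if i = t j then 1 else 0) * v $ j) = (\<Sum>j\<in>UNIV. (if j = t i then v $ j else 0))"
      for i and v :: "real^'n"
      using tt by (intro sum.cong) auto
    then show ?thesis
      by (simp add: fun_eq_iff matrix_vector_mult_def h_def mat_def t_def)
  qed
  have d: "\<bar>det ?A\<bar> = 1"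
    using det_permute_columns[OF permutes_swap_id[of m UNIV n], of "mat 1 :: real^'n^'n"]
    by (simp add: sign_swap_id abs_mult)
  have hh: "h (h x) = x" for x
    by (simp add: h_def tt)
  have "measure lebesgue (h ` cbox a b) = 1 * measure lebesgue (cbox a b)" for a b
  proof (cases "cbox a b = {}")
    case False
    have sub: "h ` cbox a b \<subseteq> cbox (h a) (h b)" for a b
      by (auto simp: mem_box_cart h_def)
    \<comment> \<open>One inclusion suffices: \<open>h\<close> is an involution, so the same
      inclusion for the permuted corners gives the other one.\<close>
    have eq: "h ` cbox a b = cbox (h a) (h b)"
    proof (rule equalityI[OF sub])
      have "h ` cbox (h a) (h b) \<subseteq> cbox a b"
        using sub[of "h a" "h b"] by (simp only: hh)
      then have "h ` h ` cbox (h a) (h b) \<subseteq> h ` cbox a b"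
        by (rule image_mono)
      then show "cbox (h a) (h b) \<subseteq> h ` cbox a b"
        by (simp only: image_image hh image_ident)
    qed
    then have ne: "cbox (h a) (h b) \<noteq> {}"
      using False by (metis image_is_empty)
    have "(\<Prod>i\<in>UNIV. b $ t i - a $ t i) = (\<Prod>i\<in>UNIV. b $ i - a $ i)"
      by (rule prod.reindex_bij_witness[of _ t t]) (auto simp: tt)
    then show ?thesis
      unfolding eq using False ne by (simp add: content_cbox_cart h_def)
  qed auto
  then show ?case
    using measure_linear_sufficient[OF matrix_vector_mul_linear[of ?A, unfolded app] 4(2), of 1]
    unfolding app d by metis
next
  case (5 m n)
  let ?A = "(\<chi> i j. of_bool (i = m \<and> j = n \<or> i = j)) :: real^'n^'n"
  define h where "h = (\<lambda>v::real^'n. \<chi> i. if i = m then v $ m + v $ n else v $ i)"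
  have app: "(*v) ?A = h"
  proof -
    have "(\<Sum>j\<in>UNIV. of_bool (i = m \<and> j = n \<or> i = j) * v $ j) = (if i = m then v $ m + v $ n else v $ i)"
      for i and v :: "real^'n"
    proof (cases "i = m")
      case True
      have "(\<Sum>j\<in>UNIV. of_bool (i = m \<and> j = n \<or> i = j) * v $ j)
          = (\<Sum>j\<in>UNIV. (if j = n then v $ j else 0) + (if j = m then v $ j else 0))"
        using True 5(1) by (intro sum.cong) auto
      then show ?thesis using True by (simp add: sum.distrib)
    next
      case False
      have "(\<Sum>j\<in>UNIV. of_bool (i = m \<and> j = n \<or> i = j) * v $ j) = (\<Sum>j\<in>UNIV. (if j = i then v $ j else 0))"
        using False by (intro sum.cong) auto
      then show ?thesis using False by simp
    qed
    then show ?thesis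
      by (simp add: fun_eq_iff matrix_vector_mult_def h_def)
  qed
  have "?A = (\<chi> k. if k = m then row m (mat 1) + 1 *s row n (mat 1) else row k (mat 1))"
    using 5(1) by (auto simp: vec_eq_iff row_def mat_def)
  then have d: "det ?A = 1"
    by (simp only: det_row_operation[OF 5(1)] det_I)
  have "measure lebesgue (h ` cbox a b) = 1 * measure lebesgue (cbox a b)" for a b
  proof (cases "cbox a b = {}")
    case False
    \<comment> \<open>translate so that the library's shear lemma, stated for \<open>0 \<le> a $ n\<close>, applies\<close>
    define v :: "real^'n" where "v = (\<chi> i. if i = n then - a $ n else 0)"
    have lin: "h (v + x) = h v + h x" for x
      by (simp add: h_def vec_eq_iff)
    have tr: "cbox (v + a) (v + b) = (+) v ` cbox a b"
      by (simp add: cbox_translation)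
    have "h ` cbox (v + a) (v + b) = (+) (h v) ` h ` cbox a b"
      unfolding tr image_image lin ..
    then have "measure lebesgue (h ` cbox a b) = measure lebesgue (h ` cbox (v + a) (v + b))"
      by (simp only: measure_translation)
    also have "\<dots> = measure lebesgue (cbox (v + a) (v + b))"
      unfolding h_def
    proof (rule measure_shear_interval[OF 5(1)])
      show "cbox (v + a) (v + b) \<noteq> {}"
        using False unfolding tr by blast
      show "0 \<le> (v + a) $ n"
        by (simp add: v_def)
    qed
    also have "\<dots> = measure lebesgue (cbox a b)"
      unfolding tr by (rule measure_translation)
    finally show ?thesis by simp
  qed auto
  then show ?case
    using measure_linear_sufficient[OF matrix_vector_mul_linear[of ?A, unfolded app] 5(2), of 1]
    unfolding app d by (metis abs_one)
qed

text \<open>Lebesgue measure is determined by its values on boxes. The preimage of a box is its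
  image under the inverse matrix, hence measurable, and \<open>A\<close> maps it back onto the box.
  As an equality of measures the result transforms volumes as well as complex integrals.\<close>

lemma lborel_linear_vec:
  fixes A :: "real^'n^'n"
  assumes A: "det A \<noteq> 0"
  shows "lborel = density (distr lborel borel ((*v) A)) (\<lambda>_. ennreal \<bar>det A\<bar>)"
proof (rule lborel_eqI)
  have cont: "continuous_on UNIV ((*v) A)"
    by (rule linear_continuous_on[OF matrix_vector_mul_bounded_linear])
  then have [measurable]: "(*v) A \<in> borel_measurable borel"
    by (rule borel_measurable_continuous_onI)
  fix l u :: "real^'n" assume le: "\<And>b. b \<in> Basis \<Longrightarrow> l \<bullet> b \<le> u \<bullet> b"
  let ?S = "(*v) A -` box l u"
  obtain B where B: "A ** B = mat 1" "B ** A = mat 1"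
    using A unfolding invertible_det_nz[symmetric] invertible_def by blast
  have AB: "A *v (B *v x) = x" "B *v (A *v x) = x" for x
    by (simp_all only: matrix_vector_mul_assoc B matrix_vector_mul_lid)
  have S: "?S = (*v) B ` box l u"
  proof (intro set_eqI iffI)
    fix x assume "x \<in> ?S"
    then have "B *v (A *v x) \<in> (*v) B ` box l u" by blast
    then show "x \<in> (*v) B ` box l u" unfolding AB .
  next
    fix x assume "x \<in> (*v) B ` box l u"
    then obtain y where "y \<in> box l u" "x = B *v y" by blast
    then show "x \<in> ?S" by (simp only: vimage_eq AB)
  qed
  have Sm: "?S \<in> lmeasurable"
    unfolding S using measure_linear_vec[OF lmeasurable_box, of B] by blast
  have AS: "(*v) A ` ?S = box l u"
    unfolding S image_image AB by simp
  have Sb: "?S \<in> sets borel"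
    using open_vimage[OF open_box cont] by (rule borel_open)
  have "emeasure (density (distr lborel borel ((*v) A)) (\<lambda>_. ennreal \<bar>det A\<bar>)) (box l u)
      = ennreal \<bar>det A\<bar> * emeasure lborel ?S"
    by (simp add: emeasure_density nn_integral_cmult emeasure_distr)
  also have "emeasure lborel ?S = emeasure lebesgue ?S"
    using Sb by (simp add: emeasure_completion main_part_sets)
  also have "\<dots> = ennreal (measure lebesgue ?S)"
    by (rule emeasure_eq_measure2[OF Sm])
  also have "ennreal \<bar>det A\<bar> * \<dots> = ennreal (measure lebesgue (box l u))"
    using measure_linear_vec[OF Sm, of A] unfolding AS by (simp only: ennreal_mult abs_ge_zero measure_nonneg)
  also have "measure lebesgue (box l u) = measure lborel (box l u)"
    by (rule measure_completion) simp
  also have "ennreal \<dots> = (\<Prod>b\<in>Basis. (u - l) \<bullet> b)"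
    using le unfolding measure_lborel_box_eq by auto
  finally show "emeasure (density (distr lborel borel ((*v) A)) (\<lambda>_. ennreal \<bar>det A\<bar>)) (box l u)
      = (\<Prod>b\<in>Basis. (u - l) \<bullet> b)" .
qed simp

section \<open>One-parameter groups of dilations\<close>

text \<open>With the additive parameter u = ln t the dilation t^E becomes the matrix exponential exp
  (u E), a group on the whole real line without sign conditions.\<close>

definition flow :: "real^'n^'n \<Rightarrow> real \<Rightarrow> real^'n^'n" where
  "flow E u = tpow (exp u) E"

lemma tpow_eq_flow: "t > 0 \<Longrightarrow> tpow t E = flow E (ln t)"
  by (simp add: flow_def)

lemma matrix_matrix_mult_entry: "(A ** B) $ i $ j = (\<Sum>l\<in>UNIV. A $ i $ l * B $ l $ j)"
  by (simp add: matrix_matrix_mult_def)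

text \<open>The sum of all absolute entries dominates every row sum, so it serves as a geometric
  ratio. Each entry of the exponential can then be treated as a scalar power series.\<close>

lemma mpow_entry_bound:
  fixes E :: "real^'n^'n"
  obtains B where "\<And>k i j. \<bar>mpow E k $ i $ j\<bar> \<le> B ^ k"
proof
  define B where "B = (\<Sum>i\<in>UNIV. \<Sum>j\<in>UNIV. \<bar>E $ i $ j\<bar>)"
  fix k show "\<bar>mpow E k $ i $ j\<bar> \<le> B ^ k" for i j
  proof (induction k arbitrary: i j)
    case 0
    then show ?case by (simp add: mat_def)
  next
    case (Suc k)
    have "\<bar>mpow E (Suc k) $ i $ j\<bar> \<le> (\<Sum>l\<in>UNIV. \<bar>E $ i $ l\<bar> * \<bar>mpow E k $ l $ j\<bar>)"
      unfolding mpow.simps matrix_matrix_mult_def by (simp add: abs_mult[symmetric] sum_abs)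
    also have "\<dots> \<le> (\<Sum>l\<in>UNIV. \<bar>E $ i $ l\<bar> * B ^ k)"
      using Suc by (intro sum_mono mult_left_mono) auto
    also have "\<dots> = (\<Sum>l\<in>UNIV. \<bar>E $ i $ l\<bar>) * B ^ k"
      by (simp add: sum_distrib_right)
    also have "\<dots> \<le> B * B ^ k"
    proof (rule mult_right_mono)
      show "(\<Sum>l\<in>UNIV. \<bar>E $ i $ l\<bar>) \<le> B"
        unfolding B_def by (rule member_le_sum[where f = "\<lambda>i. \<Sum>l\<in>UNIV. \<bar>E $ i $ l\<bar>"]) (auto intro: sum_nonneg)
      show "0 \<le> B ^ k"
        unfolding B_def by (intro zero_le_power sum_nonneg) auto
    qed
    finally show ?case by simp
  qed
qed

lemma summable_mpow_entry:
  fixes E :: "real^'n^'n"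
  shows "summable (\<lambda>k. (mpow E k $ i $ j / fact k) * u ^ k)"
proof -
  obtain B where B: "\<And>k i j. \<bar>mpow E k $ i $ j\<bar> \<le> B ^ k"
    using mpow_entry_bound[where E = E] by metis
  have "summable (\<lambda>k. (B * \<bar>u\<bar>) ^ k /\<^sub>R fact k)"
    by (rule summable_exp_generic)
  then show ?thesis
  proof (rule summable_comparison_test')
    fix k :: nat
    have "\<bar>mpow E k $ i $ j\<bar> * \<bar>u\<bar> ^ k \<le> B ^ k * \<bar>u\<bar> ^ k"
      using B by (intro mult_right_mono) auto
    then show "norm (mpow E k $ i $ j / fact k * u ^ k) \<le> (B * \<bar>u\<bar>) ^ k /\<^sub>R fact k"
      by (simp add: abs_mult power_abs power_mult_distrib divide_simps)
  qed
qed

lemma flow_entry: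
  "flow E u $ i $ j = (\<Sum>k. (mpow E k $ i $ j / fact k) * u ^ k)"
proof -
  have "(\<lambda>k. ((ln (exp u)) ^ k / fact k) *\<^sub>R mpow E k) sums (\<chi> i j. \<Sum>k. (mpow E k $ i $ j / fact k) * u ^ k)"
    unfolding sums_def
  proof (intro vec_tendstoI, goal_cases)
    case (1 i j)
    show ?case
      using summable_LIMSEQ[OF summable_mpow_entry[of E i j u]]
      by (simp add: sum_component field_simps)
  qed
  then show ?thesis
    unfolding flow_def tpow_def by (simp add: sums_iff)
qed

lemma mpow_commute: "E ** mpow E k = mpow E k ** E"
  by (induction k) (simp_all add: matrix_mul_assoc)

text \<open>Termwise differentiation of the power series of an entry. The differentiated
  coefficients can be written with \<open>E\<close> on the left or on the right of the power;
  comparing the two sums also yields commutation.\<close>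

lemma flow_entry_derivative:
  fixes E :: "real^'n^'n"
  shows "((\<lambda>u. flow E u $ i $ j) has_real_derivative (E ** flow E u) $ i $ j) (at u)"
    and flow_commute: "E ** flow E u = flow E u ** E"
proof -
  let ?c = "\<lambda>i j k. mpow E k $ i $ j / fact k"
  have 1: "diffs (?c i j) k = (\<Sum>l\<in>UNIV. E $ i $ l * ?c l j k)" 
    and 2: "diffs (?c i j) k = (\<Sum>l\<in>UNIV. E $ l $ j * ?c i l k)" for i j k
  proof -
    have *: "diffs (?c i j) k = (E ** mpow E k) $ i $ j / fact k"
      by (simp add: diffs_def)
    show "diffs (?c i j) k = (\<Sum>l\<in>UNIV. E $ i $ l * ?c l j k)"
      unfolding * matrix_matrix_mult_entry sum_divide_distrib by simp
    show "diffs (?c i j) k = (\<Sum>l\<in>UNIV. E $ l $ j * ?c i l k)"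
      unfolding * mpow_commute unfolding matrix_matrix_mult_entry sum_divide_distrib by (simp add: mult.commute)
  qed
  have s: "summable (\<lambda>k. a * (?c i j k * u ^ k))" for a i j
    by (intro summable_mult summable_mpow_entry)
  have 3: "(\<Sum>k. diffs (?c i j) k * u ^ k) = (E ** flow E u) $ i $ j" for i j
  proof -
    have "(\<Sum>k. diffs (?c i j) k * u ^ k) = (\<Sum>k. \<Sum>l\<in>UNIV. E $ i $ l * (?c l j k * u ^ k))"
      by (simp only: 1 sum_distrib_right mult.assoc)
    also have "\<dots> = (\<Sum>l\<in>UNIV. E $ i $ l * flow E u $ l $ j)"
      by (simp only: suminf_sum[OF s] suminf_mult[OF summable_mpow_entry] flow_entry)
    finally show ?thesis by (simp add: matrix_matrix_mult_def)
  qed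
  have 4: "(\<Sum>k. diffs (?c i j) k * u ^ k) = (flow E u ** E) $ i $ j" for i j
  proof -
    have "(\<Sum>k. diffs (?c i j) k * u ^ k) = (\<Sum>k. \<Sum>l\<in>UNIV. E $ l $ j * (?c i l k * u ^ k))"
      by (simp only: 2 sum_distrib_right mult.assoc)
    also have "\<dots> = (\<Sum>l\<in>UNIV. E $ l $ j * flow E u $ i $ l)"
      by (simp only: suminf_sum[OF s] suminf_mult[OF summable_mpow_entry] flow_entry)
    finally show ?thesis by (simp add: matrix_matrix_mult_def mult.commute)
  qed
  show "E ** flow E u = flow E u ** E"
    by (simp add: vec_eq_iff flip: 3 4)
  show "((\<lambda>u. flow E u $ i $ j) has_real_derivative (E ** flow E u) $ i $ j) (at u)"
    unfolding 3[symmetric] flow_entry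
    by (intro termdiffs_strong_converges_everywhere summable_mpow_entry)
qed

lemma flow_0 [simp]: "flow E 0 = mat 1"
proof -
  have "(\<Sum>k. (mpow E k $ i $ j / fact k) * 0 ^ k) = mat 1 $ i $ j" for i j
    using powser_zero[of "\<lambda>k. mpow E k $ i $ j / fact k"] by simp
  then show ?thesis
    by (simp add: vec_eq_iff flow_entry)
qed

lemma flow_vector_derivative:
  "((\<lambda>u. flow E u *v x) has_vector_derivative E *v (flow E u *v x)) (at u)"
proof -
  have "((\<lambda>u. (flow E u *v x) $ i) has_real_derivative (E *v (flow E u *v x)) $ i) (at u)" for i
  proof -
    have "((\<lambda>u. \<Sum>j\<in>UNIV. flow E u $ i $ j * x $ j) has_real_derivative
        (\<Sum>j\<in>UNIV. (E ** flow E u) $ i $ j * x $ j)) (at u)"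
      by (intro DERIV_sum DERIV_cmult_right flow_entry_derivative)
    then show ?thesis
      unfolding matrix_vector_mul_assoc by (simp add: matrix_vector_mult_def)
  qed
  then show ?thesis
    unfolding has_vector_derivative_def has_derivative_componentwise_within[of "\<lambda>u. flow E u *v x"]
    by (auto simp: Basis_vec_def inner_axis has_field_derivative_def mult_commute_abs)
qed

text \<open>Since \<open>E\<close> commutes with the flow,
  \<open>flow E (- u) ** flow E (u + v)\<close> has derivative zero in \<open>u\<close>, so it
  equals \<open>flow E v\<close>. The case \<open>v = 0\<close> identifies the inverse, by which the
  identity is then multiplied.\<close>

lemma flow_add: "flow E (u + v) = flow E u ** flow E v"
proof -
  have const: "flow E (-u) ** flow E (u + v) = flow E v" for u v
  proof -
    have "(flow E (-u) ** flow E (u + v)) $ i $ j = (flow E (-0) ** flow E (0 + v)) $ i $ j" for i j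
    proof (rule DERIV_isconst_all[of "\<lambda>u. (flow E (-u) ** flow E (u + v)) $ i $ j"], rule allI)
      fix u
      have "((\<lambda>u. flow E (-u) $ i $ l * flow E (u + v) $ l $ j) has_real_derivative
          - (E ** flow E (-u)) $ i $ l * flow E (u + v) $ l $ j
          + flow E (-u) $ i $ l * (E ** flow E (u + v)) $ l $ j) (at u)" for l
      proof -
        have "((\<lambda>u. flow E (-u) $ i $ l) has_real_derivative (E ** flow E (-u)) $ i $ l * (-1)) (at u)"
          by (rule DERIV_chain2[OF flow_entry_derivative(1)]) (auto intro!: derivative_eq_intros)
        moreover have "((\<lambda>u. flow E (u + v) $ l $ j) has_real_derivative (E ** flow E (u + v)) $ l $ j * 1) (at u)"
          by (rule DERIV_chain2[OF flow_entry_derivative(1)]) (auto intro!: derivative_eq_intros)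
        ultimately show ?thesis
          by (auto intro!: derivative_eq_intros)
      qed
      then have "((\<lambda>u. \<Sum>l\<in>UNIV. flow E (-u) $ i $ l * flow E (u + v) $ l $ j) has_real_derivative
          (\<Sum>l\<in>UNIV. - (E ** flow E (-u)) $ i $ l * flow E (u + v) $ l $ j
          + flow E (-u) $ i $ l * (E ** flow E (u + v)) $ l $ j)) (at u)"
        by (intro DERIV_sum)
      also have "(\<Sum>l\<in>UNIV. - (E ** flow E (-u)) $ i $ l * flow E (u + v) $ l $ j
          + flow E (-u) $ i $ l * (E ** flow E (u + v)) $ l $ j)
        = - ((E ** flow E (-u)) ** flow E (u + v)) $ i $ j + (flow E (-u) ** (E ** flow E (u + v))) $ i $ j"
        unfolding matrix_matrix_mult_entry[of "E ** flow E (-u)"] matrix_matrix_mult_entry[of "flow E (-u)" "E ** flow E (u + v)"]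
        by (simp add: sum.distrib sum_negf sum_subtractf)
      also have "\<dots> = 0"
        unfolding flow_commute[of E "-u"] matrix_mul_assoc[symmetric] by simp
      finally show "((\<lambda>u. (flow E (-u) ** flow E (u + v)) $ i $ j) has_real_derivative 0) (at u)"
        by (simp add: matrix_matrix_mult_def)
    qed
    then show ?thesis
      by (simp add: vec_eq_iff)
  qed
  have inv: "flow E u ** flow E (-u) = mat 1"
    using const[of "-u" 0] by simp
  have "flow E u ** flow E v = flow E u ** (flow E (-u) ** flow E (u + v))"
    by (simp only: const)
  also have "\<dots> = flow E (u + v)"
    by (simp add: matrix_mul_assoc inv)
  finally show ?thesis ..
qed

lemma flow_vec_add: "flow E (u + v) *v x = flow E u *v (flow E v *v x)"
  by (simp add: flow_add matrix_vector_mul_assoc)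

lemma flow_minus_vec [simp]:
  "flow E (-u) *v (flow E u *v x) = x" "flow E u *v (flow E (-u) *v x) = x"
  by (simp_all flip: flow_vec_add)

lemma mpow_scaleR: "mpow (c *\<^sub>R E) k = c ^ k *\<^sub>R mpow E k"
  by (induction k) (simp_all add: matrix_scalar_ac scalar_matrix_assoc mult.commute flip: scalar_mult_eq_scaleR)

lemma flow_scaleR: "flow (c *\<^sub>R E) u = flow E (c * u)"
  by (simp add: vec_eq_iff flow_entry mpow_scaleR power_mult_distrib mult_ac)

lemma continuous_flow_entry: "continuous_on UNIV (\<lambda>u. flow E u $ i $ j)"
  by (intro continuous_at_imp_continuous_on ballI DERIV_isCont[OF flow_entry_derivative(1)])

lemma continuous_on_flow:
  assumes "continuous_on S f" "continuous_on S g"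
  shows "continuous_on S (\<lambda>z. flow E (f z) *v g z)"
proof -
  have "continuous_on S (\<lambda>z. (flow E (f z) *v g z) $ i)" for i
    unfolding matrix_vector_mult_def vec_lambda_beta
    by (intro continuous_intros continuous_on_compose2[OF continuous_flow_entry assms(1)] assms) auto
  then have "continuous_on S (\<lambda>z. \<chi> i. (flow E (f z) *v g z) $ i)"
    by (intro continuous_on_vec_lambda)
  then show ?thesis by simp
qed

text \<open>Liouville's formula. At 0, where the flow is the identity, only the identity permutation
  contributes to the derivative: any other moves two indices, so a zero factor remains after one
  factor is differentiated. The group law carries the derivative to every \<open>u\<close>, and the
  linear equation so obtained is solved with an integrating factor.\<close>

lemma det_flow:
  fixes E :: "real^'n^'n"
  shows "det (flow E u) = exp (u * trace E)"
proof -
  have at0: "((\<lambda>u. det (flow E u)) has_real_derivative trace E) (at 0)"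
  proof -
    have pr: "((\<lambda>u. \<Prod>i\<in>UNIV. flow E u $ i $ p i) has_real_derivative
        (\<Sum>i\<in>UNIV. E $ i $ p i * (\<Prod>j\<in>UNIV - {i}. mat 1 $ j $ p j))) (at 0)" for p :: "'n \<Rightarrow> 'n"
    proof -
      have "((\<lambda>u. flow E u $ i $ j) has_real_derivative E $ i $ j) (at 0)" for i j
        using flow_entry_derivative(1)[of E i j 0] by simp
      then show ?thesis
        using has_field_derivative_prod[of UNIV "\<lambda>i u. flow E u $ i $ p i" "\<lambda>i. E $ i $ p i" 0] by simp
    qed
    have zero: "(\<Sum>i\<in>UNIV. E $ i $ p i * (\<Prod>j\<in>UNIV - {i}. mat 1 $ j $ p j)) = (0::real)"
      if p: "p permutes UNIV" "p \<noteq> id" for p :: "'n \<Rightarrow> 'n"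
    proof (rule sum.neutral, rule ballI)
      fix i :: 'n
      obtain a where a: "p a \<noteq> a" using p(2) by (auto simp: fun_eq_iff)
      have "p (p a) \<noteq> p a" using a permutes_inj[OF p(1)] by (auto dest: injD)
      then obtain j where "j \<noteq> i" "p j \<noteq> j" using a by metis
      then have "(\<Prod>j\<in>UNIV - {i}. mat 1 $ j $ p j) = (0::real)"
        by (intro prod_zero) (auto simp: mat_def intro!: bexI[of _ j])
      then show "E $ i $ p i * (\<Prod>j\<in>UNIV - {i}. mat 1 $ j $ p j) = 0" by simp
    qed
    have "((\<lambda>u. det (flow E u)) has_real_derivative
       (\<Sum>p | p permutes UNIV. of_int (sign p) * (\<Sum>i\<in>UNIV. E $ i $ p i * (\<Prod>j\<in>UNIV - {i}. mat 1 $ j $ p j)))) (at 0)"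
      unfolding det_def by (intro DERIV_sum DERIV_cmult pr)
    also have "(\<Sum>p | p permutes UNIV. of_int (sign p) * (\<Sum>i\<in>UNIV. E $ i $ p i * (\<Prod>j\<in>UNIV - {i}. mat 1 $ j $ p j)))
      = (\<Sum>p\<in>{id}. of_int (sign p) * (\<Sum>i\<in>UNIV. E $ i $ p i * (\<Prod>j\<in>UNIV - {i}. mat 1 $ j $ p j)))"
      by (rule sum.mono_neutral_right) (auto simp: zero finite_permutations permutes_id)
    also have "\<dots> = trace E"
      by (simp add: trace_def mat_def)
    finally show ?thesis .
  qed
  have deriv: "((\<lambda>u. det (flow E u)) has_real_derivative det (flow E u) * trace E) (at u)" for u
  proof -
    have "((\<lambda>h. det (flow E u) * det (flow E h)) has_real_derivative det (flow E u) * trace E) (at 0)"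
      by (intro DERIV_cmult at0)
    then have "((\<lambda>h. det (flow E (u + h))) has_real_derivative det (flow E u) * trace E) (at 0)"
      by (simp add: flow_add det_mul)
    then show ?thesis
      using DERIV_shift[of "\<lambda>u. det (flow E u)" _ 0 u] by (simp add: add.commute)
  qed
  have "det (flow E u) * exp (- (u * trace E)) = det (flow E 0) * exp (- (0 * trace E))"
  proof (rule DERIV_isconst_all[of "\<lambda>u. det (flow E u) * exp (- (u * trace E))"], rule allI)
    show "((\<lambda>u. det (flow E u) * exp (- (u * trace E))) has_real_derivative 0) (at u)" for u
      by (auto intro!: derivative_eq_intros deriv)
  qed
  then show ?thesis
    by (simp add: exp_minus field_simps)
qed

section \<open>Positive homogeneous functions\<close>

lemma norm_matrix_vector_le:
  fixes A :: "real^'n^'m"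
  shows "norm (A *v x) \<le> norm A * norm x"
proof -
  have "norm (A *v x) \<le> L2_set (\<lambda>i. norm (A $ i) * norm x) UNIV"
    unfolding norm_vec_def[of "A *v x"]
    by (rule L2_set_mono) (simp_all add: matrix_vector_mul_component Cauchy_Schwarz_ineq2)
  also have "\<dots> = norm A * norm x"
    unfolding norm_vec_def[of A] by (rule L2_set_left_distrib[symmetric]) simp
  finally show ?thesis .
qed

lemma homog_flow:
  assumes "homog E P"
  shows "P (flow E u *v \<xi>) = exp u *\<^sub>R P \<xi>"
  using assms by (simp add: homog_def flow_def)

text \<open>The dilation by \<open>t\<close> carries the unit sublevel set onto the sublevel set at
  \<open>t\<close>, and \<open>det_flow\<close> gives the Jacobian. It stands outside the locale
  because \<open>hom_order_eq\<close> applies it to the exponent picked by the choice operator,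
  about which only homogeneity is known.\<close>

lemma emeasure_sublevel_scaling:
  fixes P :: "real^'n \<Rightarrow> real"
  assumes cont: "continuous_on UNIV P" and hE: "homog E P" and t: "t > 0"
  shows "emeasure lborel {\<xi>. P \<xi> < t} = ennreal (t powr trace E) * emeasure lborel {\<xi>. P \<xi> < 1}"
proof -
  let ?A = "flow E (ln t)"
  have "det ?A = t powr trace E"
    using t by (simp add: det_flow powr_def mult.commute)
  then have d: "det ?A \<noteq> 0" "\<bar>det ?A\<bar> = t powr trace E"
    using t by auto
  have [measurable]: "P \<in> borel_measurable borel" "(*v) ?A \<in> borel_measurable borel"
    by (intro borel_measurable_continuous_onI cont linear_continuous_on matrix_vector_mul_bounded_linear)+
  have eq: "{\<xi>. P (?A *v \<xi>) < t} = {\<xi>. P \<xi> < 1}"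
    using t by (simp add: homog_flow[OF hE])
  have "emeasure lborel {\<xi>. P \<xi> < t}
      = emeasure (density (distr lborel borel ((*v) ?A)) (\<lambda>_. ennreal \<bar>det ?A\<bar>)) {\<xi>. P \<xi> < t}"
    using lborel_linear_vec[OF d(1)] by simp
  also have "\<dots> = ennreal (t powr trace E) * emeasure lborel {\<xi>. P (?A *v \<xi>) < t}"
    unfolding d by (simp add: emeasure_density nn_integral_cmult emeasure_distr vimage_def)
  finally show ?thesis
    unfolding eq .
qed

text \<open>Contraction is taken as an assumption because every use has it at hand: it is a
  component of both \<open>subhomog\<close> and \<open>strongly_subhomog\<close>.\<close>

locale pos_homog_scaling =
  fixes P :: "real^'n \<Rightarrow> real" and E :: "real^'n^'n"
  assumes ph: "pos_homog P" and hE: "homog E P" and con: "contracting E"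
begin

definition "\<mu> = trace E"

text \<open>Every orbit through a nonzero point crosses this set during one unit of
  \<open>u\<close>. It is closed, hence compact, so that constants can be chosen uniformly on it;
  integration uses its half-open variant \<open>W\<close>.\<close>

definition "shell = {\<xi>. 1 \<le> P \<xi> \<and> P \<xi> \<le> exp 1}"

lemma P_cont: "continuous_on UNIV P" and P_nonneg: "0 \<le> P \<xi>" and P_0_iff: "P \<xi> = 0 \<longleftrightarrow> \<xi> = 0"
  and compact_sphere: "compact {\<xi>. P \<xi> = 1}"
  using ph by (auto simp: pos_homog_def)

lemma P_pos_iff: "0 < P \<xi> \<longleftrightarrow> \<xi> \<noteq> 0"
  using P_nonneg[of \<xi>] P_0_iff[of \<xi>] by linarith

lemma P_measurable [measurable]: "P \<in> borel_measurable borel"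
  by (intro borel_measurable_continuous_onI P_cont)

lemma P_flow: "P (flow E u *v \<xi>) = exp u * P \<xi>"
  by (simp add: homog_flow[OF hE])

lemma polar_decomp:
  assumes "\<xi> \<noteq> 0"
  obtains \<omega> where "P \<omega> = 1" "flow E (ln (P \<xi>)) *v \<omega> = \<xi>"
proof
  have "P \<xi> > 0" using assms by (simp add: P_pos_iff)
  then show "P (flow E (- ln (P \<xi>)) *v \<xi>) = 1"
    by (simp add: P_flow exp_minus)
qed simp

lemma flow_small:
  assumes "\<epsilon> > 0"
  obtains u0 where "\<And>u x. u \<le> u0 \<Longrightarrow> norm (flow E u *v x) \<le> \<epsilon> * norm x"
proof -
  have "((\<lambda>t. norm (tpow t E)) \<longlongrightarrow> 0) (at_right 0)"
    using con by (simp add: contracting_def)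
  then have "eventually (\<lambda>t. norm (tpow t E) < \<epsilon>) (at_right 0)"
    using assms by (rule order_tendstoD)
  then obtain b where b: "b > 0" "\<And>t. 0 < t \<Longrightarrow> t < b \<Longrightarrow> norm (tpow t E) < \<epsilon>"
    unfolding eventually_at_right_field by auto
  show thesis
  proof
    fix u x assume "u \<le> ln b - 1"
    then have "exp u \<le> exp (ln b - 1)" by simp
    also have "\<dots> < exp (ln b)" by (simp only: exp_less_cancel_iff)
    also have "\<dots> = b" using b by simp
    finally have "exp u < b" .
    then have "norm (flow E u) < \<epsilon>"
      unfolding flow_def by (intro b) auto
    then show "norm (flow E u *v x) \<le> \<epsilon> * norm x"
      using norm_matrix_vector_le[of "flow E u" x] mult_right_mono[of "norm (flow E u)" \<epsilon> "norm x"] by simp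
  qed
qed

text \<open>Contraction handles very negative \<open>u\<close>, compactness the remaining interval.
  Growth for large \<open>u\<close> is a different matter, see \<open>flow_growth\<close>.\<close>

lemma flow_bounded:
  obtains C where "C > 0" "\<And>u x. u \<le> u0 \<Longrightarrow> norm (flow E u *v x) \<le> C * norm x"
proof -
  obtain u1 where u1: "\<And>u x. u \<le> u1 \<Longrightarrow> norm (flow E u *v x) \<le> 1 * norm x"
    using flow_small[of 1] by (metis zero_less_one)
  have "continuous_on UNIV (\<lambda>u. \<chi> i j. flow E u $ i $ j)"
    by (intro continuous_on_vec_lambda continuous_flow_entry)
  then have "compact (flow E ` {u1..u0})"
    by (intro compact_continuous_image) (auto elim: continuous_on_subset)
  then have "bounded (flow E ` {u1..u0})"
    by (rule compact_imp_bounded)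
  then obtain B where B: "\<And>u. u \<in> {u1..u0} \<Longrightarrow> norm (flow E u) \<le> B"
    unfolding bounded_iff by blast
  show thesis
  proof
    show "max 1 B > 0" by simp
    fix u x assume "u \<le> u0"
    show "norm (flow E u *v x) \<le> max 1 B * norm x"
    proof (cases "u \<le> u1")
      case True
      then have "norm (flow E u *v x) \<le> 1 * norm x" by (rule u1)
      also have "\<dots> \<le> max 1 B * norm x" by (intro mult_right_mono) auto
      finally show ?thesis .
    next
      case False
      then have "norm (flow E u) \<le> max 1 B"
        using B[of u] \<open>u \<le> u0\<close> by auto
      then show ?thesis
        using norm_matrix_vector_le[of "flow E u" x] mult_right_mono[of "norm (flow E u)" "max 1 B" "norm x"] by simp
    qed
  qed
qed

lemma sphere_bounded:
  obtains r where "r > 0" "\<And>\<omega>. P \<omega> = 1 \<Longrightarrow> norm \<omega> \<le> r"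
proof -
  obtain r where "\<And>\<omega>. P \<omega> = 1 \<Longrightarrow> norm \<omega> \<le> r"
    using compact_imp_bounded[OF compact_sphere] unfolding bounded_iff by auto
  then show thesis
    using that[of "max 1 r"] by (metis less_max_iff_disj max.coboundedI2 zero_less_one)
qed

text \<open>A nonzero point of the sublevel set is reached from the compact unit level set at a time
  of at most \<open>ln c\<close>, where the flow is bounded.\<close>

lemma bounded_sublevel: "bounded {\<xi>. P \<xi> \<le> c}"
proof -
  obtain r where r: "r > 0" "\<And>\<omega>. P \<omega> = 1 \<Longrightarrow> norm \<omega> \<le> r"
    using sphere_bounded by blast
  obtain C where C: "C > 0" "\<And>u x. u \<le> ln c \<Longrightarrow> norm (flow E u *v x) \<le> C * norm x"
    using flow_bounded[of "ln c"] by blast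
  have "norm \<xi> \<le> C * r" if "P \<xi> \<le> c" for \<xi>
  proof (cases "\<xi> = 0")
    case False
    then obtain \<omega> where \<omega>: "P \<omega> = 1" "flow E (ln (P \<xi>)) *v \<omega> = \<xi>"
      by (rule polar_decomp)
    have "ln (P \<xi>) \<le> ln c"
      using that False P_pos_iff[of \<xi>] by simp
    then have "norm \<xi> \<le> C * norm \<omega>"
      using C(2)[of "ln (P \<xi>)" \<omega>] \<omega>(2) by simp
    also have "\<dots> \<le> C * r"
      using C(1) r(2)[OF \<omega>(1)] by simp
    finally show ?thesis .
  qed (use C r in auto)
  then show ?thesis
    unfolding bounded_iff by blast
qed

text \<open>Contraction drives the compact unit level set into any ball, so sublevel sets form a
  neighbourhood base at 0. All local neighbourhoods can therefore be taken to be sublevel sets,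
  whose volumes are known exactly.\<close>

lemma small_sublevel:
  assumes "open W" "0 \<in> W"
  obtains \<delta> where "\<delta> > 0" "{\<xi>. P \<xi> < \<delta>} \<subseteq> W"
proof -
  obtain e where e: "e > 0" "ball 0 e \<subseteq> W"
    using assms open_contains_ball by blast
  obtain r where r: "r > 0" "\<And>\<omega>. P \<omega> = 1 \<Longrightarrow> norm \<omega> \<le> r"
    using sphere_bounded by blast
  obtain u0 where u0: "\<And>u x. u \<le> u0 \<Longrightarrow> norm (flow E u *v x) \<le> (e / (2 * r)) * norm x"
    using flow_small[of "e / (2 * r)"] e r by (metis divide_pos_pos mult_pos_pos zero_less_numeral)
  show thesis
  proof
    show "exp u0 > 0" by simp
    show "{\<xi>. P \<xi> < exp u0} \<subseteq> W"
    proof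
      fix \<xi> assume "\<xi> \<in> {\<xi>. P \<xi> < exp u0}"
      then have P: "P \<xi> < exp u0" by simp
      show "\<xi> \<in> W"
      proof (cases "\<xi> = 0")
        case False
        then obtain \<omega> where \<omega>: "P \<omega> = 1" "flow E (ln (P \<xi>)) *v \<omega> = \<xi>"
          by (rule polar_decomp)
        have "ln (P \<xi>) \<le> ln (exp u0)"
          using P False P_pos_iff[of \<xi>] by (subst ln_le_cancel_iff) auto
        then have "norm \<xi> \<le> (e / (2 * r)) * norm \<omega>"
          using u0[of "ln (P \<xi>)" \<omega>] \<omega>(2) by simp
        also have "\<dots> \<le> (e / (2 * r)) * r"
          using e r \<omega> by (intro mult_left_mono) auto
        also have "\<dots> < e"
          using e r by simp
        finally show ?thesis using e by auto
      qed (use assms in auto)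
    qed
  qed
qed

lemma open_sublevel: "open {\<xi>. P \<xi> < t}"
  by (intro open_Collect_less P_cont continuous_on_const)

lemma compact_shell: "compact shell"
proof -
  have "closed shell"
    unfolding shell_def by (intro closed_Collect_conj closed_Collect_le P_cont continuous_on_const)
  moreover have "bounded shell"
    by (rule bounded_subset[OF bounded_sublevel[of "exp 1"]]) (auto simp: shell_def)
  ultimately show ?thesis
    by (simp add: compact_eq_bounded_closed)
qed

text \<open>Taking the unit level set for \<open>K\<close> and \<open>P \<xi>\<close> for
  \<open>t\<close>, subhomogeneity becomes the pointwise statement f = o(P) at 0, in which the
  dilations no longer appear. The premise is spelled out so that \<open>subhomog\<close> and the
  case \<open>k = 0\<close> of \<open>strongly_subhomog\<close> can both supply it.\<close>

lemma little_o:
  assumes f: "\<And>\<epsilon> K. \<epsilon> > 0 \<Longrightarrow> compact K \<Longrightarrow>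
      \<exists>\<tau>>0. \<forall>t. 0 < t \<and> t < \<tau> \<longrightarrow> (\<forall>\<xi>\<in>K. \<bar>f (tpow t E *v \<xi>)\<bar> \<le> \<epsilon> * t)"
    and f0: "f 0 = (0::real)" and \<epsilon>: "\<epsilon> > 0"
  obtains \<delta> where "\<delta> > 0" "\<And>\<xi>. P \<xi> < \<delta> \<Longrightarrow> \<bar>f \<xi>\<bar> \<le> \<epsilon> * P \<xi>"
proof -
  obtain \<tau> where \<tau>: "\<tau> > 0" "\<And>t \<xi>. 0 < t \<Longrightarrow> t < \<tau> \<Longrightarrow> P \<xi> = 1 \<Longrightarrow> \<bar>f (tpow t E *v \<xi>)\<bar> \<le> \<epsilon> * t"
    using f[OF \<epsilon> compact_sphere] by auto
  show thesis
  proof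
    fix \<xi> assume *: "P \<xi> < \<tau>"
    show "\<bar>f \<xi>\<bar> \<le> \<epsilon> * P \<xi>"
    proof (cases "\<xi> = 0")
      case False
      then obtain \<omega> where \<omega>: "P \<omega> = 1" "flow E (ln (P \<xi>)) *v \<omega> = \<xi>"
        by (rule polar_decomp)
      have p: "P \<xi> > 0" using False by (simp add: P_pos_iff)
      then have "tpow (P \<xi>) E *v \<omega> = \<xi>" using \<omega> by (simp add: tpow_eq_flow)
      with \<tau>(2)[OF p * \<omega>(1)] show ?thesis by simp
    qed (use f0 P_nonneg \<epsilon> in auto)
  qed (use \<tau> in auto)
qed

section \<open>Volumes of sublevel sets and the homogeneous order\<close>

lemma emeasure_sublevel_finite: "emeasure lborel {\<xi>. P \<xi> < t} < \<infinity>"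
proof (rule emeasure_bounded_finite)
  show "bounded {\<xi>. P \<xi> < t}"
    by (rule bounded_subset[OF bounded_sublevel[of t]]) auto
qed

definition "V = measure lborel {\<xi>. P \<xi> < 1}"

lemma measure_sublevel: "t > 0 \<Longrightarrow> measure lborel {\<xi>. P \<xi> < t} = t powr \<mu> * V"
  unfolding measure_def V_def \<mu>_def
  by (subst emeasure_sublevel_scaling[OF P_cont hE]) (simp_all add: enn2real_mult)

lemma emeasure_sublevel: "t > 0 \<Longrightarrow> emeasure lborel {\<xi>. P \<xi> < t} = ennreal (t powr \<mu> * V)"
  using measure_sublevel[of t] emeasure_sublevel_finite[of t] emeasure_eq_ennreal_measure[of lborel "{\<xi>. P \<xi> < t}"]
  by simp

lemma V_pos: "V > 0"
proof -
  have "0 \<in> {\<xi>. P \<xi> < 1}"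
    using P_0_iff[of 0] by simp
  then obtain e where e: "e > 0" "ball 0 e \<subseteq> {\<xi>. P \<xi> < 1}"
    using open_sublevel[of 1] open_contains_ball by metis
  have "0 < measure lborel (ball (0::real^'n) e)"
    using content_ball_pos[OF e(1)] .
  also have "\<dots> \<le> V"
    unfolding V_def
  proof (rule measure_mono_fmeasurable[OF e(2)])
    show "ball (0::real^'n) e \<in> sets lborel"
      by simp
    show "{\<xi>. P \<xi> < 1} \<in> fmeasurable lborel"
      using emeasure_sublevel_finite[of 1] open_sublevel[of 1] by (intro fmeasurableI) simp_all
  qed
  finally show ?thesis .
qed

text \<open>The order is defined through a choice of exponent. The volume of
  \<open>{\<xi>. P \<xi> < 2}\<close> does not depend on that choice, and since \<open>V\<close> is
  finite and positive, it determines the trace.\<close>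

lemma hom_order_eq: "hom_order P = \<mu>"
proof -
  define E0 where "E0 = (SOME E. E \<in> Exps P)"
  have "E \<in> Exps P" using hE by (simp add: Exps_def)
  then have "homog E0 P"
    unfolding E0_def by (metis (mono_tags) Exps_def mem_Collect_eq someI_ex)
  then have "ennreal (2 powr trace E0) * emeasure lborel {\<xi>. P \<xi> < 1} = emeasure lborel {\<xi>. P \<xi> < 2}"
    using emeasure_sublevel_scaling[OF P_cont, of E0 2] by simp
  then have "ennreal (2 powr trace E0 * V) = ennreal (2 powr \<mu> * V)"
    by (simp add: emeasure_sublevel ennreal_mult V_pos less_imp_le)
  then have "log 2 (2 powr trace E0) = log 2 (2 powr \<mu>)"
    using V_pos by simp
  then have "trace E0 = \<mu>"
    by simp
  then show ?thesis
    unfolding hom_order_def E0_def[symmetric] by simp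
qed

text \<open>Slice by the integer part m of \<open>s * P \<xi>\<close>: there the integrand is at
  most exp (- m) on a set of volume at most \<open>((m + 1) / s) powr \<mu> * V\<close>. The power
  of \<open>s\<close> factors out and the sum over m converges.\<close>

lemma exp_integral_bound:
  obtains C where "C > 0" "\<And>s. s > 0 \<Longrightarrow> (\<integral>\<^sup>+\<xi>. ennreal (exp (- (s * P \<xi>))) \<partial>lborel) \<le> ennreal (C * s powr (- \<mu>))"
proof -
  define a where "a = (\<lambda>m::nat. exp (- real m) * (real m + 1) powr \<mu> * V)"
  have a0: "a m \<ge> 0" for m using V_pos by (simp add: a_def)
  have sa: "summable a"
  proof (rule summable_comparison_test_bigo)
    show "summable (\<lambda>m::nat. norm (1 / real m ^ 2))"
      using inverse_power_summable[of 2, where 'a = real] by (simp add: field_simps)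
    have "(\<lambda>m::nat. exp (- real m) * (real m + 1) powr \<mu>) \<in> O(\<lambda>m. 1 / real m ^ 2)"
      by real_asymp
    then have "(\<lambda>m::nat. V * (exp (- real m) * (real m + 1) powr \<mu>)) \<in> O(\<lambda>m. 1 / real m ^ 2)"
      by (rule landau_o.big.cmult_in_iff[THEN iffD2, rotated]) (use V_pos in auto)
    then show "a \<in> O(\<lambda>m. 1 / real m ^ 2)"
      by (simp add: a_def mult_ac)
  qed
  show thesis
  proof
    \<comment> \<open>Adding 1 makes the constant visibly positive; the same device recurs in later
      constants.\<close>
    show "suminf a + 1 > 0"
      using suminf_nonneg[OF sa a0] by simp
    fix s :: real assume s: "s > 0"
    have "ennreal (exp (- (s * P \<xi>))) \<le> (\<Sum>m. ennreal (exp (- real m)) * indicator {\<xi>. P \<xi> < (real m + 1) / s} \<xi>)" for \<xi>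
    proof -
      define m where "m = nat \<lfloor>s * P \<xi>\<rfloor>"
      have sP: "s * P \<xi> \<ge> 0" using s P_nonneg by simp
      then have m: "real m \<le> s * P \<xi>" "s * P \<xi> < real m + 1"
        unfolding m_def by linarith+
      have "ennreal (exp (- (s * P \<xi>))) \<le> ennreal (exp (- real m)) * indicator {\<xi>. P \<xi> < (real m + 1) / s} \<xi>"
        using m s by (simp add: indicator_def field_simps ennreal_leI)
      also have "\<dots> \<le> (\<Sum>m. ennreal (exp (- real m)) * indicator {\<xi>. P \<xi> < (real m + 1) / s} \<xi>)"
      proof -
        have "g m \<le> suminf g" for g :: "nat \<Rightarrow> ennreal"
          using sum_le_suminf[of g "{m}"] by (simp add: summableI)
        then show ?thesis .
      qed
      finally show ?thesis .
    qed
    then have "(\<integral>\<^sup>+\<xi>. ennreal (exp (- (s * P \<xi>))) \<partial>lborel)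
      \<le> (\<integral>\<^sup>+\<xi>. (\<Sum>m. ennreal (exp (- real m)) * indicator {\<xi>. P \<xi> < (real m + 1) / s} \<xi>) \<partial>lborel)"
      by (intro nn_integral_mono) auto
    also have "\<dots> = (\<Sum>m. \<integral>\<^sup>+\<xi>. ennreal (exp (- real m)) * indicator {\<xi>. P \<xi> < (real m + 1) / s} \<xi> \<partial>lborel)"
      by (rule nn_integral_suminf) measurable
    also have "\<dots> = (\<Sum>m. ennreal (a m * s powr (- \<mu>)))"
    proof (rule suminf_cong)
      fix m :: nat
      have pos: "(real m + 1) / s > 0" using s by simp
      have "(\<integral>\<^sup>+\<xi>. ennreal (exp (- real m)) * indicator {\<xi>. P \<xi> < (real m + 1) / s} \<xi> \<partial>lborel)
         = ennreal (exp (- real m)) * emeasure lborel {\<xi>. P \<xi> < (real m + 1) / s}"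
        by (rule nn_integral_cmult_indicator) measurable
      also have "\<dots> = ennreal (exp (- real m) * (((real m + 1) / s) powr \<mu> * V))"
        unfolding emeasure_sublevel[OF pos] using V_pos by (simp add: ennreal_mult)
      also have "exp (- real m) * (((real m + 1) / s) powr \<mu> * V) = a m * s powr (- \<mu>)"
        using s by (simp add: a_def powr_divide powr_minus field_simps)
      finally show "(\<integral>\<^sup>+\<xi>. ennreal (exp (- real m)) * indicator {\<xi>. P \<xi> < (real m + 1) / s} \<xi> \<partial>lborel)
         = ennreal (a m * s powr (- \<mu>))" .
    qed
    also have "\<dots> = ennreal (suminf a * s powr (- \<mu>))"
      using a0 sa by (subst suminf_ennreal2) (auto simp: summable_mult2 suminf_mult2)
    also have "\<dots> \<le> ennreal ((suminf a + 1) * s powr (- \<mu>))"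
      by (intro ennreal_leI mult_right_mono) auto
    finally show "(\<integral>\<^sup>+\<xi>. ennreal (exp (- (s * P \<xi>))) \<partial>lborel) \<le> ennreal ((suminf a + 1) * s powr (- \<mu>))" .
  qed
qed

end

section \<open>Integration along orbits of the dilations\<close>

lemma integrable_bounded_support:
  fixes G :: "'a::euclidean_space \<Rightarrow> 'b::{banach,second_countable_topology}"
  assumes [measurable]: "G \<in> borel_measurable borel" and S: "bounded S"
    and 0: "\<And>x. x \<notin> S \<Longrightarrow> G x = 0" and B: "\<And>x. norm (G x) \<le> B"
  shows "integrable lborel G"
proof -
  obtain a b where ab: "S \<subseteq> cbox a b"
    using bounded_subset_cbox_symmetric[OF S] by blast
  have "integrable lborel (\<lambda>x. indicat_real (cbox a b) x * B)"
    using emeasure_lborel_cbox_finite[of a b] by (intro integrable_mult_left integrable_real_indicator) auto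
  then show ?thesis
  proof (rule Bochner_Integration.integrable_bound)
    show "G \<in> borel_measurable lborel" by simp
    have "norm (G x) \<le> norm (indicat_real (cbox a b) x * B)" for x
    proof (cases "x \<in> cbox a b")
      case True
      then show ?thesis using B[of x] by simp
    next
      case False
      then have "G x = 0" using 0 ab by blast
      then show ?thesis by simp
    qed
    then show "AE x in lborel. norm (G x) \<le> norm (indicat_real (cbox a b) x * B)" by simp
  qed
qed

lemma Fubini_bounded_support:
  fixes G :: "'a::euclidean_space \<times> 'b::euclidean_space \<Rightarrow> complex"
  assumes "G \<in> borel_measurable borel" "bounded S" "bounded T"
    "\<And>x y. x \<notin> S \<or> y \<notin> T \<Longrightarrow> G (x, y) = 0" "\<And>z. norm (G z) \<le> B"
  shows "(\<integral>x. (\<integral>y. G (x, y) \<partial>lborel) \<partial>lborel) = (\<integral>y. (\<integral>x. G (x, y) \<partial>lborel) \<partial>lborel)"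
proof -
  have "integrable lborel G"
    by (rule integrable_bounded_support[where S = "S \<times> T"]) (use assms in \<open>auto simp: bounded_Times\<close>)
  then have "integrable (lborel \<Otimes>\<^sub>M lborel) (case_prod (\<lambda>x y. G (x, y)))"
    by (simp add: lborel_prod)
  from lborel_pair.Fubini_integral[OF this] show ?thesis ..
qed

lemma integral_lborel_linear_vec:
  fixes A :: "real^'n^'n" and F :: "real^'n \<Rightarrow> complex"
  assumes A: "det A \<noteq> 0" and [measurable]: "F \<in> borel_measurable borel"
  shows "(\<integral>x. F x \<partial>lborel) = \<bar>det A\<bar> *\<^sub>R (\<integral>x. F (A *v x) \<partial>lborel)"
proof -
  have [measurable]: "(*v) A \<in> borel_measurable borel"
    by (intro borel_measurable_continuous_onI linear_continuous_on matrix_vector_mul_bounded_linear)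
  have "(\<integral>x. F x \<partial>lborel) = (\<integral>x. F x \<partial>density (distr lborel borel ((*v) A)) (\<lambda>_. ennreal \<bar>det A\<bar>))"
    using lborel_linear_vec[OF A] by simp
  also have "\<dots> = (\<integral>x. \<bar>det A\<bar> *\<^sub>R F x \<partial>distr lborel borel ((*v) A))"
    by (rule integral_density) auto
  also have "\<dots> = (\<integral>x. \<bar>det A\<bar> *\<^sub>R F (A *v x) \<partial>lborel)"
    by (rule integral_distr) auto
  finally show ?thesis by simp
qed

context pos_homog_scaling
begin

definition "W = {\<xi>. 1 \<le> P \<xi> \<and> P \<xi> < exp 1}"

lemma W_sub: "W \<subseteq> shell"
  by (auto simp: W_def shell_def)

lemma W_sets [measurable]: "W \<in> sets borel"
  unfolding W_def by measurable

text \<open>The window \<^term>\<open>W\<close> meets each orbit of the dilations in logarithmic length one; this replaces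
  the surface measure of polar coordinates.\<close>

lemma polar_integral:
  fixes F :: "real^'n \<Rightarrow> complex"
  assumes Fm [measurable]: "F \<in> borel_measurable borel" and B: "\<And>\<xi>. norm (F \<xi>) \<le> B"
    and a: "a > 0" and supp: "\<And>\<xi>. \<not> (a \<le> P \<xi> \<and> P \<xi> \<le> b) \<Longrightarrow> F \<xi> = 0"
  shows "(\<integral>\<xi>. F \<xi> \<partial>lborel) = (\<integral>\<zeta>. indicator W \<zeta> *\<^sub>R (\<integral>u. exp (\<mu> * u) *\<^sub>R F (flow E u *v \<zeta>) \<partial>lborel) \<partial>lborel)"
proof -
  \<comment> \<open>If the orbit point lies between the levels \<open>a\<close> and \<open>b\<close>
    and its base point in \<open>W\<close>, where \<open>P\<close> is between 1 and
    \<open>exp 1\<close>, then \<open>u\<close> lies in this interval. So both applications of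
    Fubini concern bounded functions of bounded support.\<close>
  define I where "I = {ln a - 1..ln b}"
  have P_pos: "P \<xi> > 0" "a \<le> P \<xi>" "P \<xi> \<le> b" if "F \<xi> \<noteq> 0" for \<xi>
    using supp[of \<xi>] that a by force+
  have W_flow: "flow E (- u) *v \<xi> \<in> W \<longleftrightarrow> ln (P \<xi>) - 1 < u \<and> u \<le> ln (P \<xi>)" if "P \<xi> > 0" for \<xi> u
  proof -
    have "flow E (- u) *v \<xi> \<in> W \<longleftrightarrow> exp u \<le> P \<xi> \<and> P \<xi> < exp (1 + u)"
      by (simp add: W_def P_flow exp_minus exp_add field_simps)
    also have "\<dots> \<longleftrightarrow> u \<le> ln (P \<xi>) \<and> ln (P \<xi>) < 1 + u"
      using ln_ge_iff[OF that, of u] ln_ge_iff[OF that, of "1 + u"] by linarith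
    finally show ?thesis by auto
  qed
  have fl [measurable]: "(\<lambda>z. flow E (f z) *v g z) \<in> borel_measurable borel"
    if "continuous_on UNIV f" "continuous_on UNIV g" for f and g :: "'z::euclidean_space \<Rightarrow> real^'n"
    by (intro borel_measurable_continuous_onI continuous_on_flow that)
  \<comment> \<open>The factor 1 is inserted as the length of the set of \<open>u\<close> for which
    \<open>\<xi>\<close>, moved back by \<open>u\<close>, lies in the window.\<close>
  have "(\<integral>\<xi>. F \<xi> \<partial>lborel) = (\<integral>\<xi>. (\<integral>u. indicator W (flow E (- u) *v \<xi>) *\<^sub>R F \<xi> \<partial>lborel) \<partial>lborel)"
  proof (rule Bochner_Integration.integral_cong[OF refl])
    fix \<xi>
    show "F \<xi> = (\<integral>u. indicator W (flow E (- u) *v \<xi>) *\<^sub>R F \<xi> \<partial>lborel)"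
    proof (cases "F \<xi> = 0")
      case False
      have "(\<integral>u. indicator W (flow E (- u) *v \<xi>) *\<^sub>R F \<xi> \<partial>lborel)
          = (\<integral>u. indicator {ln (P \<xi>) - 1<..ln (P \<xi>)} u *\<^sub>R F \<xi> \<partial>lborel)"
        by (rule Bochner_Integration.integral_cong[OF refl]) (simp add: indicator_def W_flow P_pos[OF False])
      also have "\<dots> = F \<xi>"
        by (subst integral_scaleR_left) (auto simp: integrable_real_indicator)
      finally show ?thesis ..
    qed simp
  qed
  also have "\<dots> = (\<integral>u. (\<integral>\<xi>. indicator W (flow E (- u) *v \<xi>) *\<^sub>R F \<xi> \<partial>lborel) \<partial>lborel)"
  proof (rule Fubini_bounded_support[where G = "\<lambda>z. indicator W (flow E (- snd z) *v fst z) *\<^sub>R F (fst z)"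
        and S = "{\<xi>. P \<xi> \<le> b}" and T = I and B = B, simplified fst_conv snd_conv])
    have [measurable]: "(\<lambda>z::(real^'n) \<times> real. flow E (- snd z) *v fst z) \<in> borel_measurable borel"
      "(\<lambda>z::(real^'n) \<times> real. F (fst z)) \<in> borel_measurable borel"
      by (intro fl continuous_intros)
         (rule measurable_compose[OF borel_measurable_continuous_onI Fm], intro continuous_intros)
    show "(\<lambda>z. indicat_real W (flow E (- snd z) *v fst z) *\<^sub>R F (fst z)) \<in> borel_measurable borel"
      by measurable
    show "bounded {\<xi>. P \<xi> \<le> b}" by (rule bounded_sublevel)
    show "bounded I" by (simp add: I_def)
    show "indicat_real W (flow E (- y) *v x) *\<^sub>R F x = 0" if "x \<notin> {\<xi>. P \<xi> \<le> b} \<or> y \<notin> I" for x y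
    proof (rule ccontr)
      assume "\<not> ?thesis"
      then have F: "F x \<noteq> 0" and "flow E (- y) *v x \<in> W" by (auto simp: indicator_def)
      then have "ln (P x) - 1 < y" "y \<le> ln (P x)" using W_flow P_pos(1) by auto
      moreover have "ln a \<le> ln (P x)" "ln (P x) \<le> ln b" using P_pos[OF F] a by auto
      ultimately have "y \<in> I"
        unfolding I_def atLeastAtMost_iff by linarith
      then show False using that P_pos[OF F] by auto
    qed
    show "norm (indicat_real W (flow E (- snd z) *v fst z) *\<^sub>R F (fst z)) \<le> B" for z
      using B[of "fst z"] order_trans[OF norm_ge_zero B[of "fst z"]] by (auto simp: indicator_def)
  qed
  \<comment> \<open>For fixed \<open>u\<close>, substitute the dilated point for the variable; the
    weight \<open>exp (\<mu> * u)\<close> is the Jacobian.\<close>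
  also have "\<dots> = (\<integral>u. (\<integral>\<zeta>. indicator W \<zeta> *\<^sub>R (exp (\<mu> * u) *\<^sub>R F (flow E u *v \<zeta>)) \<partial>lborel) \<partial>lborel)"
  proof (rule Bochner_Integration.integral_cong[OF refl])
    fix u
    have d: "det (flow E u) \<noteq> 0" "\<bar>det (flow E u)\<bar> = exp (\<mu> * u)"
      by (simp_all add: det_flow \<mu>_def mult.commute)
    have [measurable]: "(\<lambda>\<xi>. flow E (- u) *v \<xi>) \<in> borel_measurable borel"
      by (intro fl continuous_intros)
    have "(\<integral>\<xi>. indicator W (flow E (- u) *v \<xi>) *\<^sub>R F \<xi> \<partial>lborel)
       = \<bar>det (flow E u)\<bar> *\<^sub>R (\<integral>\<zeta>. indicator W (flow E (- u) *v (flow E u *v \<zeta>)) *\<^sub>R F (flow E u *v \<zeta>) \<partial>lborel)"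
      by (rule integral_lborel_linear_vec[OF d(1)]) measurable
    then show "(\<integral>\<xi>. indicator W (flow E (- u) *v \<xi>) *\<^sub>R F \<xi> \<partial>lborel)
       = (\<integral>\<zeta>. indicator W \<zeta> *\<^sub>R (exp (\<mu> * u) *\<^sub>R F (flow E u *v \<zeta>)) \<partial>lborel)"
      unfolding d(2) flow_minus_vec scaleR_left_commute[of "indicat_real W z" for z]
      by (simp only: integral_scaleR_right)
  qed
  also have "\<dots> = (\<integral>\<zeta>. (\<integral>u. indicator W \<zeta> *\<^sub>R (exp (\<mu> * u) *\<^sub>R F (flow E u *v \<zeta>)) \<partial>lborel) \<partial>lborel)"
  proof (rule Fubini_bounded_support[where G = "\<lambda>z. indicator W (snd z) *\<^sub>R (exp (\<mu> * fst z) *\<^sub>R F (flow E (fst z) *v snd z))"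
        and T = shell and S = I and B = "exp (\<bar>\<mu>\<bar> * (\<bar>ln a - 1\<bar> + \<bar>ln b\<bar>)) * B", simplified fst_conv snd_conv])
    have [measurable]: "(\<lambda>z::real \<times> (real^'n). F (flow E (fst z) *v snd z)) \<in> borel_measurable borel"
      by (rule measurable_compose[OF fl Fm]) (intro continuous_intros)+
    have [measurable]: "(\<lambda>z::real \<times> (real^'n). snd z) \<in> borel_measurable borel"
      "(\<lambda>z::real \<times> (real^'n). exp (\<mu> * fst z)) \<in> borel_measurable borel"
      by (intro borel_measurable_continuous_onI continuous_intros)+
    show "(\<lambda>z. indicat_real W (snd z) *\<^sub>R (exp (\<mu> * fst z) *\<^sub>R F (flow E (fst z) *v snd z))) \<in> borel_measurable borel"
      by measurable
    show "bounded shell" using compact_shell by (rule compact_imp_bounded)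
    show "bounded I" by (simp add: I_def)
    have inI: "x \<in> I" if "y \<in> W" "F (flow E x *v y) \<noteq> 0" for x y
    proof -
      have p: "a \<le> exp x * P y" "exp x * P y \<le> b"
        using P_pos[OF that(2)] by (simp_all add: P_flow)
      have y: "1 \<le> P y" "P y < exp 1" using that(1) by (auto simp: W_def)
      have "a \<le> exp x * exp 1" using p(1) y by (meson exp_ge_zero less_imp_le mult_left_mono order_trans)
      then have "ln a \<le> ln (exp (x + 1))" using a by (subst ln_le_cancel_iff) (auto simp: exp_add)
      then have 1: "ln a \<le> x + 1" by simp
      have "exp x * 1 \<le> exp x * P y" using y by (intro mult_left_mono) auto
      then have b: "exp x \<le> b" using p(2) by linarith
      then have "b > 0" using exp_gt_zero[of x] by linarith
      then have "x \<le> ln b" using b by (simp add: ln_ge_iff)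
      with 1 show ?thesis by (simp add: I_def)
    qed
    show "indicat_real W y *\<^sub>R (exp (\<mu> * x) *\<^sub>R F (flow E x *v y)) = 0" if "x \<notin> I \<or> y \<notin> shell" for x y
    proof (cases "y \<in> W \<and> F (flow E x *v y) \<noteq> 0")
      case True
      then show ?thesis using that inI[of y x] W_sub by blast
    qed auto
    have B0: "B \<ge> 0" using B norm_ge_zero order_trans by blast
    show "norm (indicat_real W (snd z) *\<^sub>R (exp (\<mu> * fst z) *\<^sub>R F (flow E (fst z) *v snd z)))
       \<le> exp (\<bar>\<mu>\<bar> * (\<bar>ln a - 1\<bar> + \<bar>ln b\<bar>)) * B" for z
    proof (cases "snd z \<in> W \<and> F (flow E (fst z) *v snd z) \<noteq> 0")
      case True
      then have "fst z \<in> I" using inI by blast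
      then have z: "\<bar>fst z\<bar> \<le> \<bar>ln a - 1\<bar> + \<bar>ln b\<bar>"
        unfolding I_def atLeastAtMost_iff by linarith
      have "\<mu> * fst z \<le> \<bar>\<mu>\<bar> * \<bar>fst z\<bar>"
        unfolding abs_mult[symmetric] by (rule abs_ge_self)
      also have "\<dots> \<le> \<bar>\<mu>\<bar> * (\<bar>ln a - 1\<bar> + \<bar>ln b\<bar>)"
        using z by (intro mult_left_mono) auto
      finally have "exp (\<mu> * fst z) * norm (F (flow E (fst z) *v snd z)) \<le> exp (\<bar>\<mu>\<bar> * (\<bar>ln a - 1\<bar> + \<bar>ln b\<bar>)) * B"
        using B by (intro mult_mono) auto
      then show ?thesis using True by simp
    qed (use B0 in auto)
  qed
  also have "\<dots> = (\<integral>\<zeta>. indicator W \<zeta> *\<^sub>R (\<integral>u. exp (\<mu> * u) *\<^sub>R F (flow E u *v \<zeta>) \<partial>lborel) \<partial>lborel)"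
    by (simp only: integral_scaleR_right)
  finally show ?thesis .
qed

text \<open>Reduces an integral over an annulus to one-dimensional integrals along orbits, bounded
  uniformly in the base point. Absolute integrability is a soft matter, by continuity on the closed
  annulus; the quantitative bound rests on cancellation in \<open>inner\<close>. The annulus is
  half-open so that annuli can be joined without overlap.\<close>

lemma polar_bound:
  fixes f :: "real^'n \<Rightarrow> complex"
  assumes a: "0 < a" and ab: "a \<le> b" and f: "continuous_on {\<xi>. a \<le> P \<xi> \<and> P \<xi> \<le> b} f" and M: "M \<ge> 0"
    and inner: "\<And>\<zeta> \<alpha> \<beta>. \<zeta> \<in> shell \<Longrightarrow> \<alpha> \<le> \<beta> \<Longrightarrow> ln a - 1 \<le> \<alpha> \<Longrightarrow>
       (\<And>u. u \<in> {\<alpha>..\<beta>} \<Longrightarrow> a \<le> exp u * P \<zeta> \<and> exp u * P \<zeta> \<le> b) \<Longrightarrow>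
       norm (integral {\<alpha>..\<beta>} (\<lambda>u. exp (\<mu> * u) *\<^sub>R f (flow E u *v \<zeta>))) \<le> M"
  shows "f absolutely_integrable_on {\<xi>. a \<le> P \<xi> \<and> P \<xi> < b}"
    "norm (integral {\<xi>. a \<le> P \<xi> \<and> P \<xi> < b} f) \<le> M * measure lborel shell"
proof -
  define A where "A = {\<xi>. a \<le> P \<xi> \<and> P \<xi> < b}"
  define A' where "A' = {\<xi>. a \<le> P \<xi> \<and> P \<xi> \<le> b}"
  define F where "F = (\<lambda>\<xi>. indicator A \<xi> *\<^sub>R f \<xi>)"
  have AA: "A \<subseteq> A'" by (auto simp: A_def A'_def)
  have A'c: "compact A'"
  proof -
    have "closed A'"
      unfolding A'_def by (intro closed_Collect_conj closed_Collect_le P_cont continuous_on_const)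
    moreover have "bounded A'"
      by (rule bounded_subset[OF bounded_sublevel[of b]]) (auto simp: A'_def)
    ultimately show ?thesis by (simp add: compact_eq_bounded_closed)
  qed
  have As: "A \<in> sets borel" unfolding A_def by measurable
  have Fm [measurable]: "F \<in> borel_measurable borel"
    unfolding F_def using As continuous_on_subset[OF f] AA
    by (intro borel_measurable_continuous_on_indicator) (auto simp: A'_def)
  have "bounded (f ` A')"
    using A'c f by (intro compact_imp_bounded compact_continuous_image) (auto simp: A'_def)
  then obtain B where B: "\<And>\<xi>. \<xi> \<in> A' \<Longrightarrow> norm (f \<xi>) \<le> B" "B > 0"
    by (auto simp: bounded_pos)
  have FB: "norm (F \<xi>) \<le> B" for \<xi>
    using B AA by (auto simp: F_def indicator_def)
  have iF: "integrable lborel F"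
    by (rule integrable_bounded_support[OF Fm _ _ FB, of A'])
       (use A'c compact_imp_bounded AA in \<open>auto simp: F_def indicator_def\<close>)
  then have "set_integrable lborel A f" by (simp add: set_integrable_def F_def)
  then have "set_integrable lebesgue A f"
    by (simp add: set_integrable_def integrable_completion F_def[symmetric] Fm iF)
  then show "f absolutely_integrable_on {\<xi>. a \<le> P \<xi> \<and> P \<xi> < b}"
    by (simp add: A_def)
  have J: "norm (\<integral>u. exp (\<mu> * u) *\<^sub>R F (flow E u *v \<zeta>) \<partial>lborel) \<le> M" if "\<zeta> \<in> shell" for \<zeta>
  proof -
    \<comment> \<open>The times at which the orbit of \<open>\<zeta>\<close> enters and leaves the
      annulus. As \<open>P \<zeta>\<close> is at most \<open>exp 1\<close>, entry occurs no earlier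
      than \<open>ln a - 1\<close>.\<close>
    define \<alpha> where "\<alpha> = ln (a / P \<zeta>)"
    define \<beta> where "\<beta> = ln (b / P \<zeta>)"
    have z: "1 \<le> P \<zeta>" "P \<zeta> \<le> exp 1" using that by (auto simp: shell_def)
    have \<alpha>\<beta>: "\<alpha> \<le> \<beta>" using a ab z by (simp add: \<alpha>_def \<beta>_def divide_right_mono)
    have P\<zeta>: "ln (P \<zeta>) \<le> 1" using z by (metis exp_gt_zero ln_exp ln_le_cancel_iff order_less_le_trans zero_less_one)
    have e\<alpha>\<beta>: "exp \<alpha> = a / P \<zeta>" "exp \<beta> = b / P \<zeta>"
      using a ab z by (simp_all add: \<alpha>_def \<beta>_def)
    have iff: "a \<le> exp u * P \<zeta> \<longleftrightarrow> \<alpha> \<le> u" "exp u * P \<zeta> \<le> b \<longleftrightarrow> u \<le> \<beta>" "exp u * P \<zeta> < b \<longleftrightarrow> u < \<beta>" for u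
    proof -
      have "a \<le> exp u * P \<zeta> \<longleftrightarrow> a / P \<zeta> \<le> exp u" "exp u * P \<zeta> \<le> b \<longleftrightarrow> exp u \<le> b / P \<zeta>"
        "exp u * P \<zeta> < b \<longleftrightarrow> exp u < b / P \<zeta>"
        using z by (auto simp: field_simps)
      then show "a \<le> exp u * P \<zeta> \<longleftrightarrow> \<alpha> \<le> u" "exp u * P \<zeta> \<le> b \<longleftrightarrow> u \<le> \<beta>" "exp u * P \<zeta> < b \<longleftrightarrow> u < \<beta>"
        unfolding e\<alpha>\<beta>[symmetric] by simp_all
    qed
    define g where "g = (\<lambda>u. exp (\<mu> * u) *\<^sub>R f (flow E u *v \<zeta>))"
    have gc: "continuous_on {\<alpha>..\<beta>} g"
      unfolding g_def
      by (intro continuous_intros continuous_on_compose2[OF f] continuous_on_flow) (auto simp: P_flow iff)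
    have "(\<lambda>u. exp (\<mu> * u) *\<^sub>R F (flow E u *v \<zeta>)) = (\<lambda>u. indicator {\<alpha>..<\<beta>} u *\<^sub>R g u)"
      by (auto simp: fun_eq_iff F_def g_def A_def indicator_def P_flow iff)
    \<comment> \<open>The half-open annulus produces a half-open interval; its right endpoint is a
      null set.\<close>
    moreover have "(LINT u:{\<alpha>..<\<beta>}|lborel. g u) = (LINT u:{\<alpha>..\<beta>}|lborel. g u)"
      unfolding set_lebesgue_integral_def
    proof (rule integral_cong_AE)
      have "(\<lambda>u. indicat_real {\<alpha>..\<beta>} u *\<^sub>R g u) \<in> borel_measurable borel"
        by (rule borel_measurable_continuous_on_indicator[OF _ gc]) simp
      moreover have "(\<lambda>u. indicat_real {\<alpha>..<\<beta>} u *\<^sub>R g u) \<in> borel_measurable borel"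
        by (rule borel_measurable_continuous_on_indicator[OF _ continuous_on_subset[OF gc]]) auto
      ultimately show "(\<lambda>u. indicat_real {\<alpha>..\<beta>} u *\<^sub>R g u) \<in> borel_measurable lborel"
        "(\<lambda>u. indicat_real {\<alpha>..<\<beta>} u *\<^sub>R g u) \<in> borel_measurable lborel" by simp_all
      show "AE u in lborel. indicat_real {\<alpha>..<\<beta>} u *\<^sub>R g u = indicat_real {\<alpha>..\<beta>} u *\<^sub>R g u"
        using AE_lborel_singleton[of \<beta>] by eventually_elim (auto simp: indicator_def)
    qed
    moreover have "\<dots> = integral {\<alpha>..\<beta>} g"
      by (rule set_borel_integral_eq_integral[OF borel_integrable_atLeastAtMost'[OF gc]])
    ultimately have "(\<integral>u. exp (\<mu> * u) *\<^sub>R F (flow E u *v \<zeta>) \<partial>lborel) = integral {\<alpha>..\<beta>} g"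
      by (simp add: set_lebesgue_integral_def)
    moreover have "norm (integral {\<alpha>..\<beta>} g) \<le> M"
      unfolding g_def by (rule inner[OF that \<alpha>\<beta>]) (use a z P\<zeta> in \<open>auto simp: iff \<alpha>_def ln_div\<close>)
    ultimately show ?thesis by simp
  qed
  have "integral A f = integral UNIV F"
    unfolding F_def by (simp add: indicator_def of_bool_def if_distrib[of "\<lambda>c. c *\<^sub>R _"] integral_restrict_UNIV cong: if_cong)
  also have "\<dots> = (\<integral>\<xi>. F \<xi> \<partial>lborel)"
    by (rule integral_lborel[OF iF])
  also have "\<dots> = (\<integral>\<zeta>. indicator W \<zeta> *\<^sub>R (\<integral>u. exp (\<mu> * u) *\<^sub>R F (flow E u *v \<zeta>) \<partial>lborel) \<partial>lborel)"
    by (rule polar_integral[OF Fm FB a, of b]) (auto simp: F_def A_def)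
  also have "norm \<dots> \<le> (\<integral>\<zeta>. norm (indicator W \<zeta> *\<^sub>R (\<integral>u. exp (\<mu> * u) *\<^sub>R F (flow E u *v \<zeta>) \<partial>lborel)) \<partial>lborel)"
    by (rule integral_norm_bound)
  also have "\<dots> \<le> (\<integral>\<zeta>. M * indicator shell \<zeta> \<partial>lborel)"
  proof (rule Bochner_Integration.integral_mono')
    show "integrable lborel (\<lambda>\<zeta>. M * indicat_real shell \<zeta>)"
      using compact_shell emeasure_bounded_finite[OF compact_imp_bounded[OF compact_shell]]
      by (intro integrable_mult_right integrable_real_indicator) (auto simp: compact_imp_closed borel_closed)
    show "norm (indicator W \<zeta> *\<^sub>R (\<integral>u. exp (\<mu> * u) *\<^sub>R F (flow E u *v \<zeta>) \<partial>lborel)) \<le> M * indicat_real shell \<zeta>" for \<zeta>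
      using J[of \<zeta>] W_sub M by (auto simp: indicator_def)
  qed (use M in auto)
  also have "\<dots> = M * measure lborel shell"
    using compact_shell by (simp add: compact_imp_closed borel_closed)
  finally show "norm (integral {\<xi>. a \<le> P \<xi> \<and> P \<xi> < b} f) \<le> M * measure lborel shell"
    by (simp add: A_def)
qed

end

section \<open>Oscillatory and exponential integrals\<close>

text \<open>One integration by parts against the phase. Dividing the weight
  \<open>exp (\<mu> * u)\<close> by a phase derivative of size at least \<open>c * N * exp u\<close>
  leaves terms of size \<open>exp (u * (\<mu> - 1)) / N\<close>, integrable towards plus infinity
  because \<open>\<mu> < 1\<close>. So only the left endpoint enters: \<open>2 / c\<close> comes
  from the two boundary terms, the remaining summand from the new integral.\<close>

lemma oscillatory_integral_bound:
  fixes \<phi> \<phi>1 \<phi>2 :: "real \<Rightarrow> real" and A A1 :: "real \<Rightarrow> complex"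
  assumes \<mu>: "\<mu> < 1" and c: "c > 0" and D: "D \<ge> 0" and N: "N > 0" and ab: "\<alpha> \<le> \<beta>"
    and d\<phi>: "\<And>u. u \<in> {\<alpha>..\<beta>} \<Longrightarrow> (\<phi> has_real_derivative \<phi>1 u) (at u within {\<alpha>..\<beta>})"
    and d\<phi>1: "\<And>u. u \<in> {\<alpha>..\<beta>} \<Longrightarrow> (\<phi>1 has_real_derivative \<phi>2 u) (at u within {\<alpha>..\<beta>})"
    and dA: "\<And>u. u \<in> {\<alpha>..\<beta>} \<Longrightarrow> (A has_vector_derivative A1 u) (at u within {\<alpha>..\<beta>})"
    and \<phi>1: "\<And>u. u \<in> {\<alpha>..\<beta>} \<Longrightarrow> \<bar>\<phi>1 u\<bar> \<ge> c * N * exp u"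
    and \<phi>2: "\<And>u. u \<in> {\<alpha>..\<beta>} \<Longrightarrow> \<bar>\<phi>2 u\<bar> \<le> D * N * exp u"
    and A: "\<And>u. u \<in> {\<alpha>..\<beta>} \<Longrightarrow> norm (A u) \<le> 1"
    and A1: "\<And>u. u \<in> {\<alpha>..\<beta>} \<Longrightarrow> norm (A1 u) \<le> D"
  shows "norm (integral {\<alpha>..\<beta>} (\<lambda>u. exp (- (\<i> * of_real (\<phi> u))) * (exp (\<mu> * u) *\<^sub>R A u)))
     \<le> (2 / c + ((D + \<bar>\<mu>\<bar>) / c + D / c\<^sup>2) / (1 - \<mu>)) * exp (\<alpha> * (\<mu> - 1)) / N"
proof -
  let ?I = "{\<alpha>..\<beta>}"
  define L where "L = (D + \<bar>\<mu>\<bar>) / c + D / c\<^sup>2"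
  define e where "e = (\<lambda>u. exp (- (\<i> * of_real (\<phi> u))))"
  define b where "b = (\<lambda>u. exp (\<mu> * u) / \<phi>1 u)"
  define b1 where "b1 = (\<lambda>u. (exp (\<mu> * u) * \<mu>) / \<phi>1 u - exp (\<mu> * u) * \<phi>2 u / (\<phi>1 u)\<^sup>2)"
  have pos: "c * N * exp u > 0" for u using c N by simp
  have nz: "\<phi>1 u \<noteq> 0" if "u \<in> ?I" for u using \<phi>1[OF that] pos[of u] by auto
  have ne: "norm (e u) = 1" for u by (simp add: e_def)
  have de: "(e has_vector_derivative (- \<i> * of_real (\<phi>1 u)) * e u) (at u within ?I)" if "u \<in> ?I" for u
  proof -
    have "((\<lambda>u. - (\<i> * of_real (\<phi> u))) has_vector_derivative - (\<i> * of_real (\<phi>1 u))) (at u within ?I)"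
      by (intro derivative_intros d\<phi> that has_vector_derivative_minus has_vector_derivative_mult_right
            has_vector_derivative_of_real)
    from field_vector_diff_chain_within[OF this DERIV_exp[THEN has_field_derivative_at_within]]
    show ?thesis by (simp add: e_def o_def)
  qed
  have db: "(b has_real_derivative b1 u) (at u within ?I)" if "u \<in> ?I" for u
    unfolding b_def b1_def using nz[OF that]
    by (auto intro!: derivative_eq_intros d\<phi>1 that simp: field_simps power2_eq_square)
  have dB: "((\<lambda>u. b u *\<^sub>R A u) has_vector_derivative (b u *\<^sub>R A1 u + b1 u *\<^sub>R A u)) (at u within ?I)" if "u \<in> ?I" for u
    by (intro has_vector_derivative_scaleR db dA that)
  \<comment> \<open>The primitive up to an error: differentiating the exponential produces
    \<open>- \<i> * \<phi>1\<close>, which cancels both the factor \<open>\<i>\<close> and the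
    denominator of \<open>b\<close>. So the derivative of \<open>H\<close> is the integrand
    \<open>f\<close> plus the remainder \<open>r\<close>.\<close>
  define H where "H = (\<lambda>u. \<i> * (e u * (b u *\<^sub>R A u)))"
  define r where "r = (\<lambda>u. \<i> * (e u * (b u *\<^sub>R A1 u + b1 u *\<^sub>R A u)))"
  define f where "f = (\<lambda>u. e u * (exp (\<mu> * u) *\<^sub>R A u))"
  have dH: "(H has_vector_derivative f u + r u) (at u within ?I)" if "u \<in> ?I" for u
  proof -
    have "(H has_vector_derivative \<i> * (e u * (b u *\<^sub>R A1 u + b1 u *\<^sub>R A u) + ((- \<i> * of_real (\<phi>1 u)) * e u) * (b u *\<^sub>R A u)))
       (at u within ?I)"
      unfolding H_def by (intro has_vector_derivative_mult_right has_vector_derivative_mult de dB that)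
    also have "\<i> * (e u * (b u *\<^sub>R A1 u + b1 u *\<^sub>R A u) + ((- \<i> * of_real (\<phi>1 u)) * e u) * (b u *\<^sub>R A u)) = f u + r u"
      using nz[OF that] by (simp add: f_def r_def b_def algebra_simps scaleR_conv_of_real)
    finally show ?thesis .
  qed
  have iH: "((\<lambda>u. f u + r u) has_integral (H \<beta> - H \<alpha>)) ?I"
    by (rule fundamental_theorem_of_calculus[OF ab dH])
  have ce: "continuous_on ?I e"
    using de by (intro continuous_on_vector_derivative)
  have cA: "continuous_on ?I A"
    using dA by (intro continuous_on_vector_derivative)
  have if': "f integrable_on ?I"
    unfolding f_def by (intro integrable_continuous_real continuous_intros ce cA)
  have "(\<lambda>u. (f u + r u) - f u) integrable_on ?I"
    using iH if' by (intro integrable_diff) auto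
  then have ir: "r integrable_on ?I" by simp
  have "integral ?I f + integral ?I r = H \<beta> - H \<alpha>"
    using integral_add[OF if' ir] iH by (simp add: integral_unique)
  then have "integral ?I f = H \<beta> - H \<alpha> - integral ?I r" by (simp add: algebra_simps)
  also have "norm \<dots> \<le> norm (H \<beta>) + norm (H \<alpha>) + norm (integral ?I r)"
    by (meson add_mono norm_triangle_ineq4 order_refl order_trans)
  finally have 1: "norm (integral ?I f) \<le> norm (H \<beta>) + norm (H \<alpha>) + norm (integral ?I r)" .
  have bb: "\<bar>b u\<bar> \<le> exp (u * (\<mu> - 1)) / (c * N)" if "u \<in> ?I" for u
  proof -
    have "\<bar>b u\<bar> = exp (\<mu> * u) / \<bar>\<phi>1 u\<bar>" by (simp add: b_def)
    also have "\<dots> \<le> exp (\<mu> * u) / (c * N * exp u)"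
      using \<phi>1[OF that] pos[of u] by (intro divide_left_mono) auto
    also have "\<dots> = exp (u * (\<mu> - 1)) / (c * N)"
      by (simp add: algebra_simps exp_diff)
    finally show ?thesis .
  qed
  have bH: "norm (H u) \<le> exp (\<alpha> * (\<mu> - 1)) / (c * N)" if "u \<in> ?I" for u
  proof -
    have "norm (H u) \<le> \<bar>b u\<bar> * 1"
      unfolding H_def norm_mult ne norm_scaleR using A[OF that] by (simp add: mult_left_le)
    also have "\<dots> \<le> exp (u * (\<mu> - 1)) / (c * N)" using bb[OF that] by simp
    also have "\<dots> \<le> exp (\<alpha> * (\<mu> - 1)) / (c * N)"
      using that \<mu> c N by (intro divide_right_mono) (auto intro: mult_right_mono_neg)
    finally show ?thesis .
  qed
  have br: "norm (r u) \<le> L / N * exp (u * (\<mu> - 1))" if "u \<in> ?I" for u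
  proof -
    have b1: "\<bar>b1 u\<bar> \<le> (\<bar>\<mu>\<bar> / c + D / c\<^sup>2) / N * exp (u * (\<mu> - 1))"
    proof -
      have "b1 u = \<mu> * b u - b u * (\<phi>2 u / \<phi>1 u)"
        by (simp add: b1_def b_def power2_eq_square)
      then have "\<bar>b1 u\<bar> \<le> \<bar>\<mu>\<bar> * \<bar>b u\<bar> + \<bar>b u\<bar> * (\<bar>\<phi>2 u\<bar> / \<bar>\<phi>1 u\<bar>)"
        using abs_triangle_ineq4[of "\<mu> * b u" "b u * (\<phi>2 u / \<phi>1 u)"] by (simp add: abs_mult)
      also have "\<dots> = (\<bar>\<mu>\<bar> + \<bar>\<phi>2 u\<bar> / \<bar>\<phi>1 u\<bar>) * \<bar>b u\<bar>" by (simp add: algebra_simps)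
      also have "\<bar>\<phi>2 u\<bar> / \<bar>\<phi>1 u\<bar> \<le> (D * N * exp u) / (c * N * exp u)"
        using \<phi>1[OF that] \<phi>2[OF that] pos[of u] by (intro frac_le) auto
      also have "(D * N * exp u) / (c * N * exp u) = D / c" using N by simp
      finally have "\<bar>b1 u\<bar> \<le> (\<bar>\<mu>\<bar> + D / c) * \<bar>b u\<bar>" by (simp add: mult_right_mono)
      also have "\<dots> \<le> (\<bar>\<mu>\<bar> + D / c) * (exp (u * (\<mu> - 1)) / (c * N))"
        using bb[OF that] c D by (intro mult_left_mono) auto
      also have "\<dots> = (\<bar>\<mu>\<bar> / c + D / c\<^sup>2) / N * exp (u * (\<mu> - 1))"
        using c N by (simp add: field_simps power2_eq_square)
      finally show ?thesis .
    qed
    have "norm (r u) \<le> norm (b u *\<^sub>R A1 u) + norm (b1 u *\<^sub>R A u)"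
      unfolding r_def norm_mult ne by (simp del: norm_scaleR add: norm_triangle_ineq)
    also have "\<dots> \<le> (exp (u * (\<mu> - 1)) / (c * N)) * D + \<bar>b1 u\<bar> * 1"
      unfolding norm_scaleR using bb[OF that] A[OF that] A1[OF that] c N by (intro add_mono mult_mono) auto
    also have "\<dots> \<le> (exp (u * (\<mu> - 1)) / (c * N)) * D + (\<bar>\<mu>\<bar> / c + D / c\<^sup>2) / N * exp (u * (\<mu> - 1))"
      using b1 by simp
    also have "\<dots> = L / N * exp (u * (\<mu> - 1))"
      using c N by (simp add: L_def field_simps power2_eq_square)
    finally show ?thesis .
  qed
  have iexp: "((\<lambda>u. L / N * exp (u * (\<mu> - 1))) has_integral
      L / N * exp (\<beta> * (\<mu> - 1)) / (\<mu> - 1) - L / N * exp (\<alpha> * (\<mu> - 1)) / (\<mu> - 1)) ?I"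
    by (rule fundamental_theorem_of_calculus[OF ab])
       (use \<mu> N in \<open>auto intro!: derivative_eq_intros simp flip: has_real_derivative_iff_has_vector_derivative\<close>)
  have L0: "L \<ge> 0" using c D by (simp add: L_def)
  have "norm (integral ?I r) \<le> integral ?I (\<lambda>u. L / N * exp (u * (\<mu> - 1)))"
    using iexp br by (intro integral_norm_bound_integral ir) auto
  also have "\<dots> = (L / N) * (exp (\<alpha> * (\<mu> - 1)) - exp (\<beta> * (\<mu> - 1))) / (1 - \<mu>)"
  proof -
    have "p / (\<mu> - 1) - q / (\<mu> - 1) = (q - p) / (1 - \<mu>)" for p q :: real
      using \<mu> by (simp add: divide_simps) (simp add: algebra_simps)
    then show ?thesis
      unfolding integral_unique[OF iexp] by (simp only: right_diff_distrib)
  qed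
  also have "\<dots> \<le> (L / N) * exp (\<alpha> * (\<mu> - 1)) / (1 - \<mu>)"
    using \<mu> N L0 by (intro divide_right_mono mult_left_mono) auto
  finally have r1: "norm (integral ?I r) \<le> L / N * exp (\<alpha> * (\<mu> - 1)) / (1 - \<mu>)" .
  have "norm (integral ?I f) \<le> exp (\<alpha> * (\<mu> - 1)) / (c * N) + exp (\<alpha> * (\<mu> - 1)) / (c * N)
      + (L / N) * exp (\<alpha> * (\<mu> - 1)) / (1 - \<mu>)"
  proof -
    have "norm (H \<alpha>) \<le> exp (\<alpha> * (\<mu> - 1)) / (c * N)" "norm (H \<beta>) \<le> exp (\<alpha> * (\<mu> - 1)) / (c * N)"
      using bH ab by auto
    with 1 r1 show ?thesis
      by linarith
  qed
  also have "\<dots> = (2 / c + L / (1 - \<mu>)) * exp (\<alpha> * (\<mu> - 1)) / N"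
    using c N \<mu> by (simp add: field_simps)
  finally show ?thesis
    unfolding f_def e_def L_def .
qed

text \<open>Termwise comparison of the power series reduces to the real case, which is
  \<open>1 - x \<le> exp (- x)\<close>. It measures the relative error made by dropping the
  remainder terms from an exponent.\<close>

lemma norm_exp_minus_one_le:
  fixes w :: complex
  shows "norm (exp w - 1) \<le> norm w * exp (norm w)"
proof -
  have "norm (exp w - 1) \<le> exp (norm w) - 1"
  proof -
    have s: "(\<lambda>n. w ^ Suc n /\<^sub>R fact (Suc n)) sums (exp w - 1)"
      using exp_converges[of w] sums_Suc_iff[of "\<lambda>n. w ^ n /\<^sub>R fact n" "exp w - 1"] by simp
    have t: "(\<lambda>n. norm w ^ Suc n /\<^sub>R fact (Suc n)) sums (exp (norm w) - 1)"
      using exp_converges[of "norm w"] sums_Suc_iff[of "\<lambda>n. norm w ^ n /\<^sub>R fact n" "exp (norm w) - 1"] by simp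
    have "norm (\<Sum>n. w ^ Suc n /\<^sub>R fact (Suc n)) \<le> (\<Sum>n. norm w ^ Suc n /\<^sub>R fact (Suc n))"
      by (rule norm_suminf_le[OF _ sums_summable[OF t]]) (simp add: norm_mult norm_power)
    then show ?thesis
      using s t by (simp add: sums_iff)
  qed
  also have "exp (norm w) - 1 \<le> norm w * exp (norm w)"
  proof -
    have "(1 - norm w) * exp (norm w) \<le> exp (- norm w) * exp (norm w)"
      using exp_ge_add_one_self[of "- norm w"] by (intro mult_right_mono) auto
    then show ?thesis
      by (simp add: exp_minus algebra_simps)
  qed
  finally show ?thesis .
qed

context pos_homog_scaling
begin

lemma exp_integral_bound':
  obtains C where "C > 0" "\<And>s. s > 0 \<Longrightarrow> integrable lborel (\<lambda>\<xi>. exp (- (s * P \<xi>)))"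
    "\<And>s. s > 0 \<Longrightarrow> (\<integral>\<xi>. exp (- (s * P \<xi>)) \<partial>lborel) \<le> C * s powr (- \<mu>)"
proof -
  obtain C where C: "C > 0" "\<And>s. s > 0 \<Longrightarrow> (\<integral>\<^sup>+\<xi>. ennreal (exp (- (s * P \<xi>))) \<partial>lborel) \<le> ennreal (C * s powr (- \<mu>))"
    using exp_integral_bound by blast
  have int: "integrable lborel (\<lambda>\<xi>. exp (- (s * P \<xi>)))" if "s > 0" for s
  proof (rule integrableI_bounded)
    show "(\<lambda>\<xi>. exp (- (s * P \<xi>))) \<in> borel_measurable lborel" by measurable
    have "(\<integral>\<^sup>+\<xi>. ennreal (norm (exp (- (s * P \<xi>)))) \<partial>lborel) \<le> ennreal (C * s powr (- \<mu>))"
      using C(2)[OF that] by simp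
    then show "(\<integral>\<^sup>+\<xi>. ennreal (norm (exp (- (s * P \<xi>)))) \<partial>lborel) < \<infinity>"
      using le_less_trans ennreal_less_top by fastforce
  qed
  show thesis
  proof
    show "C > 0" by fact
    fix s :: real assume s: "s > 0"
    show "integrable lborel (\<lambda>\<xi>. exp (- (s * P \<xi>)))" by (rule int[OF s])
    have "ennreal (\<integral>\<xi>. exp (- (s * P \<xi>)) \<partial>lborel) = (\<integral>\<^sup>+\<xi>. ennreal (exp (- (s * P \<xi>))) \<partial>lborel)"
      by (rule nn_integral_eq_integral[symmetric, OF int[OF s]]) simp
    also have "\<dots> \<le> ennreal (C * s powr (- \<mu>))" by (rule C(2)[OF s])
    finally show "(\<integral>\<xi>. exp (- (s * P \<xi>)) \<partial>lborel) \<le> C * s powr (- \<mu>)"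
      using C(1) by simp
  qed
qed

text \<open>At a positive point absolute values suffice. With x = n P the relative error is at most
  a small multiple of x exp (x / 4), which the decay exp (- x) absorbs; what is left integrates to
  the order \<open>n powr (- \<mu>)\<close> by \<open>exp_integral_bound'\<close>. Uniformity in
  \<open>y\<close> is automatic, as \<open>y\<close> enters through a factor of modulus one.\<close>

lemma pos_local_bounds:
  fixes Q Qt Rt :: "real^'n \<Rightarrow> real"
  assumes Qc: "continuous_on UNIV Q" and U: "open U" "0 \<in> U"
    and Qtc: "continuous_on U Qt" and Rtc: "continuous_on U Rt" and zero: "Qt 0 = 0" "Rt 0 = 0"
    and sQ: "subhomog E Qt" and sR: "subhomog E Rt"
  defines "a \<equiv> \<lambda>n y \<xi>. exp (- (of_real n * (of_real (P \<xi>) + \<i> * of_real (Q \<xi>)))) * exp (- \<i> * of_real (y \<bullet> \<xi>))"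
  obtains C \<delta>0 where "C > 0" "\<delta>0 > 0" "{\<xi>. P \<xi> < \<delta>0} \<subseteq> U"
    "\<And>\<xi>. P \<xi> < \<delta>0 \<Longrightarrow> \<bar>Rt \<xi>\<bar> \<le> P \<xi> / 2"
    "\<And>n y. n \<ge> 1 \<Longrightarrow> norm (integral UNIV (a n y)) \<le> C * n powr (- \<mu>)"
    "\<And>\<delta> \<epsilon>. 0 < \<delta> \<Longrightarrow> \<delta> \<le> \<delta>0 \<Longrightarrow> \<epsilon> > 0 \<Longrightarrow> \<forall>\<^sub>F n in at_top. \<forall>y.
       norm (integral {\<xi>. P \<xi> < \<delta>} (\<lambda>\<xi>. a n y \<xi> * exp (- (of_real n * (of_real (Rt \<xi>) + \<i> * of_real (Qt \<xi>)))))
         - integral UNIV (a n y)) \<le> \<epsilon> * n powr (- \<mu>)"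
proof -
  obtain C where C: "C > 0" and ei: "\<And>s. s > 0 \<Longrightarrow> integrable lborel (\<lambda>\<xi>. exp (- (s * P \<xi>)))"
    and eb: "\<And>s. s > 0 \<Longrightarrow> (\<integral>\<xi>. exp (- (s * P \<xi>)) \<partial>lborel) \<le> C * s powr (- \<mu>)"
    using exp_integral_bound' by blast
  have small: "\<exists>\<delta>>0. \<forall>\<xi>. P \<xi> < \<delta> \<longrightarrow> \<bar>Qt \<xi>\<bar> \<le> \<eta> * P \<xi> \<and> \<bar>Rt \<xi>\<bar> \<le> \<eta> * P \<xi>" if \<eta>: "\<eta> > 0" for \<eta>
  proof -
    obtain d1 where d1: "d1 > 0" "\<And>\<xi>. P \<xi> < d1 \<Longrightarrow> \<bar>Qt \<xi>\<bar> \<le> \<eta> * P \<xi>"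
      by (rule little_o[of Qt \<eta>]) (use sQ zero \<eta> in \<open>auto simp: subhomog_def\<close>)
    obtain d2 where d2: "d2 > 0" "\<And>\<xi>. P \<xi> < d2 \<Longrightarrow> \<bar>Rt \<xi>\<bar> \<le> \<eta> * P \<xi>"
      by (rule little_o[of Rt \<eta>]) (use sR zero \<eta> in \<open>auto simp: subhomog_def\<close>)
    show ?thesis
      by (rule exI[of _ "min d1 d2"]) (use d1 d2 in auto)
  qed
  \<comment> \<open>On this neighbourhood \<open>Rt\<close> consumes at most half of the decay; it
    is fixed before any accuracy is prescribed.\<close>
  obtain d0 where d0: "d0 > 0" "\<And>\<xi>. P \<xi> < d0 \<Longrightarrow> \<bar>Qt \<xi>\<bar> \<le> (1/2) * P \<xi> \<and> \<bar>Rt \<xi>\<bar> \<le> (1/2) * P \<xi>"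
    using small[of "1/2"] by auto
  obtain dU where dU: "dU > 0" "{\<xi>. P \<xi> < dU} \<subseteq> U"
    using small_sublevel[OF U] by blast
  define \<delta>0 where "\<delta>0 = min d0 dU"
  have na: "norm (a n y \<xi>) = exp (- (n * P \<xi>))" for n y \<xi>
    by (simp add: a_def norm_mult norm_exp_eq_Re)
  have ac: "continuous_on UNIV (a n y)" for n y
    unfolding a_def by (intro continuous_intros Qc P_cont)
  have ia: "integrable lborel (a n y)" if "n > 0" for n y
    by (rule Bochner_Integration.integrable_bound[OF ei[OF that]])
       (use ac[of n y] in \<open>auto simp: na intro: borel_measurable_continuous_onI\<close>)
  show thesis
  proof (rule that[of C \<delta>0])
    show "\<delta>0 > 0" using d0 dU by (simp add: \<delta>0_def)
    show "{\<xi>. P \<xi> < \<delta>0} \<subseteq> U" using dU by (auto simp: \<delta>0_def)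
    show "\<bar>Rt \<xi>\<bar> \<le> P \<xi> / 2" if "P \<xi> < \<delta>0" for \<xi> using d0(2)[of \<xi>] that by (auto simp: \<delta>0_def)
    show "norm (integral UNIV (a n y)) \<le> C * n powr (- \<mu>)" if "n \<ge> 1" for n y
    proof -
      have n: "n > 0" using that by simp
      have "norm (integral UNIV (a n y)) = norm (\<integral>\<xi>. a n y \<xi> \<partial>lborel)"
        by (simp add: integral_lborel[OF ia[OF n]])
      also have "\<dots> \<le> (\<integral>\<xi>. norm (a n y \<xi>) \<partial>lborel)" by (rule integral_norm_bound)
      also have "\<dots> \<le> C * n powr (- \<mu>)" using eb[OF n] by (simp add: na)
      finally show ?thesis .
    qed
    fix \<delta> \<epsilon> :: real
    assume \<delta>: "0 < \<delta>" "\<delta> \<le> \<delta>0" and \<epsilon>: "\<epsilon> > 0"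
    let ?N = "{\<xi>. P \<xi> < \<delta>}"
    \<comment> \<open>The factor \<open>4 powr \<mu>\<close> pays for using the integral bound at
      \<open>n / 4\<close>, the rate of decay that survives all estimates.\<close>
    define B where "B = C * 4 powr \<mu>"
    have B: "B > 0" using C by (simp add: B_def)
    \<comment> \<open>The bound 1/8 keeps the exponent error below x / 4, and the second entry makes
      the resulting error at most half of the prescribed \<open>\<epsilon>\<close>.\<close>
    define \<eta> where "\<eta> = min (1/8) (\<epsilon> / (16 * B))"
    have \<eta>: "\<eta> > 0" "\<eta> \<le> 1/8" "8 * \<eta> * B \<le> \<epsilon> / 2"
    proof -
      show "\<eta> > 0" "\<eta> \<le> 1/8" using \<epsilon> B by (auto simp: \<eta>_def)
      have "8 * B * \<eta> \<le> 8 * B * (\<epsilon> / (16 * B))"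
        using B by (intro mult_left_mono) (auto simp: \<eta>_def)
      also have "\<dots> = \<epsilon> / 2" using B by simp
      finally show "8 * \<eta> * B \<le> \<epsilon> / 2" by (simp add: mult_ac)
    qed
    obtain d1 where d1: "d1 > 0" "\<And>\<xi>. P \<xi> < d1 \<Longrightarrow> \<bar>Qt \<xi>\<bar> \<le> \<eta> * P \<xi> \<and> \<bar>Rt \<xi>\<bar> \<le> \<eta> * P \<xi>"
      using small[OF \<eta>(1)] by auto
    \<comment> \<open>The neighbourhood given by \<open>\<delta>\<close> stays fixed; only this
      inner radius depends on \<open>\<epsilon>\<close>. The region in between is exponentially
      small in \<open>n\<close>.\<close>
    define \<delta>1 where "\<delta>1 = min d1 \<delta>"
    have \<delta>1: "\<delta>1 > 0" using d1 \<delta> by (simp add: \<delta>1_def)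
    have "((\<lambda>n. 2 * exp (- (n * \<delta>1 / 4)) * B) \<longlongrightarrow> 0) at_top"
      using \<delta>1 by real_asymp
    then have "\<forall>\<^sub>F n in at_top. 2 * exp (- (n * \<delta>1 / 4)) * B < \<epsilon> / 2"
      using \<epsilon> by (intro order_tendstoD) auto
    then show "\<forall>\<^sub>F n in at_top. \<forall>y.
       norm (integral ?N (\<lambda>\<xi>. a n y \<xi> * exp (- (of_real n * (of_real (Rt \<xi>) + \<i> * of_real (Qt \<xi>)))))
         - integral UNIV (a n y)) \<le> \<epsilon> * n powr (- \<mu>)"
      using eventually_ge_at_top[of 1]
    proof (eventually_elim, intro allI)
      fix n :: real and y :: "real^'n"
      assume n: "2 * exp (- (n * \<delta>1 / 4)) * B < \<epsilon> / 2" "1 \<le> n"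
      define w where "w = (\<lambda>\<xi>. - (of_real n * (of_real (Rt \<xi>) + \<i> * of_real (Qt \<xi>))))"
      define F where "F = (\<lambda>\<xi>. indicat_real ?N \<xi> *\<^sub>R (a n y \<xi> * exp (w \<xi>)))"
      have NU: "?N \<subseteq> U" using dU \<delta> by (auto simp: \<delta>0_def)
      have Fm: "F \<in> borel_measurable borel"
        unfolding F_def w_def
        by (intro borel_measurable_continuous_on_indicator borel_open open_sublevel continuous_intros
             continuous_on_subset[OF ac] continuous_on_subset[OF Qtc] continuous_on_subset[OF Rtc] NU) auto
      have nw: "norm (exp (w \<xi>)) \<le> exp (n * P \<xi> / 2)" if "P \<xi> < \<delta>" for \<xi>
      proof -
        have "\<bar>Rt \<xi>\<bar> \<le> (1/2) * P \<xi>" using d0(2)[of \<xi>] that \<delta> by (auto simp: \<delta>0_def)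
        then have "n * (- Rt \<xi>) \<le> n * (P \<xi> / 2)" using n by (intro mult_left_mono) auto
        then show ?thesis by (simp add: w_def norm_exp_eq_Re)
      qed
      have nF: "norm (F \<xi>) \<le> exp (- (n / 2 * P \<xi>))" for \<xi>
      proof (cases "P \<xi> < \<delta>")
        case True
        then have "norm (F \<xi>) \<le> exp (- (n * P \<xi>)) * exp (n * P \<xi> / 2)"
          using nw[OF True] by (simp add: F_def norm_mult na)
        also have "\<dots> = exp (- (n / 2 * P \<xi>))" by (simp add: algebra_simps flip: exp_add)
        finally show ?thesis .
      qed (simp add: F_def)
      have iF: "integrable lborel F"
        by (rule Bochner_Integration.integrable_bound[OF ei[of "n / 2"]]) (use n Fm nF in auto)
      \<comment> \<open>The first summand covers the points with \<open>P \<xi> < \<delta>1\<close>.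
        The second covers all others, including those outside the neighbourhood, where half of the
        decay \<open>exp (- n / 2 * P)\<close> is given up for the factor
        \<open>exp (- n * \<delta>1 / 4)\<close>.\<close>
      have D: "norm (F \<xi> - a n y \<xi>) \<le> (8 * \<eta> + 2 * exp (- (n * \<delta>1 / 4))) * exp (- (n / 4 * P \<xi>))" for \<xi>
      proof (cases "P \<xi> < \<delta>1")
        case True
        define x where "x = n * P \<xi>"
        have x: "x \<ge> 0" using n P_nonneg by (simp add: x_def)
        have N: "P \<xi> < \<delta>" "P \<xi> < d1" using True by (auto simp: \<delta>1_def)
        have "norm (w \<xi>) \<le> n * (\<bar>Rt \<xi>\<bar> + \<bar>Qt \<xi>\<bar>)"
        proof -
          have "norm (of_real (Rt \<xi>) + \<i> * of_real (Qt \<xi>)) \<le> \<bar>Rt \<xi>\<bar> + \<bar>Qt \<xi>\<bar>"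
            by (rule order_trans[OF norm_triangle_ineq]) (simp add: norm_mult)
          then show ?thesis using n by (simp add: w_def norm_mult)
        qed
        also have "\<dots> \<le> n * (\<eta> * P \<xi> + \<eta> * P \<xi>)"
          using d1(2)[OF N(2)] n by (intro mult_left_mono add_mono) auto
        finally have w: "norm (w \<xi>) \<le> 2 * \<eta> * x" by (simp add: x_def algebra_simps)
        have "2 * \<eta> * x \<le> 2 * (1/8) * x" using \<eta> x by (intro mult_right_mono) auto
        then have w4: "norm (w \<xi>) \<le> x / 4" using w by linarith
        have "F \<xi> - a n y \<xi> = a n y \<xi> * (exp (w \<xi>) - 1)"
          using N by (simp add: F_def algebra_simps)
        then have "norm (F \<xi> - a n y \<xi>) \<le> exp (- x) * (norm (w \<xi>) * exp (norm (w \<xi>)))"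
          using norm_exp_minus_one_le[of "w \<xi>"] by (simp add: norm_mult na x_def)
        also have "\<dots> \<le> exp (- x) * ((2 * \<eta> * x) * exp (x / 4))"
          using w w4 x \<eta> by (intro mult_left_mono mult_mono) auto
        also have "\<dots> = 8 * \<eta> * (x / 4 * exp (x / 4)) * exp (- x)" by simp
        also have "\<dots> \<le> 8 * \<eta> * (exp (x / 4) * exp (x / 4)) * exp (- x)"
        proof -
          have "x / 4 \<le> exp (x / 4)" using exp_ge_add_one_self[of "x / 4"] by linarith
          then show ?thesis using \<eta> by (intro mult_right_mono mult_left_mono) auto
        qed
        also have "\<dots> = 8 * \<eta> * exp (- x / 2)" by (simp add: flip: exp_add)
        also have "\<dots> \<le> 8 * \<eta> * exp (- (n / 4 * P \<xi>))"
          using \<eta> x by (intro mult_left_mono) (auto simp: x_def)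
        also have "\<dots> \<le> (8 * \<eta> + 2 * exp (- (n * \<delta>1 / 4))) * exp (- (n / 4 * P \<xi>))"
          by (intro mult_right_mono) auto
        finally show ?thesis .
      next
        case False
        have "norm (F \<xi> - a n y \<xi>) \<le> norm (F \<xi>) + norm (a n y \<xi>)" by (rule norm_triangle_ineq4)
        also have "\<dots> \<le> exp (- (n / 2 * P \<xi>)) + exp (- (n / 2 * P \<xi>))"
          using nF[of \<xi>] n P_nonneg[of \<xi>] by (intro add_mono) (auto simp: na)
        also have "\<dots> = 2 * exp (- (n / 4 * P \<xi>)) * exp (- (n / 4 * P \<xi>))"
          by (simp add: mult.assoc flip: exp_add)
        also have "\<dots> \<le> 2 * exp (- (n * \<delta>1 / 4)) * exp (- (n / 4 * P \<xi>))"
          using False n by (intro mult_right_mono mult_left_mono) auto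
        also have "\<dots> \<le> (8 * \<eta> + 2 * exp (- (n * \<delta>1 / 4))) * exp (- (n / 4 * P \<xi>))"
          using \<eta> by (intro mult_right_mono) auto
        finally show ?thesis .
      qed
      have n4: "n / 4 > 0" "n > 0" using n by auto
      have "integral ?N (\<lambda>\<xi>. a n y \<xi> * exp (w \<xi>)) = integral UNIV F"
        unfolding F_def indicator_def by (subst integral_restrict_UNIV[symmetric]) (rule integral_cong, simp)
      then have "norm (integral ?N (\<lambda>\<xi>. a n y \<xi> * exp (w \<xi>)) - integral UNIV (a n y))
        = norm (\<integral>\<xi>. F \<xi> - a n y \<xi> \<partial>lborel)"
        by (simp add: integral_lborel[OF iF] integral_lborel[OF ia[OF n4(2)]] Bochner_Integration.integral_diff[OF iF ia[OF n4(2)]])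
      also have "\<dots> \<le> (\<integral>\<xi>. (8 * \<eta> + 2 * exp (- (n * \<delta>1 / 4))) * exp (- (n / 4 * P \<xi>)) \<partial>lborel)"
      proof (rule Bochner_Integration.integral_norm_bound_integral)
        show "integrable lborel (\<lambda>\<xi>. F \<xi> - a n y \<xi>)"
          by (intro Bochner_Integration.integrable_diff iF ia n4)
        show "integrable lborel (\<lambda>\<xi>. (8 * \<eta> + 2 * exp (- (n * \<delta>1 / 4))) * exp (- (n / 4 * P \<xi>)))"
          by (intro integrable_mult_right ei n4)
      qed (rule D)
      also have "\<dots> \<le> (8 * \<eta> + 2 * exp (- (n * \<delta>1 / 4))) * (C * (n / 4) powr (- \<mu>))"
        using eb[OF n4(1)] \<eta> by (simp add: mult_left_mono)
      also have "C * (n / 4) powr (- \<mu>) = B * n powr (- \<mu>)"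
        using n by (simp add: B_def powr_divide powr_minus field_simps)
      also have "(8 * \<eta> + 2 * exp (- (n * \<delta>1 / 4))) * (B * n powr (- \<mu>))
         = (8 * \<eta> * B + 2 * exp (- (n * \<delta>1 / 4)) * B) * n powr (- \<mu>)"
        by (simp add: algebra_simps)
      also have "\<dots> \<le> \<epsilon> * n powr (- \<mu>)"
        using n(1) \<eta>(3) by (intro mult_right_mono) auto
      finally show "norm (integral ?N (\<lambda>\<xi>. a n y \<xi> * exp (- (of_real n * (of_real (Rt \<xi>) + \<i> * of_real (Qt \<xi>)))))
         - integral UNIV (a n y)) \<le> \<epsilon> * n powr (- \<mu>)"
        by (simp add: w_def)
    qed
  qed (use C in auto)
qed

end

section \<open>Points of imaginary homogeneous type\<close>

text \<open>The Cauchy criterion, sampled at the integers to obtain a limit. The tail bound passes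
  to that limit, which gives the rate and, through it, convergence along the reals.\<close>

lemma tendsto_at_top_of_tail_bound:
  fixes I :: "real \<Rightarrow> complex" and B :: "real \<Rightarrow> real"
  assumes tail: "\<And>a b. a0 \<le> a \<Longrightarrow> a \<le> b \<Longrightarrow> norm (I b - I a) \<le> B a" and B: "(B \<longlongrightarrow> 0) at_top"
  obtains L where "(I \<longlongrightarrow> L) at_top" "\<And>a. a0 \<le> a \<Longrightarrow> norm (L - I a) \<le> B a"
proof -
  have "Cauchy (\<lambda>m. I (real m))"
  proof (rule CauchyI)
    fix e :: real assume e: "e > 0"
    have "\<forall>\<^sub>F m in sequentially. B (real m) < e / 2"
      by (rule order_tendstoD(2)[OF filterlim_compose[OF B filterlim_real_sequentially]]) (use e in simp)
    moreover have "\<forall>\<^sub>F m in sequentially. a0 \<le> real m"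
      using eventually_ge_at_top[of a0] filterlim_real_sequentially by (rule eventually_compose_filterlim)
    ultimately have "\<forall>\<^sub>F m in sequentially. B (real m) < e / 2 \<and> a0 \<le> real m" by (rule eventually_conj)
    then obtain M where M: "B (real M) < e / 2" "a0 \<le> real M"
      unfolding eventually_sequentially by blast
    show "\<exists>M. \<forall>m\<ge>M. \<forall>n\<ge>M. norm (I (real m) - I (real n)) < e"
    proof (intro exI[of _ M] allI impI)
      fix m n assume "M \<le> m" "M \<le> n"
      then have "norm (I (real m) - I (real M)) \<le> B (real M)" "norm (I (real n) - I (real M)) \<le> B (real M)"
        using tail[OF M(2)] by auto
      then show "norm (I (real m) - I (real n)) < e"
        using M(1) norm_triangle_ineq4[of "I (real m) - I (real M)" "I (real n) - I (real M)"] by simp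
    qed
  qed
  then obtain L where L: "(\<lambda>m. I (real m)) \<longlonglongrightarrow> L"
    using Cauchy_convergent unfolding convergent_def by blast
  have bound: "norm (L - I a) \<le> B a" if a: "a0 \<le> a" for a
  proof (rule tendsto_upperbound)
    show "(\<lambda>m. norm (I (real m) - I a)) \<longlonglongrightarrow> norm (L - I a)" by (intro tendsto_intros L)
    show "\<forall>\<^sub>F m in sequentially. norm (I (real m) - I a) \<le> B a"
      using eventually_compose_filterlim[OF eventually_ge_at_top[of a] filterlim_real_sequentially]
      by eventually_elim (use tail[OF a] in auto)
  qed simp
  have "((\<lambda>a. I a - L) \<longlongrightarrow> 0) at_top"
  proof (rule Lim_null_comparison[OF _ B])
    show "\<forall>\<^sub>F a in at_top. norm (I a - L) \<le> B a"
      using eventually_ge_at_top[of a0] by eventually_elim (use bound norm_minus_commute in metis)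
  qed
  then have "(I \<longlongrightarrow> L) at_top" by (simp add: LIM_zero_iff)
  then show thesis using bound that by blast
qed

section \<open>Derivatives of functions along orbits\<close>

lemma flow_orbit_derivative:
  fixes f :: "real^'n \<Rightarrow> real"
  assumes "f differentiable (at (flow E u *v \<zeta>))"
  shows "((\<lambda>u. f (flow E u *v \<zeta>)) has_real_derivative
     (\<Sum>i\<in>UNIV. partial i f (flow E u *v \<zeta>) * (E *v (flow E u *v \<zeta>)) $ i)) (at u)"
proof -
  let ?p = "flow E u *v \<zeta>"
  let ?D = "frechet_derivative f (at ?p)"
  have D: "(f has_derivative ?D) (at ?p)"
    using assms frechet_derivative_works by blast
  then have lin: "linear ?D" by (rule has_derivative_linear)
  have "((\<lambda>u. flow E u *v \<zeta>) has_derivative (\<lambda>h. h *\<^sub>R (E *v ?p))) (at u)"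
    using flow_vector_derivative by (simp add: has_vector_derivative_def)
  from has_derivative_compose[OF this D]
  have "((\<lambda>u. f (flow E u *v \<zeta>)) has_derivative (\<lambda>h. ?D (h *\<^sub>R (E *v ?p)))) (at u)" .
  moreover have "?D (h *\<^sub>R (E *v ?p)) = (\<Sum>i\<in>UNIV. partial i f ?p * (E *v ?p) $ i) * h" for h
  proof -
    have "?D (E *v ?p) = ?D (\<Sum>i\<in>UNIV. (E *v ?p) $ i *\<^sub>R axis i 1)"
      by (simp add: basis_expansion flip: scalar_mult_eq_scaleR)
    also have "\<dots> = (\<Sum>i\<in>UNIV. (E *v ?p) $ i * ?D (axis i 1))"
      by (simp add: linear_sum[OF lin] linear_scale[OF lin])
    finally show ?thesis
      by (simp add: linear_scale[OF lin] partial_def mult.commute)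
  qed
  ultimately show ?thesis
    by (simp add: has_field_derivative_def)
qed

text \<open>The derivative of \<open>f\<close> along the orbit of \<open>\<zeta>\<close>, written
  out in partial derivatives because \<open>Ck_on\<close> grants further differentiability in that
  form.\<close>

definition orbit_deriv :: "real^'n^'n \<Rightarrow> (real^'n \<Rightarrow> real) \<Rightarrow> real^'n \<Rightarrow> real \<Rightarrow> real" where
  "orbit_deriv E f \<zeta> u = (\<Sum>i\<in>UNIV. partial i f (flow E u *v \<zeta>) * (E *v (flow E u *v \<zeta>)) $ i)"

lemma orbit_deriv1:
  assumes "Ck_on (Suc k) U f" "flow E u *v \<zeta> \<in> U"
  shows "((\<lambda>u. f (flow E u *v \<zeta>)) has_real_derivative orbit_deriv E f \<zeta> u) (at u)"
  unfolding orbit_deriv_def using assms by (intro flow_orbit_derivative) auto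

text \<open>Existence of the second derivative is enough here: its size will come from strong
  subhomogeneity and not from a formula.\<close>

lemma orbit_deriv2:
  fixes f :: "real^'n \<Rightarrow> real"
  assumes f: "Ck_on 2 U f"
  obtains g2 where "\<And>u \<zeta>. flow E u *v \<zeta> \<in> U \<Longrightarrow> (orbit_deriv E f \<zeta> has_real_derivative g2 \<zeta> u) (at u)"
proof -
  have "\<exists>D. (orbit_deriv E f \<zeta> has_real_derivative D) (at u)" if p: "flow E u *v \<zeta> \<in> U" for u \<zeta>
  proof -
    have c: "((\<lambda>u. (E *v (flow E u *v \<zeta>)) $ i) has_real_derivative (E *v (E *v (flow E u *v \<zeta>))) $ i) (at u)" for i
    proof -
      have "bounded_linear (\<lambda>x. (E *v x) $ i)"
        by (intro bounded_linear_compose[OF bounded_linear_vec_nth] matrix_vector_mul_bounded_linear)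
      from bounded_linear.has_vector_derivative[OF this flow_vector_derivative]
      show ?thesis by (simp add: has_real_derivative_iff_has_vector_derivative)
    qed
    have "partial i f differentiable (at (flow E u *v \<zeta>))" for i
      using f p by (simp add: numeral_2_eq_2)
    then have d: "\<exists>D. ((\<lambda>u. partial i f (flow E u *v \<zeta>)) has_real_derivative D) (at u)" for i
      using flow_orbit_derivative by blast
    then obtain D where D: "\<And>i. ((\<lambda>u. partial i f (flow E u *v \<zeta>)) has_real_derivative D i) (at u)"
      by metis
    have "((\<lambda>u. \<Sum>i\<in>UNIV. partial i f (flow E u *v \<zeta>) * (E *v (flow E u *v \<zeta>)) $ i) has_real_derivative
       (\<Sum>i\<in>UNIV. D i * (E *v (flow E u *v \<zeta>)) $ i + (E *v (E *v (flow E u *v \<zeta>))) $ i * partial i f (flow E u *v \<zeta>))) (at u)"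
      by (intro DERIV_sum DERIV_mult c D)
    then show ?thesis
      unfolding orbit_deriv_def[abs_def] by blast
  qed
  then have "\<forall>\<zeta> u. \<exists>D. flow E u *v \<zeta> \<in> U \<longrightarrow> (orbit_deriv E f \<zeta> has_real_derivative D) (at u)"
    by blast
  from this[unfolded choice_iff] obtain g2 where
    "\<forall>\<zeta> u. flow E u *v \<zeta> \<in> U \<longrightarrow> (orbit_deriv E f \<zeta> has_real_derivative g2 \<zeta> u) (at u)" ..
  then show thesis by (intro that[of g2]) simp
qed

lemma strongly_subhomogD:
  assumes s: "strongly_subhomog l E f" and \<epsilon>: "\<epsilon> > 0" and K: "compact K"
  obtains \<tau> where "\<tau> > 0" "\<And>t \<xi> k. 0 < t \<Longrightarrow> t < \<tau> \<Longrightarrow> \<xi> \<in> K \<Longrightarrow> k \<le> l \<Longrightarrow>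
      \<bar>t ^ k * (deriv ^^ k) (\<lambda>s. f (tpow s E *v \<xi>)) t\<bar> \<le> \<epsilon> * t"
proof -
  from s have "\<forall>\<epsilon>>0. \<forall>K. compact K \<longrightarrow>
        (\<exists>\<tau>>0. \<forall>t. 0 < t \<and> t < \<tau> \<longrightarrow> (\<forall>\<xi>\<in>K. \<forall>k\<le>l.
            \<bar>t ^ k * (deriv ^^ k) (\<lambda>s. f (tpow s E *v \<xi>)) t\<bar> \<le> \<epsilon> * t))"
    unfolding strongly_subhomog_def by (elim conjE)
  from this[rule_format, OF \<epsilon> K] obtain \<tau> where \<tau>: "\<tau> > 0" and *: "\<forall>t. 0 < t \<and> t < \<tau> \<longrightarrow> (\<forall>\<xi>\<in>K. \<forall>k\<le>l.
            \<bar>t ^ k * (deriv ^^ k) (\<lambda>s. f (tpow s E *v \<xi>)) t\<bar> \<le> \<epsilon> * t)"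
    by (elim exE conjE)
  show thesis
    by (rule that[OF \<tau>]) (rule *[rule_format], simp_all)
qed

text \<open>The conditions of strong subhomogeneity are stated in \<open>t = exp u\<close>; here they are translated to the
  additive parameter \<open>u\<close>, in which \<open>t d/dt\<close> becomes \<open>d/du\<close>.\<close>

lemma strongly_subhomog_orbit1:
  fixes f :: "real^'n \<Rightarrow> real"
  assumes s: "strongly_subhomog l E f" "l \<ge> 1" and f: "Ck_on 1 U f" and K: "compact K" and \<epsilon>: "\<epsilon> > 0"
  obtains \<tau> where "\<tau> > 0" "\<And>u \<zeta>. exp u < \<tau> \<Longrightarrow> \<zeta> \<in> K \<Longrightarrow> flow E u *v \<zeta> \<in> U \<Longrightarrow> \<bar>orbit_deriv E f \<zeta> u\<bar> \<le> \<epsilon> * exp u"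
proof -
  obtain \<tau> where \<tau>: "\<tau> > 0" "\<And>t \<xi> k. 0 < t \<Longrightarrow> t < \<tau> \<Longrightarrow> \<xi> \<in> K \<Longrightarrow> k \<le> l \<Longrightarrow>
      \<bar>t ^ k * (deriv ^^ k) (\<lambda>s. f (tpow s E *v \<xi>)) t\<bar> \<le> \<epsilon> * t"
    by (rule strongly_subhomogD[OF s(1) \<epsilon> K]) (rule that)
  show thesis
  proof (rule that[OF \<tau>(1)])
    fix u \<zeta> assume a: "exp u < \<tau>" "\<zeta> \<in> K" "flow E u *v \<zeta> \<in> U"
    have "((\<lambda>u. f (flow E u *v \<zeta>)) has_real_derivative orbit_deriv E f \<zeta> u) (at (ln (exp u)))"
      using orbit_deriv1[of 0 U f E u \<zeta>] f a(3) by simp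
    from DERIV_chain2[OF this DERIV_ln[OF exp_gt_zero]]
    have d: "((\<lambda>s. f (flow E (ln s) *v \<zeta>)) has_real_derivative orbit_deriv E f \<zeta> u * inverse (exp u)) (at (exp u))" .
    \<comment> \<open>\<open>tpow\<close> and \<open>flow\<close> at \<open>ln s\<close> are
      identified for positive \<open>s\<close>; a derivative sees only values near
      \<open>exp u\<close>, where this holds.\<close>
    have "\<forall>\<^sub>F s in nhds (exp u). s \<in> {0<..}"
      by (rule eventually_nhds_in_open) auto
    then have "\<forall>\<^sub>F s in nhds (exp u). f (flow E (ln s) *v \<zeta>) = f (tpow s E *v \<zeta>)"
      by eventually_elim (simp add: tpow_eq_flow)
    from DERIV_cong_ev[OF refl this refl, THEN iffD1, OF d]
    have "((\<lambda>s. f (tpow s E *v \<zeta>)) has_real_derivative orbit_deriv E f \<zeta> u * inverse (exp u)) (at (exp u))" .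
    then have "deriv (\<lambda>s. f (tpow s E *v \<zeta>)) (exp u) = orbit_deriv E f \<zeta> u * inverse (exp u)"
      by (rule DERIV_imp_deriv)
    moreover have "\<bar>exp u ^ 1 * (deriv ^^ 1) (\<lambda>s. f (tpow s E *v \<zeta>)) (exp u)\<bar> \<le> \<epsilon> * exp u"
      by (rule \<tau>(2)) (use a s in auto)
    moreover have "exp u * (x * inverse (exp u)) = x" for x by (simp add: field_simps)
    ultimately show "\<bar>orbit_deriv E f \<zeta> u\<bar> \<le> \<epsilon> * exp u" by simp
  qed
qed

lemma Ck_on_2_imp_1: "Ck_on 2 U f \<Longrightarrow> Ck_on 1 U f"
  by (auto simp: numeral_2_eq_2)

text \<open>For t = exp u the operator t^2 d^2/dt^2 equals d^2/du^2 - d/du. The hypothesis thus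
  bounds the difference of the two orbit derivatives, and adding the first-order bound explains the
  factor 2.\<close>

lemma strongly_subhomog_orbit2:
  fixes f :: "real^'n \<Rightarrow> real"
  assumes s: "strongly_subhomog 2 E f" and f: "Ck_on 2 U f" and U: "open U" and K: "compact K" and \<epsilon>: "\<epsilon> > 0"
    and g2: "\<And>u \<zeta>. flow E u *v \<zeta> \<in> U \<Longrightarrow> (orbit_deriv E f \<zeta> has_real_derivative g2 \<zeta> u) (at u)"
  obtains \<tau> where "\<tau> > 0" "\<And>u \<zeta>. exp u < \<tau> \<Longrightarrow> \<zeta> \<in> K \<Longrightarrow> flow E u *v \<zeta> \<in> U \<Longrightarrow>
    \<bar>orbit_deriv E f \<zeta> u\<bar> \<le> \<epsilon> * exp u \<and> \<bar>g2 \<zeta> u\<bar> \<le> 2 * \<epsilon> * exp u"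
proof -
  have f1: "Ck_on (Suc 0) U f" using Ck_on_2_imp_1[OF f] by simp
  obtain \<tau>1 where \<tau>1: "\<tau>1 > 0" "\<And>u \<zeta>. exp u < \<tau>1 \<Longrightarrow> \<zeta> \<in> K \<Longrightarrow> flow E u *v \<zeta> \<in> U \<Longrightarrow> \<bar>orbit_deriv E f \<zeta> u\<bar> \<le> \<epsilon> * exp u"
    using strongly_subhomog_orbit1[OF s _ Ck_on_2_imp_1[OF f] K \<epsilon>] by auto
  obtain \<tau> where \<tau>: "\<tau> > 0" "\<And>t \<xi> k. 0 < t \<Longrightarrow> t < \<tau> \<Longrightarrow> \<xi> \<in> K \<Longrightarrow> k \<le> 2 \<Longrightarrow>
      \<bar>t ^ k * (deriv ^^ k) (\<lambda>s. f (tpow s E *v \<xi>)) t\<bar> \<le> \<epsilon> * t"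
    by (rule strongly_subhomogD[OF s \<epsilon> K]) (rule that)
  show thesis
  proof (rule that[of "min \<tau> \<tau>1"])
    fix u \<zeta> assume a: "exp u < min \<tau> \<tau>1" "\<zeta> \<in> K" "flow E u *v \<zeta> \<in> U"
    let ?G = "\<lambda>s. f (tpow s E *v \<zeta>)"
    let ?g1 = "orbit_deriv E f \<zeta>"
    have V: "open ((\<lambda>v. flow E v *v \<zeta>) -` U)"
      by (intro open_vimage U continuous_on_flow continuous_on_id continuous_on_const)
    have d1: "deriv ?G s = ?g1 (ln s) * inverse s" if "s > 0" "flow E (ln s) *v \<zeta> \<in> U" for s
    proof -
      have "((\<lambda>u. f (flow E u *v \<zeta>)) has_real_derivative ?g1 (ln s)) (at (ln s))"
        using orbit_deriv1[OF f1 that(2)] .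
      from DERIV_chain2[OF this DERIV_ln[OF that(1)]]
      have d: "((\<lambda>s. f (flow E (ln s) *v \<zeta>)) has_real_derivative ?g1 (ln s) * inverse s) (at s)" .
      have "\<forall>\<^sub>F s in nhds s. s \<in> {0<..}"
        by (rule eventually_nhds_in_open) (use that in auto)
      then have "\<forall>\<^sub>F s in nhds s. f (flow E (ln s) *v \<zeta>) = ?G s"
        by eventually_elim (simp add: tpow_eq_flow)
      from DERIV_cong_ev[OF refl this refl, THEN iffD1, OF d]
      have "(?G has_real_derivative ?g1 (ln s) * inverse s) (at s)" .
      then show ?thesis by (rule DERIV_imp_deriv)
    qed
    \<comment> \<open>Differentiating again needs the formula for the first derivative on a whole
      neighbourhood of \<open>exp u\<close>; openness of \<open>U\<close> provides it.\<close>
    have ev: "\<forall>\<^sub>F s in nhds (exp u). deriv ?G s = ?g1 (ln s) * inverse s"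
    proof -
      have "isCont ln (exp u)" by (rule isCont_ln) simp
      then have "\<forall>\<^sub>F s in nhds (exp u). ln s \<in> (\<lambda>v. flow E v *v \<zeta>) -` U"
        unfolding isCont_def by (intro topological_tendstoD[OF tendsto_nhds_iff[THEN iffD2] V]) (use a in auto)
      moreover have "\<forall>\<^sub>F s in nhds (exp u). s \<in> {0<..}"
        by (rule eventually_nhds_in_open) auto
      ultimately show ?thesis by eventually_elim (use d1 in auto)
    qed
    have "(?g1 has_real_derivative g2 \<zeta> u) (at (ln (exp u)))"
      using g2[OF a(3)] by simp
    from DERIV_chain2[OF this DERIV_ln[OF exp_gt_zero]]
    have "((\<lambda>s. ?g1 (ln s)) has_real_derivative g2 \<zeta> u * inverse (exp u)) (at (exp u))" .
    then have "((\<lambda>s. ?g1 (ln s) * inverse s) has_real_derivative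
        (g2 \<zeta> u - ?g1 u) / exp u ^ 2) (at (exp u))"
      by (auto intro!: derivative_eq_intros simp: field_simps power2_eq_square)
    from DERIV_cong_ev[OF refl ev refl, THEN iffD2, OF this]
    have "(deriv ?G has_real_derivative (g2 \<zeta> u - ?g1 u) / exp u ^ 2) (at (exp u))" .
    then have "(deriv ^^ 2) ?G (exp u) = (g2 \<zeta> u - ?g1 u) / exp u ^ 2"
      by (simp add: numeral_2_eq_2 DERIV_imp_deriv)
    moreover have "\<bar>exp u ^ 2 * (deriv ^^ 2) ?G (exp u)\<bar> \<le> \<epsilon> * exp u"
      by (rule \<tau>(2)) (use a in auto)
    ultimately have "\<bar>g2 \<zeta> u - ?g1 u\<bar> \<le> \<epsilon> * exp u" by simp
    moreover have 1: "\<bar>?g1 u\<bar> \<le> \<epsilon> * exp u" using \<tau>1(2)[of u \<zeta>] a by simp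
    ultimately have "\<bar>g2 \<zeta> u\<bar> \<le> 2 * \<epsilon> * exp u" by linarith
    with 1 show "\<bar>?g1 u\<bar> \<le> \<epsilon> * exp u \<and> \<bar>g2 \<zeta> u\<bar> \<le> 2 * \<epsilon> * exp u" ..
  qed (use \<tau> \<tau>1 in auto)
qed

section \<open>Growth of orbits and the sign along an orbit\<close>

context pos_homog_scaling
begin

text \<open>This is how the absence of linear terms is exploited. A function that is at most
  quadratic near 0 and gains a factor \<open>exp u\<close> along the flow forces vectors to grow no
  faster than \<open>exp (u / 2)\<close>, so a linear phase is dominated by the homogeneous
  one.\<close>

lemma flow_growth:
  assumes quad: "C0 > 0" "\<And>\<xi>. norm \<xi> \<le> 1 \<Longrightarrow> P \<xi> \<le> C0 * (norm \<xi>)\<^sup>2"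
  obtains C where "C > 0" "\<And>u x. u \<ge> 0 \<Longrightarrow> norm (flow E u *v x) \<le> C * exp (u / 2) * norm x"
proof -
  have ne: "sphere 0 1 \<noteq> ({} :: (real^'n) set)"
    by (simp add: sphere_eq_empty)
  obtain e0 where e0: "norm e0 = 1" "\<And>e. norm e = 1 \<Longrightarrow> P e0 \<le> P e"
    using continuous_attains_inf[OF Elementary_Normed_Spaces.compact_sphere[of "0::real^'n" 1] ne continuous_on_subset[OF P_cont]]
    by auto
  define m where "m = P e0"
  have m: "m > 0" using e0(1) by (auto simp: m_def P_pos_iff)
  define C where "C = max 1 (sqrt (C0 / m))"
  show thesis
  proof
    show "C > 0" by (simp add: C_def)
    fix u :: real and x :: "real^'n" assume u: "u \<ge> 0"
    define y where "y = flow E u *v x"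
    have "norm y \<le> C * exp (u / 2) * norm x"
    proof (cases "norm y \<le> norm x")
      case True
      have "1 * 1 \<le> C * exp (u / 2)" using u by (intro mult_mono) (auto simp: C_def)
      then have "1 * norm x \<le> C * exp (u / 2) * norm x" by (intro mult_right_mono) auto
      then show ?thesis using True by linarith
    next
      case False
      then have y: "norm y > 0" using norm_ge_zero[of x] by linarith
      \<comment> \<open>On the unit sphere \<open>P\<close> is at least \<open>m\<close>. Running
        \<open>e\<close> back for time \<open>u\<close> divides \<open>P\<close> by
        \<open>exp u\<close> and yields a vector of norm \<open>norm x / norm y\<close>, below 1 in
        this case, to which the quadratic bound applies.\<close>
      define e where "e = (1 / norm y) *\<^sub>R y"
      have ne: "norm e = 1" using y by (simp add: e_def)
      have fe: "flow E (- u) *v e = (1 / norm y) *\<^sub>R x"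
        by (simp add: e_def y_def matrix_vector_mult_scaleR)
      have nx: "norm (flow E (- u) *v e) = norm x / norm y"
        unfolding fe by simp
      have "exp (- u) * m \<le> exp (- u) * P e"
        using e0(2)[OF ne] by (simp add: m_def)
      also have "\<dots> = P (flow E (- u) *v e)" by (simp add: P_flow)
      also have "\<dots> \<le> C0 * (norm x / norm y)\<^sup>2"
        using quad(2)[of "flow E (- u) *v e"] False y unfolding nx by simp
      finally have "m * (norm y)\<^sup>2 \<le> C0 * exp u * (norm x)\<^sup>2"
        using y by (simp add: exp_minus field_simps)
      then have "(norm y)\<^sup>2 \<le> (C0 / m) * exp u * (norm x)\<^sup>2"
        using m by (simp add: field_simps)
      also have "\<dots> = (sqrt (C0 / m) * exp (u / 2) * norm x)\<^sup>2"
      proof -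
        have "(sqrt (C0 / m))\<^sup>2 = C0 / m" using m quad(1) by simp
        moreover have "(exp (u / 2))\<^sup>2 = exp u" using exp_double[of "u / 2"] by simp
        ultimately show ?thesis unfolding power_mult_distrib by simp
      qed
      finally have "norm y \<le> sqrt (C0 / m) * exp (u / 2) * norm x"
        by (rule power2_le_imp_le) (use m quad(1) in auto)
      also have "\<dots> \<le> C * exp (u / 2) * norm x"
        by (intro mult_right_mono) (auto simp: C_def)
      finally show ?thesis .
    qed
    then show "norm (flow E u *v x) \<le> C * exp (u / 2) * norm x" by (simp add: y_def)
  qed
qed

text \<open>The exponent is only known to belong to the absolute value, so the sign might flip along
  an orbit. After rescaling, \<open>Q\<close> along the orbit is continuous with at most two values,
  hence constant.\<close>

lemma signed_flow:
  assumes Qc: "continuous_on UNIV Q" and PQ: "\<And>\<xi>. P \<xi> = \<bar>Q \<xi>\<bar>"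
  shows "Q (flow E u *v \<zeta>) = exp u * Q \<zeta>"
proof -
  define h where "h = (\<lambda>u. exp (- u) * Q (flow E u *v \<zeta>))"
  have ah: "\<bar>h u\<bar> = \<bar>Q \<zeta>\<bar>" for u
    using P_flow[of u \<zeta>] by (simp add: h_def abs_mult exp_minus field_simps flip: PQ)
  have "continuous_on UNIV h"
    unfolding h_def by (intro continuous_intros continuous_on_compose2[OF Qc] continuous_on_flow) auto
  moreover have "finite (range h)"
  proof (rule finite_subset)
    show "range h \<subseteq> {\<bar>Q \<zeta>\<bar>, - \<bar>Q \<zeta>\<bar>}"
    proof (rule image_subsetI)
      show "h u \<in> {\<bar>Q \<zeta>\<bar>, - \<bar>Q \<zeta>\<bar>}" for u using ah[of u] by (auto simp: abs_if split: if_splits)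
    qed
  qed simp
  ultimately have "h constant_on UNIV"
    by (intro continuous_finite_range_constant) auto
  then have "h u = h 0" by (auto simp: constant_on_def)
  then show ?thesis by (simp add: h_def exp_minus field_simps)
qed

end

lemma integral_diff_sublevel:
  fixes f :: "real^'n \<Rightarrow> complex" and P :: "real^'n \<Rightarrow> real"
  assumes "f absolutely_integrable_on {\<xi>. P \<xi> < a}" "f absolutely_integrable_on {\<xi>. a \<le> P \<xi> \<and> P \<xi> < b}" "a \<le> b"
  shows "integral {\<xi>. P \<xi> < b} f = integral {\<xi>. P \<xi> < a} f + integral {\<xi>. a \<le> P \<xi> \<and> P \<xi> < b} f"
proof -
  have "{\<xi>. P \<xi> < b} = {\<xi>. P \<xi> < a} \<union> {\<xi>. a \<le> P \<xi> \<and> P \<xi> < b}" using assms(3) by auto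
  moreover have "{\<xi>. P \<xi> < a} \<inter> {\<xi>. a \<le> P \<xi> \<and> P \<xi> < b} = {}" by auto
  ultimately show ?thesis
    using Henstock_Kurzweil_Integration.integral_Un[of f "{\<xi>. P \<xi> < a}" "{\<xi>. a \<le> P \<xi> \<and> P \<xi> < b}"] assms
    by (simp add: absolutely_integrable_on_def)
qed

text \<open>That \<open>Q\<close> is a polynomial without linear terms enters through its continuity
  and the quadratic bound \<open>quad\<close>. \<open>U\<close> is the neighbourhood on which the
  remainders are differentiable.\<close>

locale imag_local = pos_homog_scaling P E for P :: "real^'n \<Rightarrow> real" and E :: "real^'n^'n" +
  fixes Q Qt Rt R :: "real^'n \<Rightarrow> real" and k :: real and U :: "(real^'n) set" and C0 :: real
  assumes PQ: "\<And>\<xi>. P \<xi> = \<bar>Q \<xi>\<bar>" and Qc: "continuous_on UNIV Q"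
    and k: "k > 1" and mu1: "\<mu> < 1"
    and R: "pos_homog R" "homog ((1/k) *\<^sub>R E) R"
    and U: "open U" "0 \<in> U" and Qt: "Ck_on 2 U Qt" "Qt 0 = 0" and Rt: "Ck_on 1 U Rt" "Rt 0 = 0"
    and sQ: "strongly_subhomog 2 E Qt" and sR: "strongly_subhomog 1 ((1/k) *\<^sub>R E) Rt"
    and quad: "C0 > 0" "\<And>\<xi>. norm \<xi> \<le> 1 \<Longrightarrow> P \<xi> \<le> C0 * (norm \<xi>)\<^sup>2"
begin

text \<open>\<open>R\<close> gets the same theory for its own exponent \<open>E / k\<close>. Both
  groups have the same orbits, run at different speeds, so \<open>R\<close> gains the factor
  \<open>exp (k * u)\<close> where \<open>Q\<close> gains \<open>exp u\<close>.\<close>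

sublocale RR: pos_homog_scaling R "(1/k) *\<^sub>R E"
  using R sR by unfold_locales (auto simp: strongly_subhomog_def)

lemma Q_flow: "Q (flow E u *v \<zeta>) = exp u * Q \<zeta>"
  by (rule signed_flow[OF Qc PQ])

lemma flow_k: "flow ((1/k) *\<^sub>R E) u = flow E (u / k)"
  by (simp add: flow_scaleR)

lemma R_flow: "R (flow E u *v \<zeta>) = exp (k * u) * R \<zeta>"
  using RR.P_flow[of "k * u" \<zeta>] k by (simp add: flow_k)

text \<open>The n-th power of the Fourier transform near the point, after its value at the point and
  the drift have been split off; \<open>y\<close> stands for x - n \<alpha>.\<close>

definition f :: "real \<Rightarrow> real^'n \<Rightarrow> real^'n \<Rightarrow> complex" where
  "f n y \<xi> = exp (- (of_real n * (of_real (R \<xi> + Rt \<xi>) + \<i> * of_real (Q \<xi> + Qt \<xi>)))) * exp (- \<i> * of_real (y \<bullet> \<xi>))"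

text \<open>The integrand of the oscillatory attractor at time \<open>n\<close>. It has modulus one,
  so its integral over the whole space can only be a limit.\<close>

definition j :: "real \<Rightarrow> real^'n \<Rightarrow> real^'n \<Rightarrow> complex" where
  "j n y \<xi> = exp (- \<i> * of_real (n * Q \<xi>) - \<i> * of_real (y \<bullet> \<xi>))"

lemma Qt_cont: "continuous_on U Qt" and Rt_cont: "continuous_on U Rt"
  using Qt Rt by (auto simp: numeral_2_eq_2)

lemma j_cont: "continuous_on S (j n y)"
  unfolding j_def by (intro continuous_intros continuous_on_subset[OF Qc]) auto

lemma f_cont: "S \<subseteq> U \<Longrightarrow> continuous_on S (f n y)"
  unfolding f_def
  by (intro continuous_intros continuous_on_subset[OF Qc] continuous_on_subset[OF RR.P_cont]
      continuous_on_subset[OF Qt_cont] continuous_on_subset[OF Rt_cont]) auto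

text \<open>Smallness is relative to \<open>R\<close> and stems from the dilations of
  \<open>E / k\<close>. Only the neighbourhood is rewritten in terms of \<open>P\<close>, the
  yardstick shared by all local estimates.\<close>

lemma Rt_small:
  assumes "\<epsilon> > 0" obtains \<delta> where "\<delta> > 0" "\<And>\<xi>. P \<xi> < \<delta> \<Longrightarrow> \<bar>Rt \<xi>\<bar> \<le> \<epsilon> * R \<xi>"
proof -
  obtain d where d: "d > 0" "\<And>\<xi>. R \<xi> < d \<Longrightarrow> \<bar>Rt \<xi>\<bar> \<le> \<epsilon> * R \<xi>"
  proof (rule RR.little_o[of Rt \<epsilon>])
    fix \<epsilon> :: real and K :: "(real^'n) set" assume "\<epsilon> > 0" "compact K"
    then obtain \<tau> where \<tau>: "\<tau> > 0" "\<And>t \<xi> l. 0 < t \<Longrightarrow> t < \<tau> \<Longrightarrow> \<xi> \<in> K \<Longrightarrow> l \<le> 1 \<Longrightarrow>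
      \<bar>t ^ l * (deriv ^^ l) (\<lambda>s. Rt (tpow s ((1/k) *\<^sub>R E) *v \<xi>)) t\<bar> \<le> \<epsilon> * t"
      by (rule strongly_subhomogD[OF sR]) (rule that)
    then show "\<exists>\<tau>>0. \<forall>t. 0 < t \<and> t < \<tau> \<longrightarrow> (\<forall>\<xi>\<in>K. \<bar>Rt (tpow t ((1/k) *\<^sub>R E) *v \<xi>)\<bar> \<le> \<epsilon> * t)"
      using \<tau>(2)[where l = 0] by (intro exI[of _ \<tau>]) simp
  qed (use Rt assms in auto)
  obtain \<delta> where "\<delta> > 0" "{\<xi>. P \<xi> < \<delta>} \<subseteq> {\<xi>. R \<xi> < d}"
    using small_sublevel[OF RR.open_sublevel[of d]] d(1) RR.P_0_iff[of 0] by (metis mem_Collect_eq)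
  then show thesis using d(2) that by blast
qed

lemma Qt_small:
  assumes "\<epsilon> > 0" obtains \<delta> where "\<delta> > 0" "\<And>\<xi>. P \<xi> < \<delta> \<Longrightarrow> \<bar>Qt \<xi>\<bar> \<le> \<epsilon> * P \<xi>"
proof (rule little_o[of Qt \<epsilon>])
  fix \<epsilon> :: real and K :: "(real^'n) set" assume "\<epsilon> > 0" "compact K"
  then obtain \<tau> where \<tau>: "\<tau> > 0" "\<And>t \<xi> l. 0 < t \<Longrightarrow> t < \<tau> \<Longrightarrow> \<xi> \<in> K \<Longrightarrow> l \<le> 2 \<Longrightarrow>
    \<bar>t ^ l * (deriv ^^ l) (\<lambda>s. Qt (tpow s E *v \<xi>)) t\<bar> \<le> \<epsilon> * t"
    by (rule strongly_subhomogD[OF sQ]) (rule that)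
  then show "\<exists>\<tau>>0. \<forall>t. 0 < t \<and> t < \<tau> \<longrightarrow> (\<forall>\<xi>\<in>K. \<bar>Qt (tpow t E *v \<xi>)\<bar> \<le> \<epsilon> * t)"
    using \<tau>(2)[where l = 0] by (intro exI[of _ \<tau>]) simp
qed (use Qt assms that in auto)

text \<open>Both sides scale by \<open>exp (k * u)\<close> along orbits, so it is enough to compare
  them on the compact unit level set of \<open>P\<close>.\<close>

lemma R_bound: obtains CR where "CR > 0" "\<And>\<xi>. R \<xi> \<le> CR * P \<xi> powr k"
proof -
  have "compact (R ` {\<xi>. P \<xi> = 1})"
    by (intro compact_continuous_image compact_sphere continuous_on_subset[OF RR.P_cont]) auto
  then have "bounded (R ` {\<xi>. P \<xi> = 1})" by (rule compact_imp_bounded)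
  then obtain B where B: "B > 0" "\<And>\<xi>. P \<xi> = 1 \<Longrightarrow> \<bar>R \<xi>\<bar> \<le> B"
    by (auto simp: bounded_pos)
  show thesis
  proof
    show "B > 0" by fact
    fix \<xi> show "R \<xi> \<le> B * P \<xi> powr k"
    proof (cases "\<xi> = 0")
      case True
      have "R 0 = 0" "P 0 = 0" using RR.P_0_iff[of 0] P_0_iff[of 0] by auto
      then show ?thesis using True by simp
    next
      case False
      then obtain \<omega> where \<omega>: "P \<omega> = 1" "flow E (ln (P \<xi>)) *v \<omega> = \<xi>"
        by (rule polar_decomp)
      have "R \<xi> = exp (k * ln (P \<xi>)) * R \<omega>" unfolding R_flow[symmetric] \<omega> ..
      also have "\<dots> = P \<xi> powr k * R \<omega>" using False P_pos_iff[of \<xi>] by (simp add: powr_def)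
      also have "\<dots> \<le> P \<xi> powr k * B" using B(2)[OF \<omega>(1)] by (intro mult_left_mono) auto
      finally show ?thesis by (simp add: mult.commute)
    qed
  qed
qed

lemma shell_bounds:
  obtains r m where "r > 0" "m > 0" "\<And>\<zeta>. \<zeta> \<in> shell \<Longrightarrow> norm \<zeta> \<le> r" "\<And>\<zeta>. \<zeta> \<in> shell \<Longrightarrow> m \<le> R \<zeta>"
proof -
  obtain r where r: "r > 0" "\<And>\<zeta>. \<zeta> \<in> shell \<Longrightarrow> norm \<zeta> \<le> r"
    using compact_imp_bounded[OF compact_shell] unfolding bounded_pos by blast
  show thesis
  proof (cases "shell = {}")
    case True
    then show thesis using that[of r 1] r by auto
  next
    case False
    obtain z where z: "z \<in> shell" "\<And>\<zeta>. \<zeta> \<in> shell \<Longrightarrow> R z \<le> R \<zeta>"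
      using continuous_attains_inf[OF compact_shell False continuous_on_subset[OF RR.P_cont]] by auto
    have "z \<noteq> 0" using z(1) P_0_iff[of 0] by (auto simp: shell_def)
    then have "R z > 0" by (simp add: RR.P_pos_iff)
    then show thesis using that[of r "R z"] r z by blast
  qed
qed

text \<open>The constant of \<open>oscillatory_integral_bound\<close>, enlarged by
  \<open>exp (1 - \<mu>)\<close> because orbit intervals may start at \<open>ln a - 1\<close>
  instead of \<open>ln a\<close>.\<close>

definition osc_const :: "real \<Rightarrow> real \<Rightarrow> real" where
  "osc_const c D = (2 / c + ((D + \<bar>\<mu>\<bar>) / c + D / c\<^sup>2) / (1 - \<mu>)) * exp (1 - \<mu>)"

lemma osc_const_pos: "c > 0 \<Longrightarrow> D \<ge> 0 \<Longrightarrow> osc_const c D > 0"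
  unfolding osc_const_def using mu1 by (intro mult_pos_pos add_pos_nonneg divide_nonneg_nonneg) auto

text \<open>Rephrases the oscillatory estimate in terms of the level \<open>a\<close> of an annulus,
  the form expected by \<open>polar_bound\<close>.\<close>

lemma phase_amplitude_bound:
  assumes c: "c > 0" "D \<ge> 0" and h: "N > 0" "a > 0" "\<alpha> \<le> \<beta>" "ln a - 1 \<le> \<alpha>"
    and d: "\<And>u. u \<in> {\<alpha>..\<beta>} \<Longrightarrow> (\<phi> has_real_derivative \<phi>1 u) (at u)"
      "\<And>u. u \<in> {\<alpha>..\<beta>} \<Longrightarrow> (\<phi>1 has_real_derivative \<phi>2 u) (at u)"
      "\<And>u. u \<in> {\<alpha>..\<beta>} \<Longrightarrow> (A has_vector_derivative A1 u) (at u)"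
    and b: "\<And>u. u \<in> {\<alpha>..\<beta>} \<Longrightarrow> c * N * exp u \<le> \<bar>\<phi>1 u\<bar>"
      "\<And>u. u \<in> {\<alpha>..\<beta>} \<Longrightarrow> \<bar>\<phi>2 u\<bar> \<le> D * N * exp u"
      "\<And>u. u \<in> {\<alpha>..\<beta>} \<Longrightarrow> norm (A u) \<le> 1"
      "\<And>u. u \<in> {\<alpha>..\<beta>} \<Longrightarrow> norm (A1 u) \<le> D"
  shows "norm (integral {\<alpha>..\<beta>} (\<lambda>u. exp (\<mu> * u) *\<^sub>R (exp (- (\<i> * of_real (\<phi> u))) * A u)))
     \<le> osc_const c D * a powr (\<mu> - 1) / N"
proof -
  define L where "L = 2 / c + ((D + \<bar>\<mu>\<bar>) / c + D / c\<^sup>2) / (1 - \<mu>)"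
  have L: "L > 0"
    unfolding L_def using c mu1 by (intro add_pos_nonneg divide_nonneg_nonneg) auto
  have "norm (integral {\<alpha>..\<beta>} (\<lambda>u. exp (- (\<i> * of_real (\<phi> u))) * (exp (\<mu> * u) *\<^sub>R A u)))
    \<le> L * exp (\<alpha> * (\<mu> - 1)) / N"
    unfolding L_def
    by (rule oscillatory_integral_bound[OF mu1 c h(1,3), of \<phi> \<phi>1 \<phi>2 A A1])
       (use d b in \<open>auto intro: has_field_derivative_at_within has_vector_derivative_at_within\<close>)
  also have "\<dots> \<le> L * (exp (1 - \<mu>) * a powr (\<mu> - 1)) / N"
  proof -
    have "\<alpha> * (\<mu> - 1) \<le> (ln a - 1) * (\<mu> - 1)"
      using h(4) mu1 by (intro mult_right_mono_neg) auto
    then have "exp (\<alpha> * (\<mu> - 1)) \<le> exp ((1 - \<mu>) + (\<mu> - 1) * ln a)"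
      by (simp add: algebra_simps)
    also have "\<dots> = exp (1 - \<mu>) * a powr (\<mu> - 1)" using h(2) by (simp only: exp_add powr_def) simp
    finally show ?thesis using L h(1) by (intro divide_right_mono mult_left_mono) auto
  qed
  finally show ?thesis
    by (simp add: osc_const_def L_def mult_ac)
qed

lemma inner_flow_derivative:
  "((\<lambda>u. y \<bullet> (flow E u *v \<zeta>)) has_real_derivative y \<bullet> (E *v (flow E u *v \<zeta>))) (at u)"
  using bounded_linear.has_vector_derivative[OF bounded_linear_inner_right flow_vector_derivative]
  by (simp add: has_real_derivative_iff_has_vector_derivative)

lemma inner_E_flow_derivative:
  "((\<lambda>u. y \<bullet> (E *v (flow E u *v \<zeta>))) has_real_derivative y \<bullet> (E *v (E *v (flow E u *v \<zeta>)))) (at u)"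
  using bounded_linear.has_vector_derivative[OF
      bounded_linear_compose[OF bounded_linear_inner_right matrix_vector_mul_bounded_linear] flow_vector_derivative]
  by (simp add: has_real_derivative_iff_has_vector_derivative)

text \<open>Here the annuli reach to infinity, so the linear term must be part of the phase. By
  \<open>flow_growth\<close> its orbit derivatives are of order \<open>1 + exp (u / 2)\<close>,
  which is at most half of \<open>n * exp u\<close> once \<open>n * exp u\<close> exceeds a
  constant. This is why the estimate starts at the level \<open>T0 / n\<close>.\<close>

lemma tail_j:
  assumes \<rho>: "\<rho> > 0"
  obtains C T0 where "C > 0" "T0 > 0"
    "\<And>n y a b. n \<ge> 1 \<Longrightarrow> norm y \<le> \<rho> \<Longrightarrow> T0 / n \<le> a \<Longrightarrow> a \<le> b \<Longrightarrow>
      j n y absolutely_integrable_on {\<xi>. a \<le> P \<xi> \<and> P \<xi> < b} \<and>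
      norm (integral {\<xi>. a \<le> P \<xi> \<and> P \<xi> < b} (j n y)) \<le> C * a powr (\<mu> - 1) / n"
proof -
  obtain r m where r: "r > 0" "\<And>\<zeta>. \<zeta> \<in> shell \<Longrightarrow> norm \<zeta> \<le> r"
    using shell_bounds by metis
  obtain C1 where C1: "C1 > 0" "\<And>u x. u \<le> 0 \<Longrightarrow> norm (flow E u *v x) \<le> C1 * norm x"
    using flow_bounded[of 0] by blast
  obtain C2 where C2: "C2 > 0" "\<And>u x. u \<ge> 0 \<Longrightarrow> norm (flow E u *v x) \<le> C2 * exp (u / 2) * norm x"
    using flow_growth[OF quad] by blast
  \<comment> \<open>Being at least 1, \<open>e * e\<close> bounds the effect of one factor
    \<open>E\<close> as well as of two.\<close>
  define e where "e = max 1 (norm E)"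
  define G where "G = \<rho> * e * e * (C1 + C2) * r"
  have e: "e \<ge> 1" "norm E \<le> e" by (auto simp: e_def)
  have G: "G > 0" using \<rho> r C1 C2 e by (simp add: G_def)
  have flow_le: "norm (flow E u *v \<zeta>) \<le> (C1 + C2) * (1 + exp (u / 2)) * r" if "\<zeta> \<in> shell" for u \<zeta>
  proof (cases "u \<le> 0")
    case True
    have "norm (flow E u *v \<zeta>) \<le> C1 * norm \<zeta>" by (rule C1(2)[OF True])
    also have "\<dots> \<le> (C1 + C2) * (1 + exp (u / 2)) * r"
    proof (rule mult_mono)
      show "C1 \<le> (C1 + C2) * (1 + exp (u / 2))"
        using C1 C2 mult_mono[of C1 "C1 + C2" 1 "1 + exp (u / 2)"] by simp
    qed (use r that C1 C2 in \<open>auto intro!: mult_nonneg_nonneg add_nonneg_nonneg\<close>)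
    finally show ?thesis .
  next
    case False
    then have "norm (flow E u *v \<zeta>) \<le> C2 * exp (u / 2) * norm \<zeta>" by (intro C2) simp
    also have "\<dots> \<le> (C1 + C2) * (1 + exp (u / 2)) * r"
      using r that C1 C2 by (intro mult_mono) (auto intro!: mult_nonneg_nonneg add_nonneg_nonneg)
    finally show ?thesis .
  qed
  have E_le: "norm (E *v x) \<le> e * norm x" for x
    using norm_matrix_vector_le[of E x] mult_right_mono[OF e(2), of "norm x"] by simp
  have y1: "\<bar>y \<bullet> (E *v (flow E u *v \<zeta>))\<bar> \<le> G * (1 + exp (u / 2))"
    and y2: "\<bar>y \<bullet> (E *v (E *v (flow E u *v \<zeta>)))\<bar> \<le> G * (1 + exp (u / 2))"
    if y: "norm y \<le> \<rho>" and z: "\<zeta> \<in> shell" for y u \<zeta>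
  proof -
    let ?p = "flow E u *v \<zeta>"
    have a: "norm (E *v ?p) \<le> e * norm ?p" by (rule E_le)
    also have "\<dots> \<le> e * (e * norm ?p)"
      using e mult_right_mono[of 1 e "norm ?p"] by (intro mult_left_mono) auto
    finally have 1: "norm (E *v ?p) \<le> e * (e * norm ?p)" .
    have "norm (E *v (E *v ?p)) \<le> e * norm (E *v ?p)" by (rule E_le)
    also have "\<dots> \<le> e * (e * norm ?p)" using a e by (intro mult_left_mono) auto
    finally have 2: "norm (E *v (E *v ?p)) \<le> e * (e * norm ?p)" .
    have "\<rho> * (e * (e * norm ?p)) \<le> \<rho> * (e * (e * ((C1 + C2) * (1 + exp (u / 2)) * r)))"
      using flow_le[OF z, of u] e \<rho> by (intro mult_left_mono) auto
    also have "\<dots> = G * (1 + exp (u / 2))" by (simp add: G_def mult_ac)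
    finally have 3: "\<rho> * (e * (e * norm ?p)) \<le> G * (1 + exp (u / 2))" .
    have 4: "\<bar>y \<bullet> v\<bar> \<le> \<rho> * (e * (e * norm ?p))" if "norm v \<le> e * (e * norm ?p)" for v
      using Cauchy_Schwarz_ineq2[of y v] mult_mono[OF y that] \<rho> by simp
    show "\<bar>y \<bullet> (E *v ?p)\<bar> \<le> G * (1 + exp (u / 2))" "\<bar>y \<bullet> (E *v (E *v ?p))\<bar> \<le> G * (1 + exp (u / 2))"
      using 3 4[OF 1] 4[OF 2] by linarith+
  qed
  \<comment> \<open>\<open>4 * G\<close> lets a quarter of \<open>n * exp u\<close> absorb
    \<open>G\<close>, and \<open>16 * G\<^sup>2\<close> lets another quarter absorb
    \<open>G * exp (u / 2)\<close>. In \<open>T0\<close> the factor \<open>exp 1\<close> accounts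
    for orbits that start at \<open>ln a - 1\<close>.\<close>
  define T1 where "T1 = max (4 * G) (16 * G\<^sup>2)"
  define T0 where "T0 = exp 1 * T1"
  have T1: "T1 \<ge> 4 * G" "T1 \<ge> 16 * G\<^sup>2" "T1 > 0" using G by (auto simp: T1_def)
  have key: "G * (1 + exp (u / 2)) \<le> n * exp u / 2" if n: "n \<ge> 1" and u: "T1 \<le> n * exp u" for n u
  proof -
    define s where "s = n * exp (u / 2)"
    have "(4 * G)\<^sup>2 \<le> n * exp u" using u T1(2) by (simp add: power_mult_distrib)
    also have "\<dots> \<le> n * (n * exp u)" using n by (intro mult_left_mono) auto
    also have "\<dots> = s\<^sup>2" by (simp add: s_def power2_eq_square flip: exp_add)
    finally have "4 * G \<le> s" by (rule power2_le_imp_le) (use n in \<open>auto simp: s_def\<close>)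
    then have "4 * G * exp (u / 2) \<le> s * exp (u / 2)" by (intro mult_right_mono) auto
    also have "\<dots> = n * exp u" by (simp add: s_def flip: exp_add)
    finally show ?thesis using u T1(1) by (simp add: algebra_simps)
  qed
  \<comment> \<open>On the shell \<open>\<bar>Q\<bar>\<close> lies between 1 and
    \<open>exp 1\<close>, and the linear term changes this by at most one half; hence the constants.
    The amplitude is identically 1.\<close>
  define M where "M = osc_const (1/2) (exp 1 + 1)"
  have M: "M > 0" unfolding M_def by (intro osc_const_pos) (auto intro: add_nonneg_nonneg)
  show thesis
  proof (rule that[of "M * measure lborel shell + 1" T0])
    show "M * measure lborel shell + 1 > 0" using M by (simp add: add_nonneg_pos)
    show "T0 > 0" using T1 by (simp add: T0_def)
    fix n a b :: real and y :: "real^'n"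
    assume n: "n \<ge> 1" and y: "norm y \<le> \<rho>" and a: "T0 / n \<le> a" and ab: "a \<le> b"
    have a0: "a > 0" using a T1 n by (simp add: T0_def) (meson divide_pos_pos exp_gt_zero less_le_trans mult_pos_pos zero_less_one)
    have M0: "M * a powr (\<mu> - 1) / n \<ge> 0" using M n by simp
    have in_bound: "norm (integral {\<alpha>..\<beta>} (\<lambda>u. exp (\<mu> * u) *\<^sub>R j n y (flow E u *v \<zeta>))) \<le> M * a powr (\<mu> - 1) / n"
      if z: "\<zeta> \<in> shell" and \<alpha>\<beta>: "\<alpha> \<le> \<beta>" "ln a - 1 \<le> \<alpha>" for \<zeta> \<alpha> \<beta>
    proof -
      define \<phi> where "\<phi> = (\<lambda>u. n * (exp u * Q \<zeta>) + y \<bullet> (flow E u *v \<zeta>))"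
      define \<phi>1 where "\<phi>1 = (\<lambda>u. n * (exp u * Q \<zeta>) + y \<bullet> (E *v (flow E u *v \<zeta>)))"
      define \<phi>2 where "\<phi>2 = (\<lambda>u. n * (exp u * Q \<zeta>) + y \<bullet> (E *v (E *v (flow E u *v \<zeta>))))"
      have eq: "j n y (flow E u *v \<zeta>) = exp (- (\<i> * of_real (\<phi> u))) * 1" for u
        unfolding mult_1_right j_def by (rule arg_cong[where f = exp]) (simp add: \<phi>_def Q_flow algebra_simps)
      have b: "\<bar>\<phi>1 u\<bar> \<ge> (1/2) * n * exp u \<and> \<bar>\<phi>2 u\<bar> \<le> (exp 1 + 1) * n * exp u" if u: "u \<in> {\<alpha>..\<beta>}" for u
      proof -
        have "T1 \<le> n * exp u"
        proof -
          have "exp (ln a - 1) \<le> exp u" using u \<alpha>\<beta> by simp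
          then have "a \<le> exp 1 * exp u" using a0 by (simp add: exp_diff field_simps)
          then have "T0 / n \<le> exp 1 * exp u" using a by linarith
          then show ?thesis using n by (simp add: T0_def field_simps)
        qed
        from key[OF n this] have k2: "G * (1 + exp (u / 2)) \<le> n * exp u / 2" .
        have q: "1 \<le> \<bar>Q \<zeta>\<bar>" "\<bar>Q \<zeta>\<bar> \<le> exp 1" using z by (auto simp: shell_def PQ)
        have nq: "\<bar>n * (exp u * Q \<zeta>)\<bar> = n * exp u * \<bar>Q \<zeta>\<bar>" using n by (simp add: abs_mult)
        have "n * exp u * 1 \<le> n * exp u * \<bar>Q \<zeta>\<bar>" "n * exp u * \<bar>Q \<zeta>\<bar> \<le> n * exp u * exp 1"
          using q n by (intro mult_left_mono; simp)+
        then have "n * exp u \<le> \<bar>n * (exp u * Q \<zeta>)\<bar>" "\<bar>n * (exp u * Q \<zeta>)\<bar> \<le> exp 1 * n * exp u"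
          unfolding nq by (simp_all add: mult_ac)
        moreover have "\<bar>\<phi>1 u\<bar> \<ge> \<bar>n * (exp u * Q \<zeta>)\<bar> - \<bar>y \<bullet> (E *v (flow E u *v \<zeta>))\<bar>"
          "\<bar>\<phi>2 u\<bar> \<le> \<bar>n * (exp u * Q \<zeta>)\<bar> + \<bar>y \<bullet> (E *v (E *v (flow E u *v \<zeta>)))\<bar>"
          unfolding \<phi>1_def \<phi>2_def by linarith+
        moreover have "n * exp u / 2 \<le> 1 * n * exp u" using n by simp
        moreover have "(exp 1 + 1) * n * exp u = exp 1 * n * exp u + n * exp u" by (simp add: algebra_simps)
        ultimately show ?thesis
          using y1[OF y z, of u] y2[OF y z, of u] k2 by linarith
      qed
      have D1: "(\<phi> has_real_derivative \<phi>1 u) (at u)" and D2: "(\<phi>1 has_real_derivative \<phi>2 u) (at u)" for u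
        unfolding \<phi>_def \<phi>1_def \<phi>2_def
        by (intro DERIV_add DERIV_cmult DERIV_cmult_right DERIV_exp inner_flow_derivative inner_E_flow_derivative)+
      show ?thesis
        unfolding eq M_def
        by (rule phase_amplitude_bound[where ?\<phi>1.0 = \<phi>1 and ?\<phi>2.0 = \<phi>2 and ?A1.0 = "\<lambda>_. 0"])
           (use n a0 \<alpha>\<beta> b D1 D2 in \<open>auto intro: add_nonneg_nonneg\<close>)
    qed
    note pb = polar_bound[OF a0 ab j_cont M0, of n y]
    have "norm (integral {\<xi>. a \<le> P \<xi> \<and> P \<xi> < b} (j n y)) \<le> (M * a powr (\<mu> - 1) / n) * measure lborel shell"
      by (rule pb(2)) (rule in_bound)
    also have "\<dots> \<le> (M * measure lborel shell + 1) * a powr (\<mu> - 1) / n"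
      using n by (simp add: field_simps)
    finally show "j n y absolutely_integrable_on {\<xi>. a \<le> P \<xi> \<and> P \<xi> < b} \<and>
      norm (integral {\<xi>. a \<le> P \<xi> \<and> P \<xi> < b} (j n y)) \<le> (M * measure lborel shell + 1) * a powr (\<mu> - 1) / n"
      using pb(1)[OF in_bound] by blast
  qed
qed

end

section \<open>The limit integral and the local approximation\<close>

context imag_local
begin

text \<open>The limit inside \<open>attr_imag\<close>, without the normalising factor.
  \<open>Lim\<close> is a total function; that the limit really exists is part of the proof of
  \<open>L_approx\<close>.\<close>

definition L :: "real \<Rightarrow> real^'n \<Rightarrow> complex" where
  "L n y = Lim at_top (\<lambda>\<tau>. integral {\<xi>. P \<xi> < \<tau>} (j n y))"

lemma sublevel_integrable:
  fixes g :: "real^'n \<Rightarrow> complex"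
  assumes "continuous_on {\<xi>. P \<xi> \<le> b} g"
  shows "g absolutely_integrable_on {\<xi>. P \<xi> < b}"
proof -
  have "compact {\<xi>. P \<xi> \<le> b}"
    unfolding compact_eq_bounded_closed
    by (intro conjI bounded_sublevel closed_Collect_le P_cont continuous_on_const)
  then have "set_integrable lborel {\<xi>. P \<xi> \<le> b} g"
    unfolding set_integrable_def by (rule borel_integrable_compact[OF _ assms])
  then have "set_integrable lebesgue {\<xi>. P \<xi> \<le> b} g"
    unfolding set_integrable_def by (simp add: integrable_completion borel_measurable_integrable)
  then show ?thesis
    by (rule set_integrable_subset) (auto simp: open_sublevel lmeasurable_open[THEN fmeasurableD] borel_open)
qed

lemma norm_integral_sublevel:
  fixes g :: "real^'n \<Rightarrow> complex"
  assumes g: "g integrable_on {\<xi>. P \<xi> < b}" and b: "b > 0" and le: "\<And>\<xi>. P \<xi> < b \<Longrightarrow> norm (g \<xi>) \<le> c"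
  shows "norm (integral {\<xi>. P \<xi> < b} g) \<le> c * (b powr \<mu> * V)"
proof -
  let ?S = "{\<xi>. P \<xi> < b}"
  have S: "?S \<in> lmeasurable"
    by (rule lmeasurable_open[OF bounded_subset[OF bounded_sublevel[of b]] open_sublevel]) auto
  have "norm (integral ?S g) \<le> integral ?S (\<lambda>_. c)"
    using g le integrable_on_const[OF S] by (intro integral_norm_bound_integral) auto
  also have "\<dots> = c * measure lebesgue ?S"
    using lmeasure_integral[OF S] integral_mult_right[of ?S c "\<lambda>_. 1"] by simp
  also have "measure lebesgue ?S = b powr \<mu> * V"
    using measure_sublevel[OF b] open_sublevel[of b] by (simp add: measure_completion)
  finally show ?thesis .
qed

text \<open>Two truncated integrals differ by an integral over an annulus. From the level
  \<open>T0 / n\<close> on, \<open>tail_j\<close> makes them a Cauchy family, and the rate carries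
  over to the limit.\<close>

lemma L_approx:
  assumes \<rho>: "\<rho> > 0"
  obtains C T0 where "C > 0" "T0 > 0"
    "\<And>n y a. n \<ge> 1 \<Longrightarrow> norm y \<le> \<rho> \<Longrightarrow> T0 / n \<le> a \<Longrightarrow>
      norm (L n y - integral {\<xi>. P \<xi> < a} (j n y)) \<le> C * a powr (\<mu> - 1) / n"
proof -
  obtain C T0 where C: "C > 0" "T0 > 0"
    and tail: "\<And>n y a b. n \<ge> 1 \<Longrightarrow> norm y \<le> \<rho> \<Longrightarrow> T0 / n \<le> a \<Longrightarrow> a \<le> b \<Longrightarrow>
      j n y absolutely_integrable_on {\<xi>. a \<le> P \<xi> \<and> P \<xi> < b} \<and>
      norm (integral {\<xi>. a \<le> P \<xi> \<and> P \<xi> < b} (j n y)) \<le> C * a powr (\<mu> - 1) / n"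
    by (rule tail_j[OF \<rho>]) (rule that)
  show thesis
  proof (rule that[OF C])
    fix n a :: real and y :: "real^'n"
    assume n: "n \<ge> 1" and y: "norm y \<le> \<rho>" and a: "T0 / n \<le> a"
    let ?I = "\<lambda>\<tau>. integral {\<xi>. P \<xi> < \<tau>} (j n y)"
    have 1: "norm (?I b - ?I a) \<le> C * a powr (\<mu> - 1) / n" if "T0 / n \<le> a" "a \<le> b" for a b
    proof -
      have "?I b = ?I a + integral {\<xi>. a \<le> P \<xi> \<and> P \<xi> < b} (j n y)"
        using tail[OF n y that] that by (intro integral_diff_sublevel sublevel_integrable j_cont) auto
      then show ?thesis using tail[OF n y that] by simp
    qed
    have 2: "((\<lambda>a. C * a powr (\<mu> - 1) / n) \<longlongrightarrow> 0) at_top"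
    proof -
      have "((\<lambda>a. a powr (\<mu> - 1)) \<longlongrightarrow> 0) at_top"
        by (rule tendsto_neg_powr) (use mu1 filterlim_ident in auto)
      from tendsto_mult_right[OF this, of "C / n"] show ?thesis by (simp add: field_simps)
    qed
    obtain l where l: "(?I \<longlongrightarrow> l) at_top" "\<And>a. T0 / n \<le> a \<Longrightarrow> norm (l - ?I a) \<le> C * a powr (\<mu> - 1) / n"
    proof (rule tendsto_at_top_of_tail_bound[of "T0 / n" ?I])
      show "norm (?I b - ?I a) \<le> C * a powr (\<mu> - 1) / n" if "T0 / n \<le> a" "a \<le> b" for a b
        by (rule 1[OF that])
    qed (rule 2, rule that)
    have "L n y = l"
      unfolding L_def by (rule tendsto_Lim[OF _ l(1)]) simp
    then show "norm (L n y - ?I a) \<le> C * a powr (\<mu> - 1) / n"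
      using l(2)[OF a] by simp
  qed
qed

lemma norm_j: "norm (j n y \<xi>) = 1"
proof -
  have "- \<i> * of_real (n * Q \<xi>) - \<i> * of_real (y \<bullet> \<xi>) = \<i> * of_real (- (n * Q \<xi> + y \<bullet> \<xi>))"
    by (simp add: algebra_simps)
  then show ?thesis unfolding j_def by (simp only: norm_exp_i_times)
qed

text \<open>Cut at the level \<open>T0 / n\<close>: inside, the volume of the sublevel set suffices,
  outside the tail estimate. Both have the order \<open>n powr (- \<mu>)\<close>.\<close>

lemma L_bound:
  assumes \<rho>: "\<rho> > 0"
  obtains C where "C > 0" "\<And>n y. n \<ge> 1 \<Longrightarrow> norm y \<le> \<rho> \<Longrightarrow> norm (L n y) \<le> C * n powr (- \<mu>)"
proof -
  obtain C T0 where C: "C > 0" "T0 > 0" and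
    L: "\<And>n y a. n \<ge> 1 \<Longrightarrow> norm y \<le> \<rho> \<Longrightarrow> T0 / n \<le> a \<Longrightarrow>
      norm (L n y - integral {\<xi>. P \<xi> < a} (j n y)) \<le> C * a powr (\<mu> - 1) / n"
    by (rule L_approx[OF \<rho>]) (rule that)
  show thesis
  proof (rule that[of "C * T0 powr (\<mu> - 1) + T0 powr \<mu> * V"])
    show "C * T0 powr (\<mu> - 1) + T0 powr \<mu> * V > 0" using C V_pos by (simp add: add_pos_pos)
    fix n :: real and y :: "real^'n" assume n: "n \<ge> 1" and y: "norm y \<le> \<rho>"
    have "norm (integral {\<xi>. P \<xi> < T0 / n} (j n y)) \<le> 1 * ((T0 / n) powr \<mu> * V)"
      using sublevel_integrable[OF j_cont, of "T0 / n" n y] C n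
      by (intro norm_integral_sublevel) (auto simp: norm_j absolutely_integrable_on_def)
    moreover have "norm (L n y) \<le> norm (L n y - integral {\<xi>. P \<xi> < T0 / n} (j n y)) + norm (integral {\<xi>. P \<xi> < T0 / n} (j n y))"
      using norm_triangle_ineq[of "L n y - integral {\<xi>. P \<xi> < T0 / n} (j n y)" "integral {\<xi>. P \<xi> < T0 / n} (j n y)"] by simp
    ultimately have "norm (L n y) \<le> C * (T0 / n) powr (\<mu> - 1) / n + (T0 / n) powr \<mu> * V"
      using L[OF n y order_refl] by linarith
    also have "\<dots> = (C * T0 powr (\<mu> - 1) + T0 powr \<mu> * V) * n powr (- \<mu>)"
      using n C by (simp add: powr_divide powr_diff powr_minus field_simps)
    finally show "norm (L n y) \<le> (C * T0 powr (\<mu> - 1) + T0 powr \<mu> * V) * n powr (- \<mu>)" .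
  qed
qed

text \<open>On a fixed neighbourhood the orbit derivative of the linear term is bounded, so that
  term can join the damping in the amplitude; no lower threshold on \<open>a\<close> arises, in
  contrast to \<open>tail_j\<close>. The phase is \<open>Q + Qt\<close>, which explains why two
  orbit derivatives of \<open>Qt\<close> but only one of \<open>Rt\<close> have to be
  controlled.\<close>

lemma tail_f:
  obtains \<delta>0 where "\<delta>0 > 0" "{\<xi>. P \<xi> < \<delta>0} \<subseteq> U" "\<And>\<xi>. P \<xi> < \<delta>0 \<Longrightarrow> \<bar>Rt \<xi>\<bar> \<le> R \<xi> / 2"
    "\<And>\<rho>. \<rho> > 0 \<Longrightarrow> \<exists>C>0. \<forall>n y a b. n \<ge> 1 \<longrightarrow> norm y \<le> \<rho> \<longrightarrow> 0 < a \<longrightarrow> a \<le> b \<longrightarrow> b < \<delta>0 \<longrightarrow>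
      f n y absolutely_integrable_on {\<xi>. a \<le> P \<xi> \<and> P \<xi> < b} \<and>
      norm (integral {\<xi>. a \<le> P \<xi> \<and> P \<xi> < b} (f n y)) \<le> C * a powr (\<mu> - 1) / n"
proof -
  obtain g2 where g2: "\<And>u \<zeta>. flow E u *v \<zeta> \<in> U \<Longrightarrow> (orbit_deriv E Qt \<zeta> has_real_derivative g2 \<zeta> u) (at u)"
    by (rule orbit_deriv2[OF Qt(1)]) (rule that)
  \<comment> \<open>On the shell \<open>\<bar>Q\<bar>\<close> is at least 1. An error of a quarter
    in the first derivative leaves more than one half of the phase derivative, and the second
    derivative changes by at most one half.\<close>
  obtain \<tau>Q where \<tau>Q: "\<tau>Q > 0" "\<And>u \<zeta>. exp u < \<tau>Q \<Longrightarrow> \<zeta> \<in> shell \<Longrightarrow> flow E u *v \<zeta> \<in> U \<Longrightarrow>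
    \<bar>orbit_deriv E Qt \<zeta> u\<bar> \<le> (1/4) * exp u \<and> \<bar>g2 \<zeta> u\<bar> \<le> 2 * (1/4) * exp u"
    by (rule strongly_subhomog_orbit2[OF sQ Qt(1) U(1) compact_shell _ g2, of "1/4"]) (auto intro: that)
  let ?E = "(1/k) *\<^sub>R E"
  obtain \<tau>R where \<tau>R: "\<tau>R > 0" "\<And>v \<zeta>. exp v < \<tau>R \<Longrightarrow> \<zeta> \<in> shell \<Longrightarrow> flow ?E v *v \<zeta> \<in> U \<Longrightarrow>
    \<bar>orbit_deriv ?E Rt \<zeta> v\<bar> \<le> 1 * exp v"
    by (rule strongly_subhomog_orbit1[OF sR _ Rt(1) compact_shell, of 1]) (auto intro: that)
  obtain r m where r: "r > 0" "m > 0" "\<And>\<zeta>. \<zeta> \<in> shell \<Longrightarrow> norm \<zeta> \<le> r" "\<And>\<zeta>. \<zeta> \<in> shell \<Longrightarrow> m \<le> R \<zeta>"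
    by (rule shell_bounds) (rule that)
  obtain dR where dR: "dR > 0" "\<And>\<xi>. P \<xi> < dR \<Longrightarrow> \<bar>Rt \<xi>\<bar> \<le> (1/2) * R \<xi>"
    by (rule Rt_small[of "1/2"]) (auto intro: that)
  obtain dU where dU: "dU > 0" "{\<xi>. P \<xi> < dU} \<subseteq> U"
    by (rule small_sublevel[OF U]) (rule that)
  \<comment> \<open>Time \<open>u\<close> for \<open>E\<close> is time \<open>k * u\<close> for
    \<open>E / k\<close>. So \<open>exp u\<close> has to stay below the k-th root of the threshold
    of \<open>Rt\<close>.\<close>
  define \<delta>0 where "\<delta>0 = min (min dU dR) (min \<tau>Q (\<tau>R powr (1/k)))"
  have \<delta>0: "\<delta>0 > 0" "\<delta>0 \<le> dU" "\<delta>0 \<le> dR" "\<delta>0 \<le> \<tau>Q" "\<delta>0 \<le> \<tau>R powr (1/k)"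
    using dU dR \<tau>Q \<tau>R by (auto simp: \<delta>0_def)
  obtain C3 where C3: "C3 > 0" "\<And>u x. u \<le> ln \<delta>0 \<Longrightarrow> norm (flow E u *v x) \<le> C3 * norm x"
    by (rule flow_bounded[of "ln \<delta>0"]) (rule that)
  show thesis
  proof (rule that[OF \<delta>0(1)])
    show sub: "{\<xi>. P \<xi> < \<delta>0} \<subseteq> U" using dU \<delta>0 by auto
    show Rt2: "\<bar>Rt \<xi>\<bar> \<le> R \<xi> / 2" if "P \<xi> < \<delta>0" for \<xi> using dR(2)[of \<xi>] that \<delta>0 by auto
    fix \<rho> :: real assume \<rho>: "\<rho> > 0"
    \<comment> \<open>\<open>exp 1 + 1/2\<close> bounds the second derivative of the phase, the
      summand with \<open>k\<close> the derivative of the damping, and the last summand that of the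
      linear term.\<close>
    define D where "D = exp 1 + 1/2 + 2 * k * (1 + 1/m) + \<rho> * (norm E * (C3 * r))"
    have D: "D \<ge> 0" "exp 1 + 1/2 \<le> D" "2 * k * (1 + 1/m) + \<rho> * (norm E * (C3 * r)) \<le> D"
      using k r C3 \<rho> by (auto simp: D_def intro!: add_nonneg_nonneg mult_nonneg_nonneg)
    define M where "M = osc_const (1/2) D"
    have M: "M > 0" unfolding M_def using D by (intro osc_const_pos) auto
    show "\<exists>C>0. \<forall>n y a b. n \<ge> 1 \<longrightarrow> norm y \<le> \<rho> \<longrightarrow> 0 < a \<longrightarrow> a \<le> b \<longrightarrow> b < \<delta>0 \<longrightarrow>
      f n y absolutely_integrable_on {\<xi>. a \<le> P \<xi> \<and> P \<xi> < b} \<and>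
      norm (integral {\<xi>. a \<le> P \<xi> \<and> P \<xi> < b} (f n y)) \<le> C * a powr (\<mu> - 1) / n"
    proof (rule exI[of _ "M * measure lborel shell + 1"], intro conjI[of "_ > _"] allI impI)
      show "M * measure lborel shell + 1 > 0" using M by (simp add: add_nonneg_pos)
      fix n a b :: real and y :: "real^'n"
      assume n: "n \<ge> 1" and y: "norm y \<le> \<rho>" and a: "0 < a" and ab: "a \<le> b" and b: "b < \<delta>0"
      have M0: "M * a powr (\<mu> - 1) / n \<ge> 0" using M n by simp
      have in_bound: "norm (integral {\<alpha>..\<beta>} (\<lambda>u. exp (\<mu> * u) *\<^sub>R f n y (flow E u *v \<zeta>))) \<le> M * a powr (\<mu> - 1) / n"
        if z: "\<zeta> \<in> shell" and \<alpha>\<beta>: "\<alpha> \<le> \<beta>" "ln a - 1 \<le> \<alpha>"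
          and uu: "\<And>u. u \<in> {\<alpha>..\<beta>} \<Longrightarrow> a \<le> exp u * P \<zeta> \<and> exp u * P \<zeta> \<le> b" for \<zeta> \<alpha> \<beta>
      proof -
        have Pz: "1 \<le> P \<zeta>" "P \<zeta> \<le> exp 1" using z by (auto simp: shell_def)
        have eu: "exp u < \<delta>0" "flow E u *v \<zeta> \<in> U" "P (flow E u *v \<zeta>) < \<delta>0" if u: "u \<in> {\<alpha>..\<beta>}" for u
        proof -
          have "exp u * 1 \<le> exp u * P \<zeta>" using Pz by (intro mult_left_mono) auto
          then show "exp u < \<delta>0" using uu[OF u] b by linarith
          show "P (flow E u *v \<zeta>) < \<delta>0" using uu[OF u] b by (simp add: P_flow)
          then show "flow E u *v \<zeta> \<in> U" using sub by blast
        qed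
        have eku: "exp (k * u) < \<tau>R" if u: "u \<in> {\<alpha>..\<beta>}" for u
        proof -
          have "exp (k * u) = exp u powr k" by (simp add: powr_def mult.commute)
          also have "\<dots> < (\<tau>R powr (1/k)) powr k"
            using eu(1)[OF u] \<delta>0(5) k by (intro powr_less_mono2) auto
          also have "\<dots> = \<tau>R" using k \<tau>R by (simp add: powr_powr)
          finally show ?thesis .
        qed
        \<comment> \<open>The derivative of \<open>Rt\<close> along the orbit of \<open>E\<close>,
          obtained from the orbit of \<open>E / k\<close> by the change of speed.\<close>
        define h1 where "h1 = (\<lambda>u. k * orbit_deriv ?E Rt \<zeta> (k * u))"
        define \<phi> where "\<phi> = (\<lambda>u. n * (exp u * Q \<zeta> + Qt (flow E u *v \<zeta>)))"
        define \<phi>1 where "\<phi>1 = (\<lambda>u. n * (exp u * Q \<zeta> + orbit_deriv E Qt \<zeta> u))"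
        define \<phi>2 where "\<phi>2 = (\<lambda>u. n * (exp u * Q \<zeta> + g2 \<zeta> u))"
        define p where "p = (\<lambda>u. - (n * (exp (k * u) * R \<zeta> + Rt (flow E u *v \<zeta>))))"
        define p1 where "p1 = (\<lambda>u. - (n * (k * exp (k * u) * R \<zeta> + h1 u)))"
        define q where "q = (\<lambda>u. y \<bullet> (flow E u *v \<zeta>))"
        define q1 where "q1 = (\<lambda>u. y \<bullet> (E *v (flow E u *v \<zeta>)))"
        define A where "A = (\<lambda>u. exp (complex_of_real (p u) - \<i> * of_real (q u)))"
        define A1 where "A1 = (\<lambda>u. (complex_of_real (p1 u) - \<i> * of_real (q1 u)) * A u)"
        have eq: "f n y (flow E u *v \<zeta>) = exp (- (\<i> * of_real (\<phi> u))) * A u" for u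
          unfolding f_def A_def exp_add[symmetric]
          by (rule arg_cong[where f = exp]) (simp add: \<phi>_def p_def q_def Q_flow R_flow algebra_simps)
        have dQt: "((\<lambda>u. Qt (flow E u *v \<zeta>)) has_real_derivative orbit_deriv E Qt \<zeta> u) (at u)" if u: "u \<in> {\<alpha>..\<beta>}" for u
          using Ck_on_2_imp_1[OF Qt(1)] eu(2)[OF u] by (intro orbit_deriv1[of 0 U]) simp_all
        have dRt: "((\<lambda>u. Rt (flow E u *v \<zeta>)) has_real_derivative h1 u) (at u)" if u: "u \<in> {\<alpha>..\<beta>}" for u
        proof -
          have "((\<lambda>v. Rt (flow ?E v *v \<zeta>)) has_real_derivative orbit_deriv ?E Rt \<zeta> (k * u)) (at (k * u))"
            using Rt(1) eu(2)[OF u] k by (intro orbit_deriv1[of 0 U]) (simp_all add: flow_k)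
          moreover have "((\<lambda>u. k * u) has_real_derivative k) (at u)"
            by (auto intro!: derivative_eq_intros)
          ultimately have "((\<lambda>u. Rt (flow ?E (k * u) *v \<zeta>)) has_real_derivative orbit_deriv ?E Rt \<zeta> (k * u) * k) (at u)"
            by (rule DERIV_chain2[where g = "\<lambda>u. k * u"])
          then show ?thesis using k by (simp add: flow_k h1_def mult.commute)
        qed
        have d\<phi>: "(\<phi> has_real_derivative \<phi>1 u) (at u)" and d\<phi>1: "(\<phi>1 has_real_derivative \<phi>2 u) (at u)"
          and dp: "(p has_real_derivative p1 u) (at u)" and dq: "(q has_real_derivative q1 u) (at u)"
          if u: "u \<in> {\<alpha>..\<beta>}" for u
        proof -
          show "(\<phi> has_real_derivative \<phi>1 u) (at u)"
            unfolding \<phi>_def \<phi>1_def by (intro DERIV_add DERIV_cmult DERIV_cmult_right DERIV_exp dQt u)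
          show "(\<phi>1 has_real_derivative \<phi>2 u) (at u)"
            unfolding \<phi>1_def \<phi>2_def by (intro DERIV_add DERIV_cmult DERIV_cmult_right DERIV_exp g2 eu u)
          have "((\<lambda>u. exp (k * u) * R \<zeta>) has_real_derivative k * exp (k * u) * R \<zeta>) (at u)"
            by (auto intro!: derivative_eq_intros)
          then show "(p has_real_derivative p1 u) (at u)"
            unfolding p_def p1_def by (intro DERIV_minus DERIV_cmult DERIV_add dRt u)
          show "(q has_real_derivative q1 u) (at u)"
            unfolding q_def q1_def by (rule inner_flow_derivative)
        qed
        have dA: "(A has_vector_derivative A1 u) (at u)" if u: "u \<in> {\<alpha>..\<beta>}" for u
        proof -
          have "((\<lambda>u. complex_of_real (p u) - \<i> * of_real (q u)) has_vector_derivative complex_of_real (p1 u) - \<i> * of_real (q1 u)) (at u)"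
            by (intro has_vector_derivative_diff has_vector_derivative_mult_right has_vector_derivative_of_real dp dq u)
          from field_vector_diff_chain_at[OF this DERIV_exp]
          show ?thesis by (simp add: A_def A1_def o_def)
        qed
        have nA: "norm (A u) \<le> exp (- (n * exp (k * u) * R \<zeta> / 2))" if u: "u \<in> {\<alpha>..\<beta>}" for u
        proof -
          have "- Rt (flow E u *v \<zeta>) \<le> exp (k * u) * R \<zeta> / 2"
            using Rt2[OF eu(3)[OF u]] by (simp add: R_flow)
          then have "n * - Rt (flow E u *v \<zeta>) \<le> n * (exp (k * u) * R \<zeta> / 2)"
            using n by (intro mult_left_mono) auto
          then have "p u \<le> - (n * (exp (k * u) * R \<zeta> / 2))"
            unfolding p_def distrib_left by simp
          then show ?thesis by (simp add: A_def)
        qed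
        have bounds: "(1/2) * n * exp u \<le> \<bar>\<phi>1 u\<bar>" "\<bar>\<phi>2 u\<bar> \<le> D * n * exp u" if u: "u \<in> {\<alpha>..\<beta>}" for u
        proof -
          have ev: "\<bar>orbit_deriv E Qt \<zeta> u\<bar> \<le> (1/4) * exp u" "\<bar>g2 \<zeta> u\<bar> \<le> (1/2) * exp u"
            using \<tau>Q(2)[OF _ z eu(2)[OF u]] eu(1)[OF u] \<delta>0(4) by auto
          have "exp u * 1 \<le> exp u * \<bar>Q \<zeta>\<bar>" "exp u * \<bar>Q \<zeta>\<bar> \<le> exp u * exp 1"
            using Pz by (intro mult_left_mono; simp add: PQ)+
          then have q: "exp u \<le> \<bar>exp u * Q \<zeta>\<bar>" "\<bar>exp u * Q \<zeta>\<bar> \<le> exp 1 * exp u"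
            by (simp_all add: abs_mult mult.commute)
          have "(1/2) * exp u \<le> \<bar>exp u * Q \<zeta> + orbit_deriv E Qt \<zeta> u\<bar>" using q ev exp_ge_zero[of u] by linarith
          then have "n * ((1/2) * exp u) \<le> n * \<bar>exp u * Q \<zeta> + orbit_deriv E Qt \<zeta> u\<bar>" using n by (intro mult_left_mono) auto
          then show "(1/2) * n * exp u \<le> \<bar>\<phi>1 u\<bar>" unfolding \<phi>1_def abs_mult using n by (simp add: mult_ac)
          have "\<bar>exp u * Q \<zeta> + g2 \<zeta> u\<bar> \<le> (exp 1 + 1/2) * exp u"
            unfolding distrib_right using q ev by linarith
          also have "\<dots> \<le> D * exp u" using D(2) by (intro mult_right_mono) auto
          finally have "n * \<bar>exp u * Q \<zeta> + g2 \<zeta> u\<bar> \<le> n * (D * exp u)" using n by (intro mult_left_mono) auto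
          then show "\<bar>\<phi>2 u\<bar> \<le> D * n * exp u" unfolding \<phi>2_def abs_mult using n by (simp add: mult_ac)
        qed
        have A_le: "norm (A u) \<le> 1" "norm (A1 u) \<le> D" if u: "u \<in> {\<alpha>..\<beta>}" for u
        proof -
          \<comment> \<open>This is \<open>n * R\<close> at the orbit point. The derivative of
            \<open>Rt\<close>, bounded by a multiple of \<open>exp (k * u)\<close>, is a multiple of
            it because \<open>R\<close> is at least \<open>m\<close> on the shell; then
            \<open>x * exp (- (x / 2)) \<le> 2\<close> makes the bound uniform in
            \<open>n\<close>.\<close>
          define x where "x = n * exp (k * u) * R \<zeta>"
          have mR: "m \<le> R \<zeta>" by (rule r(4)[OF z])
          have x: "x \<ge> 0" using n RR.P_nonneg by (simp add: x_def)
          have nA': "norm (A u) \<le> exp (- (x / 2))" using nA[OF u] by (simp add: x_def)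
          show nA1: "norm (A u) \<le> 1" using order_trans[OF nA', of 1] x by simp
          have "\<bar>h1 u\<bar> \<le> k * exp (k * u)"
          proof -
            have "flow ?E (k * u) *v \<zeta> \<in> U" using eu(2)[OF u] k by (simp add: flow_k)
            from \<tau>R(2)[OF eku[OF u] z this] show ?thesis using k by (simp add: h1_def abs_mult)
          qed
          also have "k * exp (k * u) \<le> k * (exp (k * u) * (R \<zeta> / m))"
          proof -
            have "1 \<le> R \<zeta> / m" using mR r(2) by simp
            then have "k * (exp (k * u) * 1) \<le> k * (exp (k * u) * (R \<zeta> / m))"
              using k by (intro mult_left_mono) auto
            then show ?thesis by simp
          qed
          finally have "n * \<bar>h1 u\<bar> \<le> n * (k * (exp (k * u) * (R \<zeta> / m)))" using n by (intro mult_left_mono) auto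
          then have nh: "n * \<bar>h1 u\<bar> \<le> k * x / m" by (simp add: x_def mult_ac)
          have "\<bar>p1 u\<bar> \<le> n * (k * exp (k * u) * R \<zeta>) + n * \<bar>h1 u\<bar>"
          proof -
            have "\<bar>k * exp (k * u) * R \<zeta> + h1 u\<bar> \<le> k * exp (k * u) * R \<zeta> + \<bar>h1 u\<bar>"
              using k RR.P_nonneg[of \<zeta>] abs_triangle_ineq[of "k * exp (k * u) * R \<zeta>" "h1 u"] by (simp add: abs_mult)
            then have "n * \<bar>k * exp (k * u) * R \<zeta> + h1 u\<bar> \<le> n * (k * exp (k * u) * R \<zeta> + \<bar>h1 u\<bar>)"
              using n by (intro mult_left_mono) auto
            moreover have "\<bar>p1 u\<bar> = n * \<bar>k * exp (k * u) * R \<zeta> + h1 u\<bar>"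
              unfolding p1_def abs_minus_cancel abs_mult using n by simp
            ultimately show ?thesis by (simp only: distrib_left)
          qed
          also have "\<dots> \<le> k * x + k * x / m" using nh by (simp add: x_def mult_ac)
          also have "\<dots> = k * (1 + 1/m) * x" by (simp add: algebra_simps)
          finally have p1: "\<bar>p1 u\<bar> \<le> k * (1 + 1/m) * x" .
          have q1: "\<bar>q1 u\<bar> \<le> \<rho> * (norm E * (C3 * r))"
          proof -
            have "ln (exp u) \<le> ln \<delta>0" using eu(1)[OF u] \<delta>0(1) by (subst ln_le_cancel_iff) auto
            then have "norm (flow E u *v \<zeta>) \<le> C3 * norm \<zeta>" by (intro C3) simp
            also have "\<dots> \<le> C3 * r" using C3 r(3)[OF z] by (intro mult_left_mono) auto
            finally have "norm E * norm (flow E u *v \<zeta>) \<le> norm E * (C3 * r)" by (intro mult_left_mono) auto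
            then have "norm (E *v (flow E u *v \<zeta>)) \<le> norm E * (C3 * r)" using norm_matrix_vector_le order_trans by blast
            then have "norm y * norm (E *v (flow E u *v \<zeta>)) \<le> \<rho> * (norm E * (C3 * r))"
              using y \<rho> by (intro mult_mono) auto
            then show ?thesis unfolding q1_def using Cauchy_Schwarz_ineq2 order_trans by blast
          qed
          have xe: "x * exp (- (x / 2)) \<le> 2"
          proof -
            have "x / 2 \<le> exp (x / 2)" using exp_ge_add_one_self[of "x / 2"] by linarith
            then have "x / 2 * exp (- (x / 2)) \<le> exp (x / 2) * exp (- (x / 2))" by (intro mult_right_mono) auto
            then show ?thesis by (simp add: flip: exp_add)
          qed
          have "norm (A1 u) \<le> (\<bar>p1 u\<bar> + \<bar>q1 u\<bar>) * norm (A u)"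
          proof -
            have "norm (complex_of_real (p1 u) - \<i> * of_real (q1 u)) \<le> \<bar>p1 u\<bar> + \<bar>q1 u\<bar>"
              by (rule order_trans[OF norm_triangle_ineq4]) (simp add: norm_mult)
            then show ?thesis unfolding A1_def norm_mult by (rule mult_right_mono) simp
          qed
          also have "\<dots> = \<bar>p1 u\<bar> * norm (A u) + \<bar>q1 u\<bar> * norm (A u)" by (simp add: distrib_right)
          also have "\<dots> \<le> (k * (1 + 1/m) * x) * exp (- (x / 2)) + (\<rho> * (norm E * (C3 * r))) * 1"
            using p1 q1 nA' nA1 k r x \<rho> C3 by (intro add_mono mult_mono) auto
          also have "\<dots> = k * (1 + 1/m) * (x * exp (- (x / 2))) + \<rho> * (norm E * (C3 * r))" by simp
          also have "\<dots> \<le> k * (1 + 1/m) * 2 + \<rho> * (norm E * (C3 * r))"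
            using xe k r by (intro add_right_mono mult_left_mono) auto
          also have "\<dots> \<le> D" using D(3) by (simp add: mult_ac)
          finally show "norm (A1 u) \<le> D" .
        qed
        show ?thesis
          unfolding eq M_def
          by (rule phase_amplitude_bound[where ?\<phi>1.0 = \<phi>1 and ?\<phi>2.0 = \<phi>2 and ?A1.0 = A1])
             (use n a \<alpha>\<beta> bounds A_le d\<phi> d\<phi>1 dA D in auto)
      qed
      have fc: "continuous_on {\<xi>. a \<le> P \<xi> \<and> P \<xi> \<le> b} (f n y)"
        using b sub by (intro f_cont) auto
      note pb = polar_bound[OF a ab fc M0]
      have "norm (integral {\<xi>. a \<le> P \<xi> \<and> P \<xi> < b} (f n y)) \<le> (M * a powr (\<mu> - 1) / n) * measure lborel shell"
        by (rule pb(2)) (rule in_bound)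
      also have "\<dots> \<le> (M * measure lborel shell + 1) * a powr (\<mu> - 1) / n"
        using n by (simp add: field_simps)
      finally show "f n y absolutely_integrable_on {\<xi>. a \<le> P \<xi> \<and> P \<xi> < b} \<and>
        norm (integral {\<xi>. a \<le> P \<xi> \<and> P \<xi> < b} (f n y)) \<le> (M * measure lborel shell + 1) * a powr (\<mu> - 1) / n"
        using pb(1)[OF in_bound] by blast
    qed
  qed
qed

text \<open>Where \<open>P\<close> is below \<open>T / n\<close>, the factor between
  \<open>f\<close> and \<open>j\<close> tends to 1 uniformly: \<open>n * R\<close> is at most of
  order \<open>n powr (1 - k)\<close>, which vanishes as \<open>k > 1\<close>, and
  \<open>n * Qt\<close> is small because \<open>Qt\<close> is o(P). The volume of the set supplies
  the power of \<open>n\<close>.\<close>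

lemma head:
  assumes T: "T > 0" and \<epsilon>: "\<epsilon> > 0"
  shows "\<forall>\<^sub>F n in at_top. \<forall>y. norm (integral {\<xi>. P \<xi> < T / n} (f n y) - integral {\<xi>. P \<xi> < T / n} (j n y)) \<le> \<epsilon> * n powr (- \<mu>)"
proof -
  \<comment> \<open>The bound 1 turns \<open>exp (norm w)\<close> into \<open>exp 1\<close>; the
    second entry divides \<open>\<epsilon>\<close> by that factor and by the volume
    constant.\<close>
  define e where "e = min 1 (\<epsilon> / (exp 1 * (T powr \<mu> * V)))"
  have TV: "exp 1 * (T powr \<mu> * V) > 0" using T V_pos by simp
  have e: "e > 0" "e \<le> 1" "e * (exp 1 * (T powr \<mu> * V)) \<le> \<epsilon>"
  proof -
    show "e > 0" "e \<le> 1" using \<epsilon> TV by (auto simp: e_def)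
    have "e * (exp 1 * (T powr \<mu> * V)) \<le> \<epsilon> / (exp 1 * (T powr \<mu> * V)) * (exp 1 * (T powr \<mu> * V))"
      using TV by (intro mult_right_mono) (auto simp: e_def)
    also have "\<epsilon> / (exp 1 * (T powr \<mu> * V)) * (exp 1 * (T powr \<mu> * V)) = \<epsilon>"
      by (rule nonzero_eq_divide_eq[THEN iffD1, OF _ refl]) (use TV in linarith)
    finally show "e * (exp 1 * (T powr \<mu> * V)) \<le> \<epsilon>" .
  qed
  obtain CR where CR: "CR > 0" "\<And>\<xi>. R \<xi> \<le> CR * P \<xi> powr k"
    by (rule R_bound) (rule that)
  obtain dR where dR: "dR > 0" "\<And>\<xi>. P \<xi> < dR \<Longrightarrow> \<bar>Rt \<xi>\<bar> \<le> 1 * R \<xi>"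
    by (rule Rt_small[of 1]) (auto intro: that)
  obtain dQ where dQ: "dQ > 0" "\<And>\<xi>. P \<xi> < dQ \<Longrightarrow> \<bar>Qt \<xi>\<bar> \<le> e / (2 * T) * P \<xi>"
    by (rule Qt_small[of "e / (2 * T)"]) (use e T in \<open>auto intro: that\<close>)
  obtain dU where dU: "dU > 0" "{\<xi>. P \<xi> < dU} \<subseteq> U"
    by (rule small_sublevel[OF U]) (rule that)
  define d where "d = min (min dR dQ) dU"
  have d: "d > 0" "d \<le> dR" "d \<le> dQ" "d \<le> dU" using dR dQ dU by (auto simp: d_def)
  have l1: "((\<lambda>n. T / n) \<longlongrightarrow> 0) at_top" by real_asymp
  have "((\<lambda>n. 2 * CR * T powr k * n powr (1 - k)) \<longlongrightarrow> 2 * CR * T powr k * 0) at_top"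
    by (intro tendsto_mult_left tendsto_neg_powr filterlim_ident) (use k in auto)
  then have l2: "((\<lambda>n. 2 * CR * T powr k * n powr (1 - k)) \<longlongrightarrow> 0) at_top" by simp
  have e2: "0 < e / 2" using e by simp
  show ?thesis
    using order_tendstoD(2)[OF l1 d(1)] order_tendstoD(2)[OF l2 e2] eventually_ge_at_top[of 1]
  proof (eventually_elim, intro allI)
    fix n :: real and y :: "real^'n"
    assume n: "T / n < d" "2 * CR * T powr k * n powr (1 - k) < e / 2" "1 \<le> n"
    let ?S = "{\<xi>. P \<xi> < T / n}"
    have Tn: "T / n > 0" using T n by simp
    have fi: "f n y absolutely_integrable_on ?S"
      by (rule sublevel_integrable, rule f_cont) (use n d dU in auto)
    have ji: "j n y absolutely_integrable_on ?S"
      by (rule sublevel_integrable, rule j_cont)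
    have pt: "norm (f n y \<xi> - j n y \<xi>) \<le> e * exp 1" if p: "P \<xi> < T / n" for \<xi>
    proof -
      define w where "w = - (of_real n * (of_real (R \<xi> + Rt \<xi>) + \<i> * of_real (Qt \<xi>)))"
      have fj: "f n y \<xi> = j n y \<xi> * exp w"
        unfolding f_def j_def w_def exp_add[symmetric] by (rule arg_cong[where f = exp]) (simp add: algebra_simps)
      have "norm (of_real (R \<xi> + Rt \<xi>) + \<i> * of_real (Qt \<xi>)) \<le> \<bar>R \<xi> + Rt \<xi>\<bar> + \<bar>Qt \<xi>\<bar>"
        by (rule order_trans[OF norm_triangle_ineq]) (simp add: norm_mult flip: of_real_add)
      also have "\<dots> \<le> 2 * R \<xi> + \<bar>Qt \<xi>\<bar>"
        using dR(2)[of \<xi>] p n d RR.P_nonneg[of \<xi>] by auto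
      finally have "norm w \<le> n * (2 * R \<xi> + \<bar>Qt \<xi>\<bar>)"
        unfolding w_def norm_minus_cancel norm_mult using n by simp
      also have "\<dots> \<le> n * (2 * (CR * (T / n) powr k) + e / (2 * T) * (T / n))"
      proof -
        have "P \<xi> powr k \<le> (T / n) powr k" using p k P_nonneg by (intro powr_mono2) auto
        then have "R \<xi> \<le> CR * (T / n) powr k" using CR(2)[of \<xi>] CR(1) by (meson mult_left_mono less_imp_le order_trans)
        moreover have "\<bar>Qt \<xi>\<bar> \<le> e / (2 * T) * P \<xi>" using dQ(2)[of \<xi>] p n d by auto
        moreover have "e / (2 * T) * P \<xi> \<le> e / (2 * T) * (T / n)" using p e T by (intro mult_left_mono) auto
        ultimately show ?thesis using n by (intro mult_left_mono) auto
      qed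
      also have "\<dots> = 2 * CR * T powr k * n powr (1 - k) + e / 2"
        using n T by (simp add: powr_divide powr_diff field_simps)
      finally have w: "norm w \<le> e" using n(2) by linarith
      have "norm (f n y \<xi> - j n y \<xi>) = norm (exp w - 1)"
      proof -
        have "f n y \<xi> - j n y \<xi> = j n y \<xi> * (exp w - 1)" by (simp add: fj algebra_simps)
        then show ?thesis by (simp add: norm_mult norm_j)
      qed
      also have "\<dots> \<le> norm w * exp (norm w)" by (rule norm_exp_minus_one_le)
      also have "\<dots> \<le> e * exp 1" using w e by (intro mult_mono) auto
      finally show ?thesis .
    qed
    have "norm (integral ?S (f n y) - integral ?S (j n y)) = norm (integral ?S (\<lambda>\<xi>. f n y \<xi> - j n y \<xi>))"
      using fi ji by (simp add: Henstock_Kurzweil_Integration.integral_diff absolutely_integrable_on_def)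
    also have "\<dots> \<le> e * exp 1 * ((T / n) powr \<mu> * V)"
      using fi ji by (intro norm_integral_sublevel[OF _ Tn pt] Henstock_Kurzweil_Integration.integrable_diff)
        (auto simp: absolutely_integrable_on_def)
    also have "\<dots> = e * (exp 1 * (T powr \<mu> * V)) * n powr (- \<mu>)"
      using n T by (simp add: powr_divide powr_minus field_simps)
    also have "\<dots> \<le> \<epsilon> * n powr (- \<mu>)" using e(3) by (intro mult_right_mono) auto
    finally show "norm (integral ?S (f n y) - integral ?S (j n y)) \<le> \<epsilon> * n powr (- \<mu>)" .
  qed
qed

text \<open>The order of choices matters: first \<open>T\<close>, so large that the two tails
  together cost at most half of \<open>\<epsilon>\<close> for every \<open>n\<close>, and only then
  \<open>n\<close>, so large that the heads agree up to the other half.\<close>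

lemma imag_local_bounds:
  obtains \<delta>0 where "\<delta>0 > 0" "{\<xi>. P \<xi> < \<delta>0} \<subseteq> U" "\<And>\<xi>. P \<xi> < \<delta>0 \<Longrightarrow> \<bar>Rt \<xi>\<bar> \<le> R \<xi> / 2"
    "\<And>\<delta> \<rho> \<epsilon>. 0 < \<delta> \<Longrightarrow> \<delta> < \<delta>0 \<Longrightarrow> \<rho> > 0 \<Longrightarrow> \<epsilon> > 0 \<Longrightarrow>
      \<forall>\<^sub>F n in at_top. \<forall>y. norm y \<le> \<rho> \<longrightarrow> norm (integral {\<xi>. P \<xi> < \<delta>} (f n y) - L n y) \<le> \<epsilon> * n powr (- \<mu>)"
proof -
  obtain \<delta>0 where \<delta>0: "\<delta>0 > 0" "{\<xi>. P \<xi> < \<delta>0} \<subseteq> U" "\<And>\<xi>. P \<xi> < \<delta>0 \<Longrightarrow> \<bar>Rt \<xi>\<bar> \<le> R \<xi> / 2"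
    and tf: "\<And>\<rho>. \<rho> > 0 \<Longrightarrow> \<exists>C>0. \<forall>n y a b. n \<ge> 1 \<longrightarrow> norm y \<le> \<rho> \<longrightarrow> 0 < a \<longrightarrow> a \<le> b \<longrightarrow> b < \<delta>0 \<longrightarrow>
      f n y absolutely_integrable_on {\<xi>. a \<le> P \<xi> \<and> P \<xi> < b} \<and>
      norm (integral {\<xi>. a \<le> P \<xi> \<and> P \<xi> < b} (f n y)) \<le> C * a powr (\<mu> - 1) / n"
    by (rule tail_f) (rule that)
  show thesis
  proof (rule that[OF \<delta>0])
    fix \<delta> \<rho> \<epsilon> :: real assume \<delta>: "0 < \<delta>" "\<delta> < \<delta>0" and \<rho>: "\<rho> > 0" and \<epsilon>: "\<epsilon> > 0"
    from tf[OF \<rho>] obtain C1 where C1: "C1 > 0" and tf': "\<forall>n y a b. n \<ge> 1 \<longrightarrow> norm y \<le> \<rho> \<longrightarrow> 0 < a \<longrightarrow> a \<le> b \<longrightarrow> b < \<delta>0 \<longrightarrow>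
      f n y absolutely_integrable_on {\<xi>. a \<le> P \<xi> \<and> P \<xi> < b} \<and>
      norm (integral {\<xi>. a \<le> P \<xi> \<and> P \<xi> < b} (f n y)) \<le> C1 * a powr (\<mu> - 1) / n"
      by (elim exE conjE)
    obtain C2 T0 where C2: "C2 > 0" "T0 > 0" and
      La: "\<And>n y a. n \<ge> 1 \<Longrightarrow> norm y \<le> \<rho> \<Longrightarrow> T0 / n \<le> a \<Longrightarrow>
        norm (L n y - integral {\<xi>. P \<xi> < a} (j n y)) \<le> C2 * a powr (\<mu> - 1) / n"
      by (rule L_approx[OF \<rho>]) (rule that)
    have "((\<lambda>T. (C1 + C2) * T powr (\<mu> - 1)) \<longlongrightarrow> (C1 + C2) * 0) at_top"
      by (intro tendsto_mult_left tendsto_neg_powr filterlim_ident) (use mu1 in auto)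
    then have "\<forall>\<^sub>F T in at_top. (C1 + C2) * T powr (\<mu> - 1) < \<epsilon> / 2"
      using \<epsilon> by (intro order_tendstoD) auto
    then have "\<forall>\<^sub>F T in at_top. (C1 + C2) * T powr (\<mu> - 1) < \<epsilon> / 2 \<and> T0 \<le> T"
      using eventually_ge_at_top[of T0] by (rule eventually_conj)
    then obtain T where T: "(C1 + C2) * T powr (\<mu> - 1) < \<epsilon> / 2" "T0 \<le> T"
      by (auto simp: eventually_at_top_linorder)
    have T0: "T > 0" using T C2 by linarith
    have l1: "((\<lambda>n. T / n) \<longlongrightarrow> 0) at_top" by real_asymp
    have e2: "\<epsilon> / 2 > 0" using \<epsilon> by simp
    show "\<forall>\<^sub>F n in at_top. \<forall>y. norm y \<le> \<rho> \<longrightarrow> norm (integral {\<xi>. P \<xi> < \<delta>} (f n y) - L n y) \<le> \<epsilon> * n powr (- \<mu>)"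
      using head[OF T0 e2] order_tendstoD(2)[OF l1 \<delta>(1)] eventually_ge_at_top[of 1]
    proof (eventually_elim, intro allI impI)
      fix n :: real and y :: "real^'n"
      assume hd: "\<forall>y. norm (integral {\<xi>. P \<xi> < T / n} (f n y) - integral {\<xi>. P \<xi> < T / n} (j n y)) \<le> \<epsilon> / 2 * n powr (- \<mu>)"
        and n: "T / n < \<delta>" "1 \<le> n" and y: "norm y \<le> \<rho>"
      let ?a = "T / n"
      have a: "?a > 0" "T0 / n \<le> ?a" using T0 T n by (auto simp: divide_right_mono)
      have aw: "?a powr (\<mu> - 1) / n = T powr (\<mu> - 1) * n powr (- \<mu>)"
        using n T0 by (simp add: powr_divide powr_diff powr_minus field_simps)
      have t: "f n y absolutely_integrable_on {\<xi>. ?a \<le> P \<xi> \<and> P \<xi> < \<delta>}"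
        "norm (integral {\<xi>. ?a \<le> P \<xi> \<and> P \<xi> < \<delta>} (f n y)) \<le> C1 * ?a powr (\<mu> - 1) / n"
        using tf'[rule_format, OF n(2) y a(1) less_imp_le[OF n(1)] \<delta>(2)] by blast+
      have "f n y absolutely_integrable_on {\<xi>. P \<xi> < ?a}"
        by (rule sublevel_integrable, rule f_cont) (use n \<delta> \<delta>0 in auto)
      then have "integral {\<xi>. P \<xi> < \<delta>} (f n y) = integral {\<xi>. P \<xi> < ?a} (f n y) + integral {\<xi>. ?a \<le> P \<xi> \<and> P \<xi> < \<delta>} (f n y)"
        by (rule integral_diff_sublevel[OF _ t(1) less_imp_le[OF n(1)]])
      then have "norm (integral {\<xi>. P \<xi> < \<delta>} (f n y) - L n y) \<le> norm (integral {\<xi>. ?a \<le> P \<xi> \<and> P \<xi> < \<delta>} (f n y))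
         + norm (integral {\<xi>. P \<xi> < ?a} (f n y) - integral {\<xi>. P \<xi> < ?a} (j n y))
         + norm (L n y - integral {\<xi>. P \<xi> < ?a} (j n y))"
      proof -
        have "norm (X - l) \<le> norm Z + norm (Y - W) + norm (l - W)" if "X = Y + Z" for X Y Z W l :: complex
        proof -
          have "X - l = (Z + (Y - W)) - (l - W)" using that by simp
          also have "norm \<dots> \<le> norm (Z + (Y - W)) + norm (l - W)" by (rule norm_triangle_ineq4)
          also have "\<dots> \<le> norm Z + norm (Y - W) + norm (l - W)"
            by (intro add_right_mono norm_triangle_ineq)
          finally show ?thesis .
        qed
        then show ?thesis using \<open>integral {\<xi>. P \<xi> < \<delta>} (f n y) = _\<close> .
      qed
      also have "\<dots> \<le> C1 * ?a powr (\<mu> - 1) / n + \<epsilon> / 2 * n powr (- \<mu>) + C2 * ?a powr (\<mu> - 1) / n"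
        by (intro add_mono t(2) hd[rule_format] La[OF n(2) y a(2)])
      also have "\<dots> = ((C1 + C2) * T powr (\<mu> - 1) + \<epsilon> / 2) * n powr (- \<mu>)"
      proof -
        have c: "C * ?a powr (\<mu> - 1) / n = C * (T powr (\<mu> - 1) * n powr (- \<mu>))" for C
          unfolding aw[symmetric] by simp
        show ?thesis unfolding c by (simp add: algebra_simps)
      qed
      also have "\<dots> \<le> \<epsilon> * n powr (- \<mu>)" using T(1) by (intro mult_right_mono) auto
      finally show "norm (integral {\<xi>. P \<xi> < \<delta>} (f n y) - L n y) \<le> \<epsilon> * n powr (- \<mu>)" .
    qed
  qed
qed

end

section \<open>Fourier inversion on a shifted torus\<close>

text \<open>\<open>lborel\<close> is by definition the image of a product of one-dimensional
  measures, so the product formula can be applied before transport.\<close>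

lemma integral_lborel_prod:
  fixes f :: "'a::euclidean_space \<Rightarrow> real \<Rightarrow> complex"
  assumes "\<And>b. b \<in> Basis \<Longrightarrow> integrable lborel (f b)"
  shows "(\<integral>x. (\<Prod>b\<in>Basis. f b (x \<bullet> b)) \<partial>lborel) = (\<Prod>b\<in>Basis. (\<integral>x. f b x \<partial>lborel))"
proof -
  interpret product_sigma_finite "\<lambda>_::'a. interval_measure (\<lambda>x::real. x)"
    by (intro product_sigma_finite.intro sigma_finite_interval_measure) auto
  have [measurable]: "f b \<in> borel_measurable borel" if "b \<in> Basis" for b
    using assms[OF that] by auto
  have m [measurable]: "(\<lambda>x::'a. \<Prod>b\<in>Basis. f b (x \<bullet> b)) \<in> borel_measurable borel"
    by (intro borel_measurable_prod) measurable
  have "(\<integral>x. (\<Prod>b\<in>Basis. f b (x \<bullet> b)) \<partial>lborel)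
     = (\<integral>g. (\<Prod>b\<in>Basis. f b ((\<Sum>b\<in>Basis. g b *\<^sub>R b) \<bullet> b)) \<partial>(\<Pi>\<^sub>M b\<in>Basis. interval_measure (\<lambda>x. x)))"
    unfolding lborel_def[where 'a = 'a] by (rule integral_distr) (auto simp: m)
  also have "\<dots> = (\<integral>g. (\<Prod>b\<in>Basis. f b (g b)) \<partial>(\<Pi>\<^sub>M b\<in>Basis. interval_measure (\<lambda>x. x)))"
    by (rule Bochner_Integration.integral_cong[OF refl]) (auto intro!: prod.cong)
  also have "\<dots> = (\<Prod>b\<in>Basis. (\<integral>x. f b x \<partial>interval_measure (\<lambda>x. x)))"
    using assms by (intro product_integral_prod) (auto simp: lborel_eq_real)
  finally show ?thesis by (simp add: lborel_eq_real)
qed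

lemma integral_exp_int:
  fixes m :: int
  shows "integral {c - pi..c + pi} (\<lambda>t. exp (\<i> * of_real (of_int m * t))) = (if m = 0 then complex_of_real (2 * pi) else 0)"
proof (cases "m = 0")
  case False
  define G where "G = (\<lambda>t. exp (\<i> * of_int m * of_real t) / (\<i> * of_int m))"
  have "((\<lambda>t. exp (\<i> * of_real (of_int m * t))) has_integral G (c + pi) - G (c - pi)) {c - pi..c + pi}"
  proof (rule fundamental_theorem_of_calculus)
    fix t :: real
    have "((\<lambda>z. exp (\<i> * of_int m * z) / (\<i> * of_int m)) has_field_derivative exp (\<i> * of_int m * of_real t)) (at (of_real t))"
      using False by (auto intro!: derivative_eq_intros)
    then have "(((\<lambda>z. exp (\<i> * of_int m * z) / (\<i> * of_int m)) \<circ> of_real) has_vector_derivative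
        1 * exp (\<i> * of_int m * of_real t)) (at t within {c - pi..c + pi})"
      by (intro field_vector_diff_chain_within[OF _ has_field_derivative_at_within])
         (auto intro!: derivative_eq_intros simp: has_vector_derivative_of_real)
    then show "(G has_vector_derivative exp (\<i> * of_real (of_int m * t))) (at t within {c - pi..c + pi})"
      by (simp add: G_def o_def mult.assoc)
  qed (use pi_gt_zero in auto)
  moreover have "G (c + pi) = G (c - pi)"
  proof -
    have "\<i> * of_int m * of_real (c + pi) = \<i> * of_int m * of_real (c - pi) + of_int (2 * m) * (of_real pi * \<i>)"
      by (simp add: algebra_simps)
    moreover have "exp (of_int (2 * m) * (complex_of_real pi * \<i>)) = 1"
      by (subst exp_eq_1) auto
    ultimately show ?thesis by (simp add: G_def exp_add)
  qed
  ultimately show ?thesis using False by (simp add: integral_unique)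
qed (simp add: complex_eq_iff)

text \<open>A period cube whose centre has all coordinates equal to \<open>c\<close>. The shift
  serves to move its boundary away from \<open>Omega\<close>, see
  \<open>torus_box_choice\<close>.\<close>

definition torus_box :: "real \<Rightarrow> (real^'n) set" where
  "torus_box c = cbox (\<chi> i. c - pi) (\<chi> i. c + pi)"

lemma integral_torus_exp:
  fixes m :: "int^'n"
  shows "integral (torus_box c) (\<lambda>\<xi>. exp (\<i> * of_real (realv m \<bullet> \<xi>))) = (if m = 0 then (2 * pi) ^ CARD('n) else 0)"
proof -
  define f where "f = (\<lambda>b t. indicator {c - pi..c + pi} t *\<^sub>R exp (\<i> * of_real ((realv m \<bullet> b) * t)))"
  have If: "integrable lborel (f b)" "(\<integral>t. f b t \<partial>lborel) = integral {c - pi..c + pi} (\<lambda>t. exp (\<i> * of_real ((realv m \<bullet> b) * t)))" for b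
  proof -
    have "set_integrable lborel {c - pi..c + pi} (\<lambda>t. exp (\<i> * of_real ((realv m \<bullet> b) * t)))"
      by (intro borel_integrable_atLeastAtMost' continuous_intros)
    then show "integrable lborel (f b)" "(\<integral>t. f b t \<partial>lborel) = integral {c - pi..c + pi} (\<lambda>t. exp (\<i> * of_real ((realv m \<bullet> b) * t)))"
      using set_borel_integral_eq_integral by (force simp: f_def set_integrable_def set_lebesgue_integral_def)+
  qed
  have eq: "indicator (torus_box c) \<xi> *\<^sub>R exp (\<i> * of_real (realv m \<bullet> \<xi>)) = (\<Prod>b\<in>Basis. f b (\<xi> \<bullet> b))" for \<xi> :: "real^'n"
  proof -
    have "(\<Prod>b\<in>Basis. f b (\<xi> \<bullet> b)) = (\<Prod>b\<in>Basis. of_real (indicator {c - pi..c + pi} (\<xi> \<bullet> b))) * (\<Prod>b\<in>Basis. exp (\<i> * of_real ((realv m \<bullet> b) * (\<xi> \<bullet> b))))"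
      by (simp add: f_def scaleR_conv_of_real prod.distrib)
    also have "(\<Prod>b\<in>Basis. exp (\<i> * of_real ((realv m \<bullet> b) * (\<xi> \<bullet> b)))) = exp (\<i> * of_real (realv m \<bullet> \<xi>))"
      by (simp add: exp_sum[symmetric] euclidean_inner[of "realv m" \<xi>] sum_distrib_left)
    also have "(\<Prod>b\<in>Basis. complex_of_real (indicator {c - pi..c + pi} (\<xi> \<bullet> b))) = of_real (indicator (torus_box c) \<xi>)"
    proof (cases "\<xi> \<in> torus_box c")
      case True
      then have "indicator {c - pi..c + pi} (\<xi> \<bullet> b) = (1::real)" if "b \<in> Basis" for b
        using that by (auto simp: torus_box_def mem_box_cart Basis_vec_def inner_axis)
      then show ?thesis using True by simp
    next
      case False
      then obtain i where "\<not> (c - pi \<le> \<xi> $ i \<and> \<xi> $ i \<le> c + pi)"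
        by (auto simp: torus_box_def mem_box_cart)
      then have "\<exists>b\<in>Basis. complex_of_real (indicator {c - pi..c + pi} (\<xi> \<bullet> b)) = 0"
        by (intro bexI[of _ "axis i 1"]) (auto simp: inner_axis axis_in_Basis_iff)
      then show ?thesis using False by (simp add: prod_zero)
    qed
    finally show ?thesis by (simp add: scaleR_conv_of_real)
  qed
  have "continuous_on (torus_box c) (\<lambda>\<xi>::real^'n. exp (\<i> * of_real (realv m \<bullet> \<xi>)))"
    by (intro continuous_intros)
  then have "set_integrable lborel (torus_box c) (\<lambda>\<xi>::real^'n. exp (\<i> * of_real (realv m \<bullet> \<xi>)))"
    unfolding torus_box_def by (intro borel_integrable_compact[unfolded set_integrable_def[symmetric]]) auto
  then have "integral (torus_box c) (\<lambda>\<xi>. exp (\<i> * of_real (realv m \<bullet> \<xi>)))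
      = (\<integral>\<xi>. indicator (torus_box c) \<xi> *\<^sub>R exp (\<i> * of_real (realv m \<bullet> \<xi>)) \<partial>lborel)"
    using set_borel_integral_eq_integral(2) by (force simp: set_lebesgue_integral_def)
  also have "\<dots> = (\<Prod>b\<in>Basis. (\<integral>t. f b t \<partial>lborel))"
    unfolding eq by (rule integral_lborel_prod) (rule If)
  also have "\<dots> = (\<Prod>i\<in>UNIV. if m $ i = 0 then complex_of_real (2 * pi) else 0)"
  proof -
    have B: "Basis = range (\<lambda>i::'n. axis i (1::real))" by (auto simp: Basis_vec_def)
    have inj: "inj (\<lambda>i::'n. axis i (1::real))" by (auto simp: inj_def axis_eq_axis)
    have "(\<Prod>b\<in>Basis. (\<integral>t. f b t \<partial>lborel)) = (\<Prod>i\<in>UNIV. (\<integral>t. f (axis i 1) t \<partial>lborel))"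
      unfolding B prod.reindex[OF inj] o_def ..
    moreover have "(\<integral>t. f (axis i 1) t \<partial>lborel) = (if m $ i = 0 then complex_of_real (2 * pi) else 0)" for i
    proof -
      have "realv m \<bullet> axis i 1 = of_int (m $ i)" by (simp add: inner_axis realv_def)
      then show ?thesis unfolding If by (simp only: integral_exp_int)
    qed
    ultimately show ?thesis by simp
  qed
  also have "\<dots> = (if m = 0 then (2 * pi) ^ CARD('n) else 0)"
    by (auto simp: vec_eq_iff)
  finally show ?thesis .
qed

section \<open>The Fourier series and its inversion\<close>

lemma in_Sd_summable:
  assumes "in_Sd \<phi>"
  shows "(\<lambda>x. norm (\<phi> x)) summable_on UNIV"
  using assms[unfolded in_Sd_def, rule_format, of "\<lambda>_. 0"] by (simp add: monom_def)

lemma fhat_uniform_limit: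
  fixes \<phi> :: "int^'n \<Rightarrow> complex"
  assumes "in_Sd \<phi>"
  shows "uniform_limit UNIV (\<lambda>X \<xi>. \<Sum>x\<in>X. \<phi> x * exp (\<i> * of_real (realv x \<bullet> \<xi>))) (fhat \<phi>) (finite_subsets_at_top UNIV)"
  unfolding fhat_def
  by (rule Weierstrass_m_test_general[where M = "\<lambda>x. norm (\<phi> x)"]) (auto simp: norm_mult in_Sd_summable[OF assms])

lemma continuous_fhat:
  fixes \<phi> :: "int^'n \<Rightarrow> complex"
  assumes "in_Sd \<phi>"
  shows "continuous_on UNIV (fhat \<phi>)"
  by (rule uniform_limit_theorem[OF _ fhat_uniform_limit[OF assms]])
     (auto intro!: always_eventually continuous_intros)

lemma norm_fhat_bounded:
  fixes \<phi> :: "int^'n \<Rightarrow> complex"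
  assumes "in_Sd \<phi>"
  shows "norm (fhat \<phi> \<xi>) \<le> (\<Sum>\<^sub>\<infinity>x. norm (\<phi> x))"
proof -
  have "norm (fhat \<phi> \<xi>) \<le> (\<Sum>\<^sub>\<infinity>x. norm (\<phi> x * exp (\<i> * of_real (realv x \<bullet> \<xi>))))"
    unfolding fhat_def by (rule norm_infsum_bound) (simp add: norm_mult in_Sd_summable[OF assms])
  then show ?thesis by (simp add: norm_mult)
qed

lemma realv_simps: "realv (x - y) = realv x - realv y" "realv 0 = 0" "realv (- x) = - realv x"
  by (simp_all add: realv_def vec_eq_iff)

text \<open>Induction on \<open>n\<close> with \<open>x\<close> arbitrary. Integrating the uniformly
  convergent series of the additional factor \<open>fhat\<close> term by term replaces
  \<open>x\<close> by \<open>x - y\<close> in each term, which is the recursion of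
  \<open>convpow\<close>; the base case is orthogonality of characters.\<close>

lemma convpow_integral:
  fixes \<phi> :: "int^'n \<Rightarrow> complex"
  assumes "in_Sd \<phi>"
  shows "convpow \<phi> n x = (1 / (2 * pi) ^ CARD('n)) * integral (torus_box c) (\<lambda>\<xi>. fhat \<phi> \<xi> ^ n * exp (- \<i> * of_real (realv x \<bullet> \<xi>)))"
proof (induction n arbitrary: x)
  case 0
  have "integral (torus_box c) (\<lambda>\<xi>. fhat \<phi> \<xi> ^ 0 * exp (- \<i> * of_real (realv x \<bullet> \<xi>)))
     = integral (torus_box c) (\<lambda>\<xi>. exp (\<i> * of_real (realv (0 - x) \<bullet> \<xi>)))"
    by (simp add: realv_simps)
  also have "\<dots> = (if x = 0 then (2 * pi) ^ CARD('n) else 0)"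
    by (subst integral_torus_exp) auto
  finally show ?case by simp
next
  case (Suc n)
  let ?K = "complex_of_real (1 / (2 * pi) ^ CARD('n))"
  let ?g = "\<lambda>\<xi>. fhat \<phi> \<xi> ^ n * exp (- \<i> * of_real (realv x \<bullet> \<xi>))"
  have gc: "continuous_on (torus_box c) ?g"
    by (intro continuous_intros continuous_on_subset[OF continuous_fhat[OF assms]]) auto
  have comp: "compact (torus_box c :: (real^'n) set)" by (simp add: torus_box_def)
  have "uniform_limit (torus_box c) (\<lambda>X \<xi>. ?g \<xi> * (\<Sum>y\<in>X. \<phi> y * exp (\<i> * of_real (realv y \<bullet> \<xi>)))) (\<lambda>\<xi>. ?g \<xi> * fhat \<phi> \<xi>)
      (finite_subsets_at_top UNIV)"
  proof (rule uniform_lim_mult)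
    show "uniform_limit (torus_box c) (\<lambda>X. ?g) ?g (finite_subsets_at_top UNIV)"
      by (rule uniform_limit_const)
    show "uniform_limit (torus_box c) (\<lambda>X \<xi>. \<Sum>y\<in>X. \<phi> y * exp (\<i> * of_real (realv y \<bullet> \<xi>))) (fhat \<phi>) (finite_subsets_at_top UNIV)"
      by (rule uniform_limit_on_subset[OF fhat_uniform_limit[OF assms]]) simp
    show "bounded (?g ` torus_box c)" "bounded (fhat \<phi> ` torus_box c)"
      using gc continuous_on_subset[OF continuous_fhat[OF assms] subset_UNIV] comp
      by (auto intro!: compact_imp_bounded compact_continuous_image)
  qed
  then obtain I J where IJ: "\<And>X. ((\<lambda>\<xi>. ?g \<xi> * (\<Sum>y\<in>X. \<phi> y * exp (\<i> * of_real (realv y \<bullet> \<xi>)))) has_integral I X) (torus_box c)"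
    "((\<lambda>\<xi>. ?g \<xi> * fhat \<phi> \<xi>) has_integral J) (torus_box c)" "(I \<longlongrightarrow> J) (finite_subsets_at_top UNIV)"
    unfolding torus_box_def
    by (rule uniform_limit_integral_cbox) (auto intro!: continuous_intros gc[unfolded torus_box_def] continuous_on_subset[OF continuous_fhat[OF assms]])
  have summand: "?K * integral (torus_box c) (\<lambda>\<xi>. ?g \<xi> * (\<phi> y * exp (\<i> * of_real (realv y \<bullet> \<xi>)))) = convpow \<phi> n (x - y) * \<phi> y" for y
  proof -
    have "(\<lambda>\<xi>. ?g \<xi> * (\<phi> y * exp (\<i> * of_real (realv y \<bullet> \<xi>)))) = (\<lambda>\<xi>. (fhat \<phi> \<xi> ^ n * exp (- \<i> * of_real (realv (x - y) \<bullet> \<xi>))) * \<phi> y)"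
      by (simp add: fun_eq_iff realv_simps inner_diff_left exp_diff exp_minus field_simps)
    then show ?thesis unfolding Suc by simp
  qed
  have I: "?K * I X = (\<Sum>y\<in>X. convpow \<phi> n (x - y) * \<phi> y)" if "finite X" for X
  proof -
    have "I X = integral (torus_box c) (\<lambda>\<xi>. \<Sum>y\<in>X. ?g \<xi> * (\<phi> y * exp (\<i> * of_real (realv y \<bullet> \<xi>))))"
      using integral_unique[OF IJ(1)[of X]] by (simp add: sum_distrib_left)
    also have "\<dots> = (\<Sum>y\<in>X. integral (torus_box c) (\<lambda>\<xi>. ?g \<xi> * (\<phi> y * exp (\<i> * of_real (realv y \<bullet> \<xi>)))))"
      using that gc unfolding torus_box_def
      by (intro integral_sum integrable_continuous continuous_intros continuous_on_subset[OF continuous_fhat[OF assms] subset_UNIV])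
    finally show ?thesis
      by (simp only: sum_distrib_left summand)
  qed
  have "((\<lambda>X. ?K * I X) \<longlongrightarrow> ?K * J) (finite_subsets_at_top UNIV)"
    by (intro tendsto_intros IJ)
  moreover have "eventually (\<lambda>X::(int^'n) set. finite X) (finite_subsets_at_top UNIV)"
    by (rule eventually_finite_subsets_at_top_weakI)
  then have "eventually (\<lambda>X. ?K * I X = (\<Sum>y\<in>X. convpow \<phi> n (x - y) * \<phi> y)) (finite_subsets_at_top UNIV)"
    by eventually_elim (rule I)
  ultimately have "((\<lambda>X. \<Sum>y\<in>X. convpow \<phi> n (x - y) * \<phi> y) \<longlongrightarrow> ?K * J) (finite_subsets_at_top UNIV)"
    using tendsto_cong by fast
  then have "convpow \<phi> (Suc n) x = ?K * J"
    by (simp add: has_sum_def infsumI)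
  also have "J = integral (torus_box c) (\<lambda>\<xi>. fhat \<phi> \<xi> ^ Suc n * exp (- \<i> * of_real (realv x \<bullet> \<xi>)))"
    using integral_unique[OF IJ(2)] by (simp add: mult_ac)
  finally show ?case by simp
qed

section \<open>Local contributions\<close>

lemma Ck_on_subset: "Ck_on k U f \<Longrightarrow> V \<subseteq> U \<Longrightarrow> Ck_on k V f"
proof (induction k arbitrary: f)
  case 0
  then show ?case by (auto intro: continuous_on_subset)
next
  case (Suc k)
  then show ?case by (auto intro: continuous_on_subset)
qed

lemma abs_monom_le:
  fixes \<xi> :: "real^'n"
  shows "\<bar>monom \<beta> \<xi>\<bar> \<le> norm \<xi> ^ sum \<beta> UNIV"
proof -
  have "\<bar>monom \<beta> \<xi>\<bar> = (\<Prod>i\<in>UNIV. \<bar>\<xi> $ i\<bar> ^ \<beta> i)"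
    by (simp add: monom_def abs_prod power_abs)
  also have "\<dots> \<le> (\<Prod>i\<in>UNIV. norm \<xi> ^ \<beta> i)"
    by (intro prod_mono conjI power_mono component_le_norm_cart) auto
  also have "\<dots> = norm \<xi> ^ sum \<beta> UNIV"
    by (rule power_sum[symmetric])
  finally show ?thesis .
qed

lemma poly_nolin_continuous:
  assumes "poly_nolin Q" shows "continuous_on S Q"
proof -
  have "continuous_on S (\<lambda>\<xi>. monom \<beta> \<xi>)" for \<beta> :: "'a \<Rightarrow> nat"
    unfolding monom_def by (intro continuous_intros)
  then show ?thesis
    using assms unfolding poly_nolin_def by (auto intro!: continuous_intros)
qed

lemma poly_nolin_quadratic:
  fixes Q :: "real^'n \<Rightarrow> real"
  assumes "poly_nolin Q"
  obtains C where "C > 0" "\<And>\<xi>. norm \<xi> \<le> 1 \<Longrightarrow> \<bar>Q \<xi>\<bar> \<le> C * (norm \<xi>)\<^sup>2"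
proof -
  obtain S c where S: "finite S" "\<And>\<beta>. \<beta> \<in> S \<Longrightarrow> 2 \<le> sum \<beta> UNIV" and Q: "Q = (\<lambda>\<xi>. \<Sum>\<beta>\<in>S. c \<beta> * monom \<beta> \<xi>)"
    using assms unfolding poly_nolin_def by blast
  show thesis
  proof (rule that[of "(\<Sum>\<beta>\<in>S. \<bar>c \<beta>\<bar>) + 1"])
    show "(\<Sum>\<beta>\<in>S. \<bar>c \<beta>\<bar>) + 1 > 0" by (simp add: add_nonneg_pos sum_nonneg)
    fix \<xi> :: "real^'n" assume n: "norm \<xi> \<le> 1"
    have "\<bar>Q \<xi>\<bar> \<le> (\<Sum>\<beta>\<in>S. \<bar>c \<beta>\<bar> * \<bar>monom \<beta> \<xi>\<bar>)"
      unfolding Q abs_mult[symmetric] by (rule sum_abs)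
    also have "\<dots> \<le> (\<Sum>\<beta>\<in>S. \<bar>c \<beta>\<bar> * (norm \<xi>)\<^sup>2)"
    proof (intro sum_mono mult_left_mono)
      fix \<beta> assume "\<beta> \<in> S"
      then have "norm \<xi> ^ sum \<beta> UNIV \<le> (norm \<xi>)\<^sup>2" using S(2) n by (intro power_decreasing) auto
      then show "\<bar>monom \<beta> \<xi>\<bar> \<le> (norm \<xi>)\<^sup>2" using abs_monom_le order_trans by blast
    qed auto
    also have "\<dots> = (\<Sum>\<beta>\<in>S. \<bar>c \<beta>\<bar>) * (norm \<xi>)\<^sup>2" by (simp add: sum_distrib_right)
    also have "\<dots> \<le> ((\<Sum>\<beta>\<in>S. \<bar>c \<beta>\<bar>) + 1) * (norm \<xi>)\<^sup>2" by (intro mult_right_mono) auto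
    finally show "\<bar>Q \<xi>\<bar> \<le> ((\<Sum>\<beta>\<in>S. \<bar>c \<beta>\<bar>) + 1) * (norm \<xi>)\<^sup>2" .
  qed
qed

lemma absolutely_integrable_continuous_bounded:
  fixes g :: "real^'n \<Rightarrow> complex"
  assumes g: "continuous_on UNIV g" and S: "bounded S" "S \<in> sets borel"
  shows "integrable lborel (\<lambda>x. indicator S x *\<^sub>R g x)" "g absolutely_integrable_on S"
proof -
  have m: "(\<lambda>x. indicator S x *\<^sub>R g x) \<in> borel_measurable borel"
    using S(2) continuous_on_subset[OF g subset_UNIV] by (rule borel_measurable_continuous_on_indicator)
  have "compact (closure S)" using S(1) by (simp add: compact_closure)
  then have "bounded (g ` closure S)"
    by (intro compact_imp_bounded compact_continuous_image continuous_on_subset[OF g subset_UNIV])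
  then obtain B where B: "B > 0" "\<And>x. x \<in> closure S \<Longrightarrow> norm (g x) \<le> B"
    by (auto simp: bounded_pos)
  have nb: "norm (indicator S x *\<^sub>R g x) \<le> B" for x
    using B(1) B(2)[of x] closure_subset[of S] by (auto simp: indicator_def)
  show i: "integrable lborel (\<lambda>x. indicator S x *\<^sub>R g x)"
    by (rule integrable_bounded_support[OF m S(1) _ nb]) simp
  then show "g absolutely_integrable_on S"
    unfolding set_integrable_def using m by (simp add: integrable_completion)
qed

lemma integral_translate:
  fixes g :: "real^'n \<Rightarrow> complex"
  assumes g: "continuous_on UNIV g" and N: "open N" "bounded N"
  shows "integral ((+) c ` N) g = integral N (\<lambda>x. g (c + x))"
proof -
  have N': "open ((+) c ` N)" "bounded ((+) c ` N)"
    using N by (auto intro: open_translation bounded_translation)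
  have gc: "continuous_on UNIV (\<lambda>x. g (c + x))"
    by (intro continuous_on_compose2[OF g] continuous_intros) auto
  have set: "integral S h = (\<integral>x. indicator S x *\<^sub>R h x \<partial>lborel)"
    if "continuous_on UNIV h" "open S" "bounded S" for S and h :: "real^'n \<Rightarrow> complex"
  proof -
    have "set_integrable lborel S h"
      unfolding set_integrable_def using that by (intro absolutely_integrable_continuous_bounded) auto
    from set_borel_integral_eq_integral(2)[OF this] show ?thesis
      by (simp add: set_lebesgue_integral_def)
  qed
  have m: "(\<lambda>x. indicator ((+) c ` N) x *\<^sub>R g x) \<in> borel_measurable borel"
    using N' continuous_on_subset[OF g subset_UNIV] by (intro borel_measurable_continuous_on_indicator) auto
  have "integral ((+) c ` N) g = (\<integral>x. indicator ((+) c ` N) x *\<^sub>R g x \<partial>lborel)"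
    by (rule set[OF g N'])
  also have "\<dots> = (\<integral>x. indicator ((+) c ` N) x *\<^sub>R g x \<partial>distr lborel borel ((+) c))"
    by (simp only: lborel_distr_plus)
  also have "\<dots> = (\<integral>x. indicator ((+) c ` N) (c + x) *\<^sub>R g (c + x) \<partial>lborel)"
    by (rule integral_distr) (use m in auto)
  also have "\<dots> = (\<integral>x. indicator N x *\<^sub>R g (c + x) \<partial>lborel)"
    by (rule Bochner_Integration.integral_cong) (auto simp: indicator_def)
  also have "\<dots> = integral N (\<lambda>x. g (c + x))"
    by (rule set[OF gc N, symmetric])
  finally show ?thesis .
qed

definition fourier_integrand :: "(int^'n \<Rightarrow> complex) \<Rightarrow> nat \<Rightarrow> int^'n \<Rightarrow> real^'n \<Rightarrow> complex" where
  "fourier_integrand \<phi> n x \<xi> = fhat \<phi> \<xi> ^ n * exp (- \<i> * of_real (realv x \<bullet> \<xi>))"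

lemma continuous_fourier_integrand:
  "in_Sd \<phi> \<Longrightarrow> continuous_on S (fourier_integrand \<phi> n x)"
  unfolding fourier_integrand_def
  by (intro continuous_intros continuous_on_subset[OF continuous_fhat]) auto

text \<open>The common interface of the two types. The first clause yields arbitrarily small
  neighbourhoods whose contribution is \<open>T\<close> up to o(n^-m), so that they can be made
  disjoint; the second allows \<open>T\<close> to be discarded when \<open>m\<close> exceeds the
  minimal order. \<open>X\<close> limits the range of \<open>x\<close>: all of it at positive
  points, a ball around \<open>n \<alpha>\<close> at imaginary ones.\<close>

definition local_asym :: "(int^'n \<Rightarrow> complex) \<Rightarrow> real^'n \<Rightarrow> real \<Rightarrow> (nat \<Rightarrow> int^'n \<Rightarrow> complex) \<Rightarrow> (nat \<Rightarrow> int^'n \<Rightarrow> bool) \<Rightarrow> bool" where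
  "local_asym \<phi> \<xi>0 m T X \<longleftrightarrow>
     (\<forall>W. open W \<and> 0 \<in> W \<longrightarrow> (\<exists>N. open N \<and> 0 \<in> N \<and> N \<subseteq> W \<and>
        unif_o m (\<lambda>n x. (1 / (2 * pi) ^ CARD('n)) * integral ((+) \<xi>0 ` N) (fourier_integrand \<phi> n x) - T n x) X)) \<and>
     (\<exists>C. \<forall>\<^sub>F n in sequentially. \<forall>x. X n x \<longrightarrow> norm (T n x) \<le> C * real n powr (- m))"

text \<open>Undoes the logarithm. The neighbourhood is cut down to where \<open>fhat\<close> is
  nonzero, since there \<open>exp\<close> inverts \<open>Ln\<close> whatever the branch.\<close>

lemma decomp_neighbourhood:
  fixes \<phi> :: "int^'n \<Rightarrow> complex"
  assumes Sd: "in_Sd \<phi>" and \<xi>0: "\<xi>0 \<in> Omega \<phi>" and dec: "decomp \<phi> \<xi>0 \<alpha> R Q Rt Qt"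
  obtains U where "open U" "0 \<in> U" "\<And>k. Ck_on k U Qt" "\<And>k. Ck_on k U Rt" "Qt 0 = 0" "Rt 0 = 0"
    "\<And>\<xi>. \<xi> \<in> U \<Longrightarrow> fhat \<phi> (\<xi>0 + \<xi>) = fhat \<phi> \<xi>0 * exp (\<i> * of_real (\<alpha> \<bullet> \<xi>) - \<i> * of_real (Q \<xi> + Qt \<xi>) - of_real (R \<xi> + Rt \<xi>))"
proof -
  obtain U where U: "open U" "0 \<in> U" "smooth_on U Qt" "smooth_on U Rt" "Qt 0 = 0" "Rt 0 = 0"
    "\<And>\<xi>. \<xi> \<in> U \<Longrightarrow> Gam \<phi> \<xi>0 \<xi> = \<i> * of_real (\<alpha> \<bullet> \<xi>) - \<i> * of_real (Q \<xi> + Qt \<xi>) - of_real (R \<xi> + Rt \<xi>)"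
    using dec unfolding decomp_def by blast
  have n0: "fhat \<phi> \<xi>0 \<noteq> 0" using \<xi>0 by (auto simp: Omega_def)
  define V where "V = {\<xi>. fhat \<phi> (\<xi> + \<xi>0) \<noteq> 0}"
  have V: "open V" "0 \<in> V"
    unfolding V_def using n0
    by (auto intro!: open_Collect_neq continuous_on_compose2[OF continuous_fhat[OF Sd]] continuous_intros)
  show thesis
  proof (rule that[of "U \<inter> V"])
    show "open (U \<inter> V)" "0 \<in> U \<inter> V" using U V by auto
    show "Ck_on k (U \<inter> V) Qt" "Ck_on k (U \<inter> V) Rt" for k
      using U(3,4) unfolding smooth_on_def by (auto intro: Ck_on_subset)
    show "Qt 0 = 0" "Rt 0 = 0" by fact+
    fix \<xi> assume x: "\<xi> \<in> U \<inter> V"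
    have "exp (Gam \<phi> \<xi>0 \<xi>) = fhat \<phi> (\<xi> + \<xi>0) / fhat \<phi> \<xi>0"
      unfolding Gam_def using x n0 by (intro exp_Ln) (auto simp: V_def)
    then show "fhat \<phi> (\<xi>0 + \<xi>) = fhat \<phi> \<xi>0 * exp (\<i> * of_real (\<alpha> \<bullet> \<xi>) - \<i> * of_real (Q \<xi> + Qt \<xi>) - of_real (R \<xi> + Rt \<xi>))"
      using U(7)[of \<xi>] x n0 by (simp add: add.commute)
  qed
qed

text \<open>The n-th power turns the drift into the phase \<open>n \<alpha> \<bullet> \<xi>\<close>,
  which merges with the character of \<open>x\<close> into that of \<open>x - n \<alpha>\<close>;
  the value at the point itself becomes a prefactor of modulus one.\<close>

lemma shifted_integral:
  fixes \<phi> :: "int^'n \<Rightarrow> complex"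
  assumes Sd: "in_Sd \<phi>" and N: "open N" "bounded N"
    and ex: "\<And>\<xi>. \<xi> \<in> N \<Longrightarrow> fhat \<phi> (\<xi>0 + \<xi>) = fhat \<phi> \<xi>0 * exp (\<i> * of_real (\<alpha> \<bullet> \<xi>) - \<i> * of_real (q \<xi>) - of_real (r \<xi>))"
  shows "integral ((+) \<xi>0 ` N) (fourier_integrand \<phi> n x) = fhat \<phi> \<xi>0 ^ n * exp (- \<i> * of_real (realv x \<bullet> \<xi>0)) *
     integral N (\<lambda>\<xi>. exp (- (of_real (real n) * (of_real (r \<xi>) + \<i> * of_real (q \<xi>)))) * exp (- \<i> * of_real ((realv x - real n *\<^sub>R \<alpha>) \<bullet> \<xi>)))"
proof -
  have "fourier_integrand \<phi> n x (\<xi>0 + \<xi>) = (fhat \<phi> \<xi>0 ^ n * exp (- \<i> * of_real (realv x \<bullet> \<xi>0))) *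
     (exp (- (of_real (real n) * (of_real (r \<xi>) + \<i> * of_real (q \<xi>)))) * exp (- \<i> * of_real ((realv x - real n *\<^sub>R \<alpha>) \<bullet> \<xi>)))"
    if "\<xi> \<in> N" for \<xi>
  proof -
    have "fourier_integrand \<phi> n x (\<xi>0 + \<xi>) = fhat \<phi> \<xi>0 ^ n * (exp (of_nat n * (\<i> * of_real (\<alpha> \<bullet> \<xi>) - \<i> * of_real (q \<xi>) - of_real (r \<xi>)))
        * exp (- \<i> * of_real (realv x \<bullet> (\<xi>0 + \<xi>))))"
      unfolding fourier_integrand_def ex[OF that] power_mult_distrib exp_of_nat_mult[symmetric] by simp
    also have "exp (of_nat n * (\<i> * of_real (\<alpha> \<bullet> \<xi>) - \<i> * of_real (q \<xi>) - of_real (r \<xi>))) * exp (- \<i> * of_real (realv x \<bullet> (\<xi>0 + \<xi>)))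
       = exp (- \<i> * of_real (realv x \<bullet> \<xi>0)) * (exp (- (of_real (real n) * (of_real (r \<xi>) + \<i> * of_real (q \<xi>)))) *
          exp (- \<i> * of_real ((realv x - real n *\<^sub>R \<alpha>) \<bullet> \<xi>)))"
      unfolding exp_add[symmetric]
      by (rule arg_cong[where f = exp]) (simp add: inner_add_right inner_diff_left algebra_simps)
    finally show ?thesis by (simp only: mult.assoc)
  qed
  then have "integral N (\<lambda>\<xi>. fourier_integrand \<phi> n x (\<xi>0 + \<xi>)) = integral N (\<lambda>\<xi>. (fhat \<phi> \<xi>0 ^ n * exp (- \<i> * of_real (realv x \<bullet> \<xi>0))) *
     (exp (- (of_real (real n) * (of_real (r \<xi>) + \<i> * of_real (q \<xi>)))) * exp (- \<i> * of_real ((realv x - real n *\<^sub>R \<alpha>) \<bullet> \<xi>))))"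
    by (intro Henstock_Kurzweil_Integration.integral_cong)
  then show ?thesis
    unfolding integral_translate[OF continuous_fourier_integrand[OF Sd] N]
    by (simp only: integral_mult_right)
qed

lemma norm_prefactor:
  "\<xi>0 \<in> Omega \<phi> \<Longrightarrow> norm (fhat \<phi> \<xi>0 ^ n * exp (- \<i> * of_real (realv x \<bullet> \<xi>0))) = 1"
  by (simp add: norm_mult norm_power Omega_def)

text \<open>Passes from estimates for real \<open>n\<close> and displacements \<open>y\<close> in
  \<open>Y\<close>, as proved in the locales, to the sequence indexed by lattice points.\<close>

lemma local_asymI:
  fixes \<phi> :: "int^'n \<Rightarrow> complex" and H :: "real \<Rightarrow> real^'n \<Rightarrow> complex"
  assumes Sd: "in_Sd \<phi>" and \<xi>0: "\<xi>0 \<in> Omega \<phi>"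
    and ex: "\<And>\<xi>. \<xi> \<in> U \<Longrightarrow> fhat \<phi> (\<xi>0 + \<xi>) = fhat \<phi> \<xi>0 * exp (\<i> * of_real (\<alpha> \<bullet> \<xi>) - \<i> * of_real (q \<xi>) - of_real (r \<xi>))"
    and T: "\<And>n x. T n x = fhat \<phi> \<xi>0 ^ n * exp (- \<i> * of_real (realv x \<bullet> \<xi>0)) * ((1 / (2 * pi) ^ CARD('n)) * H (real n) (realv x - real n *\<^sub>R \<alpha>))"
    and X: "\<And>n x. X n x \<Longrightarrow> realv x - real n *\<^sub>R \<alpha> \<in> Y"
    and bound: "\<And>n y. n \<ge> 1 \<Longrightarrow> y \<in> Y \<Longrightarrow> norm (H n y) \<le> C * n powr (- m)"
    and nb: "\<And>W. open W \<Longrightarrow> 0 \<in> W \<Longrightarrow> \<exists>N. open N \<and> 0 \<in> N \<and> N \<subseteq> W \<and> N \<subseteq> U \<and> bounded N \<and>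
       (\<forall>\<epsilon>>0. \<forall>\<^sub>F n in at_top. \<forall>y\<in>Y. norm (integral N (\<lambda>\<xi>. exp (- (of_real n * (of_real (r \<xi>) + \<i> * of_real (q \<xi>)))) * exp (- \<i> * of_real (y \<bullet> \<xi>))) - H n y) \<le> \<epsilon> * n powr (- m))"
  shows "local_asym \<phi> \<xi>0 m T X"
  unfolding local_asym_def
proof (intro conjI allI impI)
  define \<kappa> :: real where "\<kappa> = 1 / (2 * pi) ^ CARD('n)"
  have \<kappa>: "\<kappa> > 0" by (simp add: \<kappa>_def)
  have T': "T n x = fhat \<phi> \<xi>0 ^ n * exp (- \<i> * of_real (realv x \<bullet> \<xi>0)) * (of_real \<kappa> * H (real n) (realv x - real n *\<^sub>R \<alpha>))" for n x
    unfolding T \<kappa>_def by simp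
  show "\<exists>C. \<forall>\<^sub>F n in sequentially. \<forall>x. X n x \<longrightarrow> norm (T n x) \<le> C * real n powr (- m)"
  proof (rule exI[of _ "\<kappa> * C"], rule eventually_sequentiallyI[of 1], intro allI impI)
    fix n x assume n: "1 \<le> n" and x: "X n x"
    have "norm (T n x) = \<kappa> * norm (H (real n) (realv x - real n *\<^sub>R \<alpha>))"
    proof -
      have "norm (T n x) = norm (fhat \<phi> \<xi>0 ^ n * exp (- \<i> * of_real (realv x \<bullet> \<xi>0)))
          * norm (of_real \<kappa> * H (real n) (realv x - real n *\<^sub>R \<alpha>))"
        unfolding T' by (rule norm_mult)
      then show ?thesis unfolding norm_prefactor[OF \<xi>0] using \<kappa> by (simp add: norm_mult)
    qed
    also have "\<dots> \<le> \<kappa> * (C * real n powr (- m))"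
      using \<kappa> bound[OF _ X[OF x]] n by (intro mult_left_mono) auto
    finally show "norm (T n x) \<le> \<kappa> * C * real n powr (- m)" by simp
  qed
  fix W :: "(real^'n) set" assume "open W \<and> 0 \<in> W"
  then obtain N where N: "open N" "0 \<in> N" "N \<subseteq> W" "N \<subseteq> U" "bounded N"
    and ap: "\<And>\<epsilon>. \<epsilon> > 0 \<Longrightarrow> \<forall>\<^sub>F n in at_top. \<forall>y\<in>Y. norm (integral N (\<lambda>\<xi>. exp (- (of_real n * (of_real (r \<xi>) + \<i> * of_real (q \<xi>)))) * exp (- \<i> * of_real (y \<bullet> \<xi>))) - H n y) \<le> \<epsilon> * n powr (- m)"
    using nb[of W] by blast
  show "\<exists>N. open N \<and> 0 \<in> N \<and> N \<subseteq> W \<and>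
        unif_o m (\<lambda>n x. (1 / (2 * pi) ^ CARD('n)) * integral ((+) \<xi>0 ` N) (fourier_integrand \<phi> n x) - T n x) X"
    unfolding unif_o_def
  proof (intro exI[of _ N] conjI allI impI N(1-3))
    fix \<epsilon> :: real assume "\<epsilon> > 0"
    then have "\<epsilon> / \<kappa> > 0" using \<kappa> by simp
    from eventually_compose_filterlim[OF ap[OF this] filterlim_real_sequentially]
    show "\<forall>\<^sub>F n in sequentially. \<forall>x. X n x \<longrightarrow>
      norm ((1 / (2 * pi) ^ CARD('n)) * integral ((+) \<xi>0 ` N) (fourier_integrand \<phi> n x) - T n x) \<le> \<epsilon> * real n powr (- m)"
    proof (eventually_elim, intro allI impI)
      fix n x assume h: "\<forall>y\<in>Y. norm (integral N (\<lambda>\<xi>. exp (- (of_real (real n) * (of_real (r \<xi>) + \<i> * of_real (q \<xi>)))) * exp (- \<i> * of_real (y \<bullet> \<xi>))) - H (real n) y) \<le> \<epsilon> / \<kappa> * real n powr (- m)"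
        and x: "X n x"
      define y where "y = realv x - real n *\<^sub>R \<alpha>"
      define pre where "pre = fhat \<phi> \<xi>0 ^ n * exp (- \<i> * of_real (realv x \<bullet> \<xi>0))"
      define I where "I = integral N (\<lambda>\<xi>. exp (- (of_real (real n) * (of_real (r \<xi>) + \<i> * of_real (q \<xi>)))) * exp (- \<i> * of_real (y \<bullet> \<xi>)))"
      have "integral ((+) \<xi>0 ` N) (fourier_integrand \<phi> n x) = pre * I"
        unfolding pre_def I_def y_def by (rule shifted_integral[OF Sd N(1,5)]) (use ex N in blast)
      then have "(1 / (2 * pi) ^ CARD('n)) * integral ((+) \<xi>0 ` N) (fourier_integrand \<phi> n x) - T n x
        = of_real \<kappa> * (pre * (I - H (real n) y))"
        unfolding T' by (simp add: \<kappa>_def pre_def y_def algebra_simps)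
      also have "norm \<dots> = \<kappa> * norm (I - H (real n) y)"
        unfolding norm_mult[of pre] using norm_prefactor[OF \<xi>0, of n x] \<kappa> by (simp add: norm_mult pre_def)
      also have "\<dots> \<le> \<kappa> * (\<epsilon> / \<kappa> * real n powr (- m))"
        using h X[OF x] \<kappa> unfolding I_def y_def by (intro mult_left_mono) auto
      also have "\<dots> = \<epsilon> * real n powr (- m)" using \<kappa> by simp
      finally show "norm ((1 / (2 * pi) ^ CARD('n)) * integral ((+) \<xi>0 ` N) (fourier_integrand \<phi> n x) - T n x) \<le> \<epsilon> * real n powr (- m)" .
    qed
  qed
qed

lemma norm_fhat_less_1:
  assumes \<xi>0: "\<xi>0 \<in> Omega \<phi>"
    and ex: "fhat \<phi> (\<xi>0 + \<xi>) = fhat \<phi> \<xi>0 * exp (\<i> * of_real (\<alpha> \<bullet> \<xi>) - \<i> * of_real q - of_real r)" and r: "r > 0"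
  shows "norm (fhat \<phi> (\<xi>0 + \<xi>)) < 1"
  using \<xi>0 r unfolding ex norm_mult by (simp add: Omega_def)

text \<open>The second claim isolates the point within the set of modulus one:
  \<open>\<bar>Rt\<bar> \<le> R / 2\<close> keeps the real part of the exponent negative away from
  0.\<close>

lemma pos_type_local:
  fixes \<phi> :: "int^'n \<Rightarrow> complex"
  assumes Sd: "in_Sd \<phi>" and \<xi>0: "\<xi>0 \<in> Omega \<phi>" and pt: "pos_type \<phi> \<xi>0 \<alpha> R Q"
  shows "local_asym \<phi> \<xi>0 (hom_order R) (pos_term \<phi> \<xi>0 (\<lambda>\<eta>. of_real (R \<eta>) + \<i> * of_real (Q \<eta>)) \<alpha>) (\<lambda>n x. True)"
    "\<exists>W. open W \<and> 0 \<in> W \<and> (\<forall>\<xi>\<in>W - {0}. norm (fhat \<phi> (\<xi>0 + \<xi>)) < 1)"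
proof -
  obtain Rt Qt E where dec: "decomp \<phi> \<xi>0 \<alpha> R Q Rt Qt" and ph: "pos_homog R" and E: "E \<in> Exps R" "homog E Q"
    and s: "subhomog E Qt" "subhomog E Rt"
    using pt unfolding pos_type_def by blast
  interpret pos_homog_scaling R E
    using ph E s by unfold_locales (auto simp: Exps_def subhomog_def)
  obtain U where U: "open U" "0 \<in> U" "\<And>k. Ck_on k U Qt" "\<And>k. Ck_on k U Rt" "Qt 0 = 0" "Rt 0 = 0"
    and ex: "\<And>\<xi>. \<xi> \<in> U \<Longrightarrow> fhat \<phi> (\<xi>0 + \<xi>) = fhat \<phi> \<xi>0 * exp (\<i> * of_real (\<alpha> \<bullet> \<xi>) - \<i> * of_real (Q \<xi> + Qt \<xi>) - of_real (R \<xi> + Rt \<xi>))"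
    by (rule decomp_neighbourhood[OF Sd \<xi>0 dec]) (rule that)
  have Qc: "continuous_on UNIV Q" using dec by (auto simp: decomp_def intro: poly_nolin_continuous)
  have c: "continuous_on U Qt" "continuous_on U Rt" using U(3)[of 0] U(4)[of 0] by auto
  obtain C \<delta>0 where C: "C > 0" and \<delta>0: "\<delta>0 > 0" "{\<xi>. R \<xi> < \<delta>0} \<subseteq> U" "\<And>\<xi>. R \<xi> < \<delta>0 \<Longrightarrow> \<bar>Rt \<xi>\<bar> \<le> R \<xi> / 2"
    and bd: "\<And>n y. n \<ge> 1 \<Longrightarrow> norm (integral UNIV (\<lambda>\<xi>. exp (- (of_real n * (of_real (R \<xi>) + \<i> * of_real (Q \<xi>)))) * exp (- \<i> * of_real (y \<bullet> \<xi>)))) \<le> C * n powr (- \<mu>)"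
    and ap: "\<And>\<delta> \<epsilon>. 0 < \<delta> \<Longrightarrow> \<delta> \<le> \<delta>0 \<Longrightarrow> \<epsilon> > 0 \<Longrightarrow> \<forall>\<^sub>F n in at_top. \<forall>y.
       norm (integral {\<xi>. R \<xi> < \<delta>} (\<lambda>\<xi>. exp (- (of_real n * (of_real (R \<xi>) + \<i> * of_real (Q \<xi>)))) * exp (- \<i> * of_real (y \<bullet> \<xi>)) * exp (- (of_real n * (of_real (Rt \<xi>) + \<i> * of_real (Qt \<xi>)))))
         - integral UNIV (\<lambda>\<xi>. exp (- (of_real n * (of_real (R \<xi>) + \<i> * of_real (Q \<xi>)))) * exp (- \<i> * of_real (y \<bullet> \<xi>)))) \<le> \<epsilon> * n powr (- \<mu>)"
    by (rule pos_local_bounds[OF Qc U(1,2) c U(5,6) s]) (rule that)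
  have merge: "exp (- (of_real n * (of_real (R \<xi>) + \<i> * of_real (Q \<xi>)))) * exp (- \<i> * of_real (y \<bullet> \<xi>)) * exp (- (of_real n * (of_real (Rt \<xi>) + \<i> * of_real (Qt \<xi>))))
    = exp (- (of_real n * (of_real (R \<xi> + Rt \<xi>) + \<i> * of_real (Q \<xi> + Qt \<xi>)))) * exp (- \<i> * of_real (y \<bullet> \<xi>))" for n :: real and y \<xi>
    unfolding exp_add[symmetric] by (rule arg_cong[where f = exp]) (simp add: algebra_simps)
  show "local_asym \<phi> \<xi>0 (hom_order R) (pos_term \<phi> \<xi>0 (\<lambda>\<eta>. of_real (R \<eta>) + \<i> * of_real (Q \<eta>)) \<alpha>) (\<lambda>n x. True)"
    unfolding hom_order_eq
  proof (rule local_asymI[OF Sd \<xi>0 ex, where Y = UNIV and C = C and H = "\<lambda>n y. integral UNIV (\<lambda>\<xi>. exp (- (of_real n * (of_real (R \<xi>) + \<i> * of_real (Q \<xi>)))) * exp (- \<i> * of_real (y \<bullet> \<xi>)))"])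
    show "pos_term \<phi> \<xi>0 (\<lambda>\<eta>. of_real (R \<eta>) + \<i> * of_real (Q \<eta>)) \<alpha> n x = fhat \<phi> \<xi>0 ^ n * exp (- \<i> * of_real (realv x \<bullet> \<xi>0)) *
       ((1 / (2 * pi) ^ CARD('n)) * integral UNIV (\<lambda>\<xi>. exp (- (of_real (real n) * (of_real (R \<xi>) + \<i> * of_real (Q \<xi>)))) * exp (- \<i> * of_real ((realv x - real n *\<^sub>R \<alpha>) \<bullet> \<xi>))))" for n x
      unfolding pos_term_def attr_pos_def by (simp only: mult.assoc)
    fix W :: "(real^'n) set" assume W: "open W" "0 \<in> W"
    obtain dW where dW: "dW > 0" "{\<xi>. R \<xi> < dW} \<subseteq> W"
      by (rule small_sublevel[OF W]) (rule that)
    define \<delta> where "\<delta> = min \<delta>0 dW"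
    have \<delta>: "0 < \<delta>" "\<delta> \<le> \<delta>0" "\<delta> \<le> dW" using \<delta>0 dW by (auto simp: \<delta>_def)
    show "\<exists>N. open N \<and> 0 \<in> N \<and> N \<subseteq> W \<and> N \<subseteq> U \<and> bounded N \<and>
       (\<forall>\<epsilon>>0. \<forall>\<^sub>F n in at_top. \<forall>y\<in>UNIV. norm (integral N (\<lambda>\<xi>. exp (- (of_real n * (of_real (R \<xi> + Rt \<xi>) + \<i> * of_real (Q \<xi> + Qt \<xi>)))) * exp (- \<i> * of_real (y \<bullet> \<xi>)))
         - integral UNIV (\<lambda>\<xi>. exp (- (of_real n * (of_real (R \<xi>) + \<i> * of_real (Q \<xi>)))) * exp (- \<i> * of_real (y \<bullet> \<xi>)))) \<le> \<epsilon> * n powr (- \<mu>))"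
    proof (intro exI[of _ "{\<xi>. R \<xi> < \<delta>}"] conjI open_sublevel allI impI)
      show "0 \<in> {\<xi>. R \<xi> < \<delta>}" using \<delta> P_0_iff[of 0] by simp
      show "{\<xi>. R \<xi> < \<delta>} \<subseteq> W" "{\<xi>. R \<xi> < \<delta>} \<subseteq> U" using \<delta> dW \<delta>0 by auto
      show "bounded {\<xi>. R \<xi> < \<delta>}" by (rule bounded_subset[OF bounded_sublevel[of \<delta>]]) auto
    qed (use ap[OF \<delta>(1,2)] in \<open>simp only: merge ball_UNIV\<close>)
  qed (use bd in auto)
  show "\<exists>W. open W \<and> 0 \<in> W \<and> (\<forall>\<xi>\<in>W - {0}. norm (fhat \<phi> (\<xi>0 + \<xi>)) < 1)"
  proof (intro exI[of _ "{\<xi>. R \<xi> < \<delta>0}"] conjI open_sublevel ballI)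
    show "0 \<in> {\<xi>. R \<xi> < \<delta>0}" using \<delta>0 P_0_iff[of 0] by simp
    fix \<xi> assume x: "\<xi> \<in> {\<xi>. R \<xi> < \<delta>0} - {0}"
    then have "R \<xi> > 0" "\<bar>Rt \<xi>\<bar> \<le> R \<xi> / 2" "\<xi> \<in> U" using \<delta>0 by (auto simp: P_pos_iff)
    then show "norm (fhat \<phi> (\<xi>0 + \<xi>)) < 1"
      by (intro norm_fhat_less_1[OF \<xi>0 ex]) auto
  qed
qed

text \<open>The analogue at an imaginary point, on balls of displacements only. The hypothesis
  \<open>mu\<close> speaks of the chosen order; \<open>hom_order_eq\<close> turns it into a
  statement on the trace of the exponent at hand.\<close>

lemma imag_type_local:
  fixes \<phi> :: "int^'n \<Rightarrow> complex"
  assumes Sd: "in_Sd \<phi>" and \<xi>0: "\<xi>0 \<in> Omega \<phi>" and it: "imag_type \<phi> \<xi>0 \<alpha> R Q"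
    and mu: "hom_order (\<lambda>\<eta>. \<bar>Q \<eta>\<bar>) < 1"
  shows "\<rho> > 0 \<Longrightarrow> local_asym \<phi> \<xi>0 (hom_order (\<lambda>\<eta>. \<bar>Q \<eta>\<bar>)) (imag_term \<phi> \<xi>0 Q \<alpha>) (\<lambda>n x. norm (realv x - real n *\<^sub>R \<alpha>) \<le> \<rho>)"
    "\<exists>W. open W \<and> 0 \<in> W \<and> (\<forall>\<xi>\<in>W - {0}. norm (fhat \<phi> (\<xi>0 + \<xi>)) < 1)"
proof -
  obtain Rt Qt E k where dec: "decomp \<phi> \<xi>0 \<alpha> R Q Rt Qt" and ph: "pos_homog (\<lambda>\<xi>. \<bar>Q \<xi>\<bar>)" "pos_homog R"
    and E: "E \<in> Exps (\<lambda>\<xi>. \<bar>Q \<xi>\<bar>)" and k: "k > 1" and hR: "homog ((1/k) *\<^sub>R E) R"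
    and s: "strongly_subhomog 2 E Qt" "strongly_subhomog 1 ((1/k) *\<^sub>R E) Rt"
    using it unfolding imag_type_def by blast
  obtain U where U: "open U" "0 \<in> U" "\<And>k. Ck_on k U Qt" "\<And>k. Ck_on k U Rt" "Qt 0 = 0" "Rt 0 = 0"
    and ex: "\<And>\<xi>. \<xi> \<in> U \<Longrightarrow> fhat \<phi> (\<xi>0 + \<xi>) = fhat \<phi> \<xi>0 * exp (\<i> * of_real (\<alpha> \<bullet> \<xi>) - \<i> * of_real (Q \<xi> + Qt \<xi>) - of_real (R \<xi> + Rt \<xi>))"
    by (rule decomp_neighbourhood[OF Sd \<xi>0 dec]) (rule that)
  have pQ: "poly_nolin Q" using dec by (auto simp: decomp_def)
  obtain C0 where C0: "C0 > 0" "\<And>\<xi>. norm \<xi> \<le> 1 \<Longrightarrow> \<bar>Q \<xi>\<bar> \<le> C0 * (norm \<xi>)\<^sup>2"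
    by (rule poly_nolin_quadratic[OF pQ]) (rule that)
  interpret A: pos_homog_scaling "\<lambda>\<xi>. \<bar>Q \<xi>\<bar>" E
    using ph E s by unfold_locales (auto simp: Exps_def strongly_subhomog_def)
  interpret imag_local "\<lambda>\<xi>. \<bar>Q \<xi>\<bar>" E Q Qt Rt R k U C0
    using mu k hR U s C0 ph by unfold_locales (auto simp: A.hom_order_eq poly_nolin_continuous[OF pQ])
  obtain \<delta>0 where \<delta>0: "\<delta>0 > 0" "{\<xi>. \<bar>Q \<xi>\<bar> < \<delta>0} \<subseteq> U" "\<And>\<xi>. \<bar>Q \<xi>\<bar> < \<delta>0 \<Longrightarrow> \<bar>Rt \<xi>\<bar> \<le> R \<xi> / 2"
    and ap: "\<And>\<delta> \<rho> \<epsilon>. 0 < \<delta> \<Longrightarrow> \<delta> < \<delta>0 \<Longrightarrow> \<rho> > 0 \<Longrightarrow> \<epsilon> > 0 \<Longrightarrow>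
      \<forall>\<^sub>F n in at_top. \<forall>y. norm y \<le> \<rho> \<longrightarrow> norm (integral {\<xi>. \<bar>Q \<xi>\<bar> < \<delta>} (f n y) - L n y) \<le> \<epsilon> * n powr (- A.\<mu>)"
    by (rule imag_local_bounds) (rule that)
  show "local_asym \<phi> \<xi>0 (hom_order (\<lambda>\<eta>. \<bar>Q \<eta>\<bar>)) (imag_term \<phi> \<xi>0 Q \<alpha>) (\<lambda>n x. norm (realv x - real n *\<^sub>R \<alpha>) \<le> \<rho>)"
    if \<rho>: "\<rho> > 0"
  proof -
    obtain C where C: "C > 0" "\<And>n y. n \<ge> 1 \<Longrightarrow> norm y \<le> \<rho> \<Longrightarrow> norm (L n y) \<le> C * n powr (- A.\<mu>)"
      by (rule L_bound[OF \<rho>]) (rule that)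
    show ?thesis
      unfolding A.hom_order_eq
    proof (rule local_asymI[OF Sd \<xi>0 ex, where Y = "{y. norm y \<le> \<rho>}" and C = C and H = L])
      show "imag_term \<phi> \<xi>0 Q \<alpha> n x = fhat \<phi> \<xi>0 ^ n * exp (- \<i> * of_real (realv x \<bullet> \<xi>0)) *
         ((1 / (2 * pi) ^ CARD('n)) * L (real n) (realv x - real n *\<^sub>R \<alpha>))" for n x
        unfolding imag_term_def attr_imag_def L_def j_def by (simp only: mult.assoc)
      fix W :: "(real^'n) set" assume W: "open W" "0 \<in> W"
      obtain dW where dW: "dW > 0" "{\<xi>. \<bar>Q \<xi>\<bar> < dW} \<subseteq> W"
        by (rule A.small_sublevel[OF W]) (rule that)
      \<comment> \<open>Half of \<open>\<delta>0\<close>, because the local bound requires a strict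
        inequality.\<close>
      define \<delta> where "\<delta> = min (\<delta>0 / 2) dW"
      have \<delta>: "0 < \<delta>" "\<delta> < \<delta>0" "\<delta> \<le> dW" using \<delta>0 dW by (auto simp: \<delta>_def)
      show "\<exists>N. open N \<and> 0 \<in> N \<and> N \<subseteq> W \<and> N \<subseteq> U \<and> bounded N \<and>
         (\<forall>\<epsilon>>0. \<forall>\<^sub>F n in at_top. \<forall>y\<in>{y. norm y \<le> \<rho>}. norm (integral N (\<lambda>\<xi>. exp (- (of_real n * (of_real (R \<xi> + Rt \<xi>) + \<i> * of_real (Q \<xi> + Qt \<xi>)))) * exp (- \<i> * of_real (y \<bullet> \<xi>))) - L n y) \<le> \<epsilon> * n powr (- A.\<mu>))"
      proof (intro exI[of _ "{\<xi>. \<bar>Q \<xi>\<bar> < \<delta>}"] conjI A.open_sublevel allI impI)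
        show "0 \<in> {\<xi>. \<bar>Q \<xi>\<bar> < \<delta>}" using \<delta> A.P_0_iff[of 0] by simp
        show "{\<xi>. \<bar>Q \<xi>\<bar> < \<delta>} \<subseteq> W" "{\<xi>. \<bar>Q \<xi>\<bar> < \<delta>} \<subseteq> U" using \<delta> dW \<delta>0 by auto
        show "bounded {\<xi>. \<bar>Q \<xi>\<bar> < \<delta>}" by (rule bounded_subset[OF A.bounded_sublevel[of \<delta>]]) auto
      qed (use ap[OF \<delta>(1,2) \<rho>] in \<open>simp only: f_def[abs_def] mem_Collect_eq Ball_def\<close>)
    qed (use C in auto)
  qed
  show "\<exists>W. open W \<and> 0 \<in> W \<and> (\<forall>\<xi>\<in>W - {0}. norm (fhat \<phi> (\<xi>0 + \<xi>)) < 1)"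
  proof (intro exI[of _ "{\<xi>. \<bar>Q \<xi>\<bar> < \<delta>0}"] conjI A.open_sublevel ballI)
    show "0 \<in> {\<xi>. \<bar>Q \<xi>\<bar> < \<delta>0}" using \<delta>0 A.P_0_iff[of 0] by simp
    fix \<xi> assume x: "\<xi> \<in> {\<xi>. \<bar>Q \<xi>\<bar> < \<delta>0} - {0}"
    then have "R \<xi> > 0" "\<bar>Rt \<xi>\<bar> \<le> R \<xi> / 2" "\<xi> \<in> U" using \<delta>0 by (auto simp: RR.P_pos_iff)
    then show "norm (fhat \<phi> (\<xi>0 + \<xi>)) < 1"
      by (intro norm_fhat_less_1[OF \<xi>0 ex]) auto
  qed
qed

section \<open>Assembling the local contributions\<close>

text \<open>Two functions homogeneous for the same dilations are compared on the compact unit level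
  set.\<close>

lemma (in pos_homog_scaling) homog_bounded_by:
  fixes Q :: "real^'n \<Rightarrow> real"
  assumes Qc: "continuous_on UNIV Q" and hQ: "homog E Q"
  obtains M where "M > 0" "\<And>\<xi>. \<bar>Q \<xi>\<bar> \<le> M * P \<xi>"
proof -
  have "compact (Q ` {\<xi>. P \<xi> = 1})"
    by (intro compact_continuous_image compact_sphere continuous_on_subset[OF Qc]) auto
  then have "bounded (Q ` {\<xi>. P \<xi> = 1})" by (rule compact_imp_bounded)
  then obtain M where M: "M > 0" "\<And>\<xi>. P \<xi> = 1 \<Longrightarrow> \<bar>Q \<xi>\<bar> \<le> M"
    by (auto simp: bounded_pos)
  have Q0: "Q 0 = 0"
    using homog_flow[OF hQ, of "ln 2" 0] by simp
  show thesis
  proof (rule that[OF M(1)])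
    fix \<xi> show "\<bar>Q \<xi>\<bar> \<le> M * P \<xi>"
    proof (cases "\<xi> = 0")
      case False
      then obtain \<omega> where \<omega>: "P \<omega> = 1" "flow E (ln (P \<xi>)) *v \<omega> = \<xi>"
        by (rule polar_decomp)
      have "Q \<xi> = exp (ln (P \<xi>)) * Q \<omega>"
        using homog_flow[OF hQ, of "ln (P \<xi>)" \<omega>] \<omega>(2) by simp
      then have "\<bar>Q \<xi>\<bar> = P \<xi> * \<bar>Q \<omega>\<bar>"
        using False P_pos_iff[of \<xi>] by (simp add: abs_mult)
      also have "\<dots> \<le> P \<xi> * M" using M(2)[OF \<omega>(1)] P_nonneg by (intro mult_left_mono)
      finally show ?thesis by (simp add: mult.commute)
    qed (use Q0 P_0_iff[of 0] in simp)
  qed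
qed

text \<open>Near a point of positive type the oscillation is dominated by the decay; at a point of imaginary
  type it is the other way round, since \<open>R\<close> is comparable to \<open>\<bar>Q\<bar> powr k\<close> with \<open>k > 1\<close>.\<close>

lemma types_exclusive:
  fixes \<phi> :: "int^'n \<Rightarrow> complex"
  assumes pt: "pos_type \<phi> \<xi>0 \<alpha> R Q" and it: "imag_type \<phi> \<xi>0 \<alpha>' R' Q'"
    and mu: "hom_order (\<lambda>\<eta>. \<bar>Q' \<eta>\<bar>) < 1"
  shows False
proof -
  obtain Rt Qt E where dec: "decomp \<phi> \<xi>0 \<alpha> R Q Rt Qt" and ph: "pos_homog R" and E: "E \<in> Exps R" "homog E Q"
    and s: "subhomog E Qt" "subhomog E Rt"
    using pt unfolding pos_type_def by blast
  obtain Rt' Qt' E' k where dec': "decomp \<phi> \<xi>0 \<alpha>' R' Q' Rt' Qt'" and ph': "pos_homog (\<lambda>\<xi>. \<bar>Q' \<xi>\<bar>)" "pos_homog R'"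
    and E': "E' \<in> Exps (\<lambda>\<xi>. \<bar>Q' \<xi>\<bar>)" and k: "k > 1" and hR: "homog ((1/k) *\<^sub>R E') R'"
    and s': "strongly_subhomog 2 E' Qt'" "strongly_subhomog 1 ((1/k) *\<^sub>R E') Rt'"
    using it unfolding imag_type_def by blast
  obtain U where U: "open U" "0 \<in> U" "Qt 0 = 0" "Rt 0 = 0"
    "\<And>\<xi>. \<xi> \<in> U \<Longrightarrow> Gam \<phi> \<xi>0 \<xi> = \<i> * of_real (\<alpha> \<bullet> \<xi>) - \<i> * of_real (Q \<xi> + Qt \<xi>) - of_real (R \<xi> + Rt \<xi>)"
    using dec unfolding decomp_def by blast
  obtain U' where U': "open U'" "0 \<in> U'" "smooth_on U' Qt'" "smooth_on U' Rt'" "Qt' 0 = 0" "Rt' 0 = 0"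
    "\<And>\<xi>. \<xi> \<in> U' \<Longrightarrow> Gam \<phi> \<xi>0 \<xi> = \<i> * of_real (\<alpha>' \<bullet> \<xi>) - \<i> * of_real (Q' \<xi> + Qt' \<xi>) - of_real (R' \<xi> + Rt' \<xi>)"
    using dec' unfolding decomp_def by blast
  have pQ: "poly_nolin Q" "poly_nolin Q'" using dec dec' by (auto simp: decomp_def)
  obtain C0 where C0: "C0 > 0" "\<And>\<xi>. norm \<xi> \<le> 1 \<Longrightarrow> \<bar>Q' \<xi>\<bar> \<le> C0 * (norm \<xi>)\<^sup>2"
    by (rule poly_nolin_quadratic[OF pQ(2)]) (rule that)
  interpret A: pos_homog_scaling R E
    using ph E s by unfold_locales (auto simp: Exps_def subhomog_def)
  interpret B: pos_homog_scaling "\<lambda>\<xi>. \<bar>Q' \<xi>\<bar>" E'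
    using ph' E' s' by unfold_locales (auto simp: Exps_def strongly_subhomog_def)
  interpret I: imag_local "\<lambda>\<xi>. \<bar>Q' \<xi>\<bar>" E' Q' Qt' Rt' R' k U' C0
    using mu k hR U' s' C0 ph' by unfold_locales (auto simp: B.hom_order_eq poly_nolin_continuous[OF pQ(2)] smooth_on_def)
  obtain M where M: "M > 0" "\<And>\<xi>. \<bar>Q \<xi>\<bar> \<le> M * R \<xi>"
    by (rule A.homog_bounded_by[OF poly_nolin_continuous[OF pQ(1)] E(2)]) (rule that)
  obtain CR where CR: "CR > 0" "\<And>\<xi>. R' \<xi> \<le> CR * \<bar>Q' \<xi>\<bar> powr k"
    by (rule I.R_bound) (rule that)
  obtain d1 where d1: "d1 > 0" "\<And>\<xi>. R \<xi> < d1 \<Longrightarrow> \<bar>Qt \<xi>\<bar> \<le> 1 * R \<xi>"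
    by (rule A.little_o[of Qt 1]) (use s U in \<open>auto simp: subhomog_def intro: that\<close>)
  obtain d2 where d2: "d2 > 0" "\<And>\<xi>. R \<xi> < d2 \<Longrightarrow> \<bar>Rt \<xi>\<bar> \<le> (1/2) * R \<xi>"
    by (rule A.little_o[of Rt "1/2"]) (use s U in \<open>auto simp: subhomog_def intro: that\<close>)
  obtain d3 where d3: "d3 > 0" "\<And>\<xi>. \<bar>Q' \<xi>\<bar> < d3 \<Longrightarrow> \<bar>Rt' \<xi>\<bar> \<le> 1 * R' \<xi>"
    by (rule I.Rt_small[of 1]) (auto intro: that)
  obtain d4 where d4: "d4 > 0" "\<And>\<xi>. \<bar>Q' \<xi>\<bar> < d4 \<Longrightarrow> \<bar>Qt' \<xi>\<bar> \<le> (1/2) * \<bar>Q' \<xi>\<bar>"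
    by (rule I.Qt_small[of "1/2"]) (auto intro: that)
  define \<beta> where "\<beta> = \<alpha> - \<alpha>'"
  define C1 where "C1 = (M + 1) * (2 * (2 * CR))"
  have C1: "C1 > 0" using M CR by (simp add: C1_def)
  have evA: "\<forall>\<^sub>F \<xi> in nhds 0. R \<xi> < d" if "d > 0" for d
    using eventually_nhds_in_open[OF A.open_sublevel[of d], of 0] that A.P_0_iff[of 0] by simp
  have evB: "\<forall>\<^sub>F \<xi> in nhds 0. \<bar>Q' \<xi>\<bar> < d" if "d > 0" for d
    using eventually_nhds_in_open[OF B.open_sublevel[of d], of 0] that B.P_0_iff[of 0] by simp
  \<comment> \<open>Equal real parts bound \<open>R\<close>, and with it \<open>Q + Qt\<close>, by a
    multiple of \<open>\<bar>Q'\<bar> powr k\<close>. Equal imaginary parts then say that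
    \<open>\<beta> \<bullet> \<xi>\<close> is \<open>- Q'\<close> up to that error and up to
    \<open>Qt'\<close>; the two inequalities are read off.\<close>
  have main: "\<forall>\<^sub>F \<xi> in nhds 0. \<bar>\<beta> \<bullet> \<xi>\<bar> \<le> C1 * \<bar>Q' \<xi>\<bar> powr k + 2 * \<bar>Q' \<xi>\<bar> \<and> \<bar>Q' \<xi>\<bar> / 2 \<le> \<bar>\<beta> \<bullet> \<xi>\<bar> + C1 * \<bar>Q' \<xi>\<bar> powr k"
    using eventually_nhds_in_open[OF U(1,2)] eventually_nhds_in_open[OF U'(1,2)] evA[OF d1(1)] evA[OF d2(1)] evB[OF d3(1)] evB[OF d4(1)]
  proof eventually_elim
    case (elim \<xi>)
    have eq: "\<i> * of_real (\<alpha> \<bullet> \<xi>) - \<i> * of_real (Q \<xi> + Qt \<xi>) - of_real (R \<xi> + Rt \<xi>)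
      = \<i> * of_real (\<alpha>' \<bullet> \<xi>) - \<i> * of_real (Q' \<xi> + Qt' \<xi>) - complex_of_real (R' \<xi> + Rt' \<xi>)"
      using U(5)[OF elim(1)] U'(7)[OF elim(2)] by simp
    have re: "R \<xi> + Rt \<xi> = R' \<xi> + Rt' \<xi>" using arg_cong[OF eq, of Re] by simp
    have im: "\<beta> \<bullet> \<xi> = (Q \<xi> + Qt \<xi>) - (Q' \<xi> + Qt' \<xi>)"
      using arg_cong[OF eq, of Im] by (simp add: \<beta>_def inner_diff_left)
    have "\<bar>Q \<xi> + Qt \<xi>\<bar> \<le> (M + 1) * R \<xi>"
      using M(2)[of \<xi>] d1(2)[OF elim(3)] by (simp add: distrib_right)
    also have "\<dots> \<le> (M + 1) * (2 * (2 * (CR * \<bar>Q' \<xi>\<bar> powr k)))"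
    proof (rule mult_left_mono)
      have "R \<xi> \<le> 2 * (R \<xi> + Rt \<xi>)" using abs_le_D2[OF d2(2)[OF elim(4)]] by simp
      also have "\<dots> \<le> 2 * (2 * R' \<xi>)" unfolding re using abs_le_D1[OF d3(2)[OF elim(5)]] by simp
      also have "\<dots> \<le> 2 * (2 * (CR * \<bar>Q' \<xi>\<bar> powr k))" using CR(2)[of \<xi>] by linarith
      finally show "R \<xi> \<le> 2 * (2 * (CR * \<bar>Q' \<xi>\<bar> powr k))" .
    qed (use M in simp)
    finally have 1: "\<bar>Q \<xi> + Qt \<xi>\<bar> \<le> C1 * \<bar>Q' \<xi>\<bar> powr k" by (simp add: C1_def)
    show ?case using 1 d4(2)[OF elim(6)] unfolding im by linarith
  qed
  \<comment> \<open>A linear function that is O(norm^2) near 0 vanishes. The test points are small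
    multiples of \<open>\<beta>\<close> itself.\<close>
  have b0: "\<beta> = 0"
  proof (rule ccontr)
    assume b: "\<beta> \<noteq> 0"
    define C where "C = (C1 + 2) * C0"
    have "\<forall>\<^sub>F \<xi> in nhds (0::real^'n). norm \<xi> < 1"
      using eventually_nhds_in_open[of "ball 0 1" "0 :: real^'n"] by simp
    with main evB[OF zero_less_one] have "\<forall>\<^sub>F \<xi> in nhds 0. \<bar>\<beta> \<bullet> \<xi>\<bar> \<le> C * (norm \<xi>)\<^sup>2"
    proof eventually_elim
      case (elim \<xi>)
      have "\<bar>Q' \<xi>\<bar> powr k \<le> \<bar>Q' \<xi>\<bar> powr 1"
        using elim(2) k by (intro powr_mono') auto
      then have "C1 * \<bar>Q' \<xi>\<bar> powr k \<le> C1 * \<bar>Q' \<xi>\<bar>" using C1 by (intro mult_left_mono) auto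
      then have "\<bar>\<beta> \<bullet> \<xi>\<bar> \<le> (C1 + 2) * \<bar>Q' \<xi>\<bar>" using elim(1) by (simp add: distrib_right)
      also have "\<dots> \<le> (C1 + 2) * (C0 * (norm \<xi>)\<^sup>2)"
        using C0(2)[of \<xi>] elim(3) C1 by (intro mult_left_mono) auto
      finally show ?case by (simp add: C_def)
    qed
    moreover have "filterlim (\<lambda>s. s *\<^sub>R \<beta>) (nhds 0) (at_right 0)"
    proof -
      have "((\<lambda>s. s *\<^sub>R \<beta>) \<longlongrightarrow> 0 *\<^sub>R \<beta>) (at_right 0)" by (intro tendsto_intros)
      then show ?thesis by simp
    qed
    ultimately have "\<forall>\<^sub>F s in at_right 0. \<bar>\<beta> \<bullet> (s *\<^sub>R \<beta>)\<bar> \<le> C * (norm (s *\<^sub>R \<beta>))\<^sup>2"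
      by (rule eventually_compose_filterlim)
    moreover have "\<forall>\<^sub>F s in at_right 0. C * s < (1::real)"
    proof -
      have "((\<lambda>s. C * s) \<longlongrightarrow> C * 0) (at_right 0)" by (intro tendsto_intros)
      then show ?thesis by (rule order_tendstoD) simp
    qed
    moreover have "\<forall>\<^sub>F s in at_right 0. s > (0::real)" by (rule eventually_at_right_less)
    ultimately have "\<forall>\<^sub>F s in at_right (0::real). False"
    proof eventually_elim
      case (elim s)
      have "s * (norm \<beta>)\<^sup>2 \<le> (C * s) * (s * (norm \<beta>)\<^sup>2)"
        using elim(1,3) by (simp add: power2_norm_eq_inner[symmetric] power_mult_distrib abs_mult power2_eq_square mult_ac)
      moreover have "s * (norm \<beta>)\<^sup>2 > 0" using elim(3) b by simp
      ultimately have "1 \<le> C * s" by (metis mult_le_cancel_right1 not_less_iff_gr_or_eq)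
      then show ?case using elim(2) by simp
    qed
    then show False by simp
  qed
  \<comment> \<open>Below this level \<open>C1 * \<bar>Q'\<bar> powr k\<close> is less than a
    quarter of \<open>\<bar>Q'\<bar>\<close>, while \<open>main\<close> with
    \<open>\<beta> = 0\<close> demands at least one half. Punctured neighbourhoods of 0 are
    nonempty, hence the contradiction.\<close>
  define \<eta> where "\<eta> = (1 / (4 * C1)) powr (1 / (k - 1))"
  have \<eta>: "\<eta> > 0" using C1 by (simp add: \<eta>_def)
  have "\<forall>\<^sub>F \<xi> in at (0::real^'n). False"
    using main[unfolded eventually_nhds_conv_at, THEN conjunct1]
      evB[OF \<eta>, unfolded eventually_nhds_conv_at, THEN conjunct1] eventually_neq_at_within[of 0 0 UNIV]
  proof eventually_elim
    case (elim \<xi>)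
    have q: "\<bar>Q' \<xi>\<bar> > 0" using elim(3) B.P_pos_iff[of \<xi>] by simp
    have "\<bar>Q' \<xi>\<bar> powr (k - 1) < \<eta> powr (k - 1)" using elim(2) q k by (intro powr_less_mono2) auto
    also have "\<dots> = 1 / (4 * C1)" using k C1 by (simp add: \<eta>_def powr_powr)
    finally have "C1 * \<bar>Q' \<xi>\<bar> powr (k - 1) < 1 / 4" using C1 by (simp add: field_simps)
    then have "C1 * \<bar>Q' \<xi>\<bar> powr (k - 1) * \<bar>Q' \<xi>\<bar> < 1 / 4 * \<bar>Q' \<xi>\<bar>"
      using q by (intro mult_strict_right_mono)
    moreover have "\<bar>Q' \<xi>\<bar> powr (k - 1) * \<bar>Q' \<xi>\<bar> = \<bar>Q' \<xi>\<bar> powr k" using q by (simp add: powr_diff)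
    ultimately have "C1 * \<bar>Q' \<xi>\<bar> powr k < 1 / 4 * \<bar>Q' \<xi>\<bar>" by (simp only: mult.assoc)
    then show ?case using elim(1) q unfolding b0 by simp
  qed
  then show False by simp
qed

section \<open>Periodicity and the choice of the period cube\<close>

lemma fhat_periodic:
  fixes \<phi> :: "int^'n \<Rightarrow> complex"
  shows "fhat \<phi> (\<xi> + (2 * pi) *\<^sub>R realv m) = fhat \<phi> \<xi>"
  unfolding fhat_def
proof (rule infsum_cong)
  fix x :: "int^'n"
  have "realv x \<bullet> realv m = of_int (\<Sum>i\<in>UNIV. x $ i * m $ i)"
    by (simp add: realv_def inner_vec_def)
  then have e: "exp (\<i> * of_real (realv x \<bullet> ((2 * pi) *\<^sub>R realv m))) = 1"
    unfolding exp_eq_1 by (intro conjI exI[of _ "\<Sum>i\<in>UNIV. x $ i * m $ i"]) simp_all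
  have "\<i> * of_real (realv x \<bullet> (\<xi> + (2 * pi) *\<^sub>R realv m))
     = \<i> * of_real (realv x \<bullet> \<xi>) + \<i> * of_real (realv x \<bullet> ((2 * pi) *\<^sub>R realv m))"
    by (simp add: inner_add_right algebra_simps)
  then show "\<phi> x * exp (\<i> * of_real (realv x \<bullet> (\<xi> + (2 * pi) *\<^sub>R realv m))) = \<phi> x * exp (\<i> * of_real (realv x \<bullet> \<xi>))"
    by (simp only: exp_add e mult_1_right)
qed

text \<open>An infinite \<open>Omega\<close> would accumulate in the closed cube, possibly on a face
  that the half-open cube omits. Periodicity moves the accumulation point into \<open>Omega\<close>,
  where isolation gives the contradiction.\<close>

lemma finite_Omega:
  fixes \<phi> :: "int^'n \<Rightarrow> complex"
  assumes Sd: "in_Sd \<phi>"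
    and iso: "\<And>\<xi>0. \<xi>0 \<in> Omega \<phi> \<Longrightarrow> \<exists>W. open W \<and> 0 \<in> W \<and> (\<forall>\<xi>\<in>W - {0}. norm (fhat \<phi> (\<xi>0 + \<xi>)) < 1)"
  shows "finite (Omega \<phi>)"
proof (rule ccontr)
  assume inf: "infinite (Omega \<phi>)"
  define B :: "(real^'n) set" where "B = cbox (\<chi> i. - pi) (\<chi> i. pi) \<inter> {\<xi>::real^'n. norm (fhat \<phi> \<xi>) = 1}"
  have "closed {\<xi>::real^'n. norm (fhat \<phi> \<xi>) = 1}"
    by (intro closed_Collect_eq continuous_intros continuous_fhat[OF Sd])
  then have "compact B" unfolding B_def by (intro compact_Int_closed) auto
  moreover have "Omega \<phi> \<subseteq> B"
    by (simp add: Omega_def B_def mem_box_cart subset_iff less_imp_le)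
  ultimately obtain z where z: "z \<in> B" "z islimpt Omega \<phi>"
    using inf compact_eq_Bolzano_Weierstrass by blast
  \<comment> \<open>Exactly the coordinates equal to \<open>- pi\<close> are shifted by one
    period.\<close>
  define m :: "int^'n" where "m = (\<chi> i. if z $ i = - pi then 1 else 0)"
  define w where "w = z + (2 * pi) *\<^sub>R realv m"
  have wi: "w $ i = (if z $ i = - pi then pi else z $ i)" for i
    by (simp add: w_def m_def realv_def)
  have zb: "- pi \<le> z $ i" "z $ i \<le> pi" for i using z(1) by (auto simp: B_def mem_box_cart)
  have fw: "fhat \<phi> (w + \<xi>) = fhat \<phi> (z + \<xi>)" for \<xi>
    using fhat_periodic[of \<phi> "z + \<xi>" m] by (simp add: w_def add_ac)
  have "w \<in> Omega \<phi>"
    unfolding Omega_def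
  proof (intro CollectI conjI allI)
    show "- pi < w $ i" "w $ i \<le> pi" for i
      using zb[of i] pi_gt_zero by (auto simp: wi less_le)
    show "norm (fhat \<phi> w) = 1" using fw[of 0] z(1) by (simp add: B_def)
  qed
  from iso[OF this] obtain W where W: "open W" "0 \<in> W" "\<And>\<xi>. \<xi> \<in> W \<Longrightarrow> \<xi> \<noteq> 0 \<Longrightarrow> norm (fhat \<phi> (w + \<xi>)) < 1"
    by (elim exE conjE) (rule that, auto)
  have "z \<in> (+) z ` W" using W(2) by (intro image_eqI[of _ _ 0]) simp_all
  from islimptE[OF z(2) this open_translation[OF W(1)]]
  obtain y where y: "y \<in> Omega \<phi>" "y \<in> (+) z ` W" "y \<noteq> z" .
  then obtain \<xi> where "\<xi> \<in> W" "y = z + \<xi>" "\<xi> \<noteq> 0" by auto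
  then have "norm (fhat \<phi> y) < 1" using W(3)[of \<xi>] fw[of \<xi>] by simp
  then show False using y(1) by (simp add: Omega_def)
qed

text \<open>The cube is moved by at most half the smallest distance of \<open>Omega\<close> from the
  omitted faces. A point of modulus one in the new cube that had to be reduced by a period would
  land in \<open>Omega\<close> at a coordinate of at most \<open>c - pi\<close>, closer to the face
  than any point of \<open>Omega\<close> is.\<close>

lemma torus_box_choice:
  fixes \<phi> :: "int^'n \<Rightarrow> complex"
  assumes fin: "finite (Omega \<phi>)"
  obtains c where "\<And>\<xi>. \<xi> \<in> torus_box c \<Longrightarrow> norm (fhat \<phi> \<xi>) = 1 \<Longrightarrow> \<xi> \<in> Omega \<phi>"
    "Omega \<phi> \<subseteq> interior (torus_box c)"
proof -
  \<comment> \<open>Inserting \<open>pi\<close> keeps the minimum defined in every case and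
    guarantees \<open>c \<le> pi\<close>.\<close>
  define S where "S = insert pi ((\<lambda>(\<xi>, i). (\<xi> $ i + pi) / 2) ` (Omega \<phi> \<times> (UNIV :: 'n set)))"
  define c where "c = Min S"
  have S: "finite S" "S \<noteq> {}" using fin by (auto simp: S_def)
  have "s > 0" if "s \<in> S" for s
  proof -
    from that consider "s = pi" | \<xi> i where "\<xi> \<in> Omega \<phi>" "s = (\<xi> $ i + pi) / 2"
      unfolding S_def by auto
    then show ?thesis
    proof cases
      case 2
      then have "- pi < \<xi> $ i" by (simp add: Omega_def)
      then show ?thesis using 2(2) by simp
    qed simp
  qed
  then have c: "c > 0" unfolding c_def using S by (subst Min_gr_iff) auto
  have cx: "c - pi < \<xi> $ i" if "\<xi> \<in> Omega \<phi>" for \<xi> i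
  proof -
    have "(\<xi> $ i + pi) / 2 \<in> S" using that by (force simp: S_def)
    then have "c \<le> (\<xi> $ i + pi) / 2" unfolding c_def using S by (intro Min_le)
    moreover have "- pi < \<xi> $ i" using that by (simp add: Omega_def)
    ultimately show ?thesis using c by (simp add: field_simps)
  qed
  show thesis
  proof
    fix \<xi> :: "real^'n" assume b: "\<xi> \<in> torus_box c" and n: "norm (fhat \<phi> \<xi>) = 1"
    define m :: "int^'n" where "m = (\<chi> i. if \<xi> $ i > pi then - 1 else 0)"
    define w where "w = \<xi> + (2 * pi) *\<^sub>R realv m"
    have wi: "w $ i = (if \<xi> $ i > pi then \<xi> $ i - 2 * pi else \<xi> $ i)" for i
      by (simp add: w_def m_def realv_def)
    have xb: "c - pi \<le> \<xi> $ i" "\<xi> $ i \<le> c + pi" for i using b by (auto simp: torus_box_def mem_box_cart)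
    have cpi: "c \<le> pi" unfolding c_def using S by (intro Min_le) (auto simp: S_def)
    have w: "w \<in> Omega \<phi>"
      unfolding Omega_def
    proof (intro CollectI conjI allI)
      fix i
      show "- pi < w $ i" "w $ i \<le> pi" using xb[of i] c cpi by (auto simp: wi)
      show "norm (fhat \<phi> w) = 1" using n fhat_periodic[of \<phi> \<xi> m] by (simp add: w_def)
    qed
    have "w $ i = \<xi> $ i" for i
      using cx[OF w, of i] xb[of i] by (auto simp: wi split: if_splits)
    then have "w = \<xi>" by (simp add: vec_eq_iff)
    then show "\<xi> \<in> Omega \<phi>" using w by simp
  next
    show "Omega \<phi> \<subseteq> interior (torus_box c)"
    proof
      fix \<xi> assume x: "\<xi> \<in> Omega \<phi>"
      then have "\<xi> $ i \<le> pi" for i by (simp add: Omega_def)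
      then have "\<xi> $ i < c + pi" for i using c by (smt (verit))
      then show "\<xi> \<in> interior (torus_box c)"
        using cx[OF x] by (simp add: torus_box_def interior_cbox mem_box_cart)
    qed
  qed
qed

section \<open>Calculus of uniform remainders\<close>

lemma unif_o_weaken:
  assumes "unif_o m h X" "M \<le> m" shows "unif_o M h X"
  unfolding unif_o_def
proof (intro allI impI)
  fix \<epsilon> :: real assume \<epsilon>: "\<epsilon> > 0"
  have "\<forall>\<^sub>F n in sequentially. \<forall>x. X n x \<longrightarrow> norm (h n x) \<le> \<epsilon> * real n powr (- m)"
    using assms(1) \<epsilon> by (simp add: unif_o_def)
  then show "\<forall>\<^sub>F n in sequentially. \<forall>x. X n x \<longrightarrow> norm (h n x) \<le> \<epsilon> * real n powr (- M)"
    using eventually_ge_at_top[of "1::nat"]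
  proof eventually_elim
    case (elim n)
    have "real n powr (- m) \<le> real n powr (- M)" using elim(2) assms(2) by (intro powr_mono) auto
    then have "\<epsilon> * real n powr (- m) \<le> \<epsilon> * real n powr (- M)" using \<epsilon> by (intro mult_left_mono) auto
    then show ?case using elim(1) order_trans by blast
  qed
qed

lemma unif_o_add:
  assumes "unif_o M f X" "unif_o M g X" shows "unif_o M (\<lambda>n x. f n x + g n x) X"
  unfolding unif_o_def
proof (intro allI impI)
  fix \<epsilon> :: real assume "\<epsilon> > 0"
  then have "\<epsilon> / 2 > 0" by simp
  then have "\<forall>\<^sub>F n in sequentially. \<forall>x. X n x \<longrightarrow> norm (f n x) \<le> \<epsilon> / 2 * real n powr (- M)"
    "\<forall>\<^sub>F n in sequentially. \<forall>x. X n x \<longrightarrow> norm (g n x) \<le> \<epsilon> / 2 * real n powr (- M)"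
    using assms unfolding unif_o_def by blast+
  then show "\<forall>\<^sub>F n in sequentially. \<forall>x. X n x \<longrightarrow> norm (f n x + g n x) \<le> \<epsilon> * real n powr (- M)"
  proof (eventually_elim, intro allI impI)
    fix n x assume h: "\<forall>x. X n x \<longrightarrow> norm (f n x) \<le> \<epsilon> / 2 * real n powr (- M)"
      "\<forall>x. X n x \<longrightarrow> norm (g n x) \<le> \<epsilon> / 2 * real n powr (- M)" and x: "X n x"
    have "norm (f n x + g n x) \<le> \<epsilon> / 2 * real n powr (- M) + \<epsilon> / 2 * real n powr (- M)"
      by (rule order_trans[OF norm_triangle_ineq]) (intro add_mono h[rule_format] x)
    then show "norm (f n x + g n x) \<le> \<epsilon> * real n powr (- M)" by simp
  qed
qed

lemma unif_o_zero: "unif_o M (\<lambda>n x. 0) X"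
  by (simp add: unif_o_def)

lemma unif_o_sum:
  assumes "finite S" "\<And>s. s \<in> S \<Longrightarrow> unif_o M (f s) X"
  shows "unif_o M (\<lambda>n x. \<Sum>s\<in>S. f s n x) X"
  using assms by (induction S) (auto intro: unif_o_zero unif_o_add)

lemma unif_o_of_null_bound:
  assumes b: "\<forall>\<^sub>F n in sequentially. \<forall>x. X n x \<longrightarrow> norm (h n x) \<le> B n * real n powr (- M)" and B: "B \<longlonglongrightarrow> 0"
  shows "unif_o M h X"
  unfolding unif_o_def
proof (intro allI impI)
  fix \<epsilon> :: real assume "\<epsilon> > 0"
  then have "\<forall>\<^sub>F n in sequentially. B n < \<epsilon>" using B by (intro order_tendstoD)
  with b show "\<forall>\<^sub>F n in sequentially. \<forall>x. X n x \<longrightarrow> norm (h n x) \<le> \<epsilon> * real n powr (- M)"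
  proof (eventually_elim, intro allI impI)
    fix n x assume h: "\<forall>x. X n x \<longrightarrow> norm (h n x) \<le> B n * real n powr (- M)" "B n < \<epsilon>" and x: "X n x"
    have "B n * real n powr (- M) \<le> \<epsilon> * real n powr (- M)" using h(2) by (intro mult_right_mono) auto
    then show "norm (h n x) \<le> \<epsilon> * real n powr (- M)" using h(1) x order_trans by blast
  qed
qed

lemma unif_o_of_bound:
  assumes b: "\<forall>\<^sub>F n in sequentially. \<forall>x. X n x \<longrightarrow> norm (h n x) \<le> C * real n powr (- m)" and m: "M < m"
  shows "unif_o M h X"
proof (rule unif_o_of_null_bound)
  show "\<forall>\<^sub>F n in sequentially. \<forall>x. X n x \<longrightarrow> norm (h n x) \<le> (C * real n powr (- (m - M))) * real n powr (- M)"
    using b by (simp add: powr_add[symmetric] mult.assoc)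
  have "(\<lambda>n. C * real n powr (- (m - M))) \<longlonglongrightarrow> C * 0"
    by (intro tendsto_mult_left tendsto_neg_powr filterlim_real_sequentially) (use m in auto)
  then show "(\<lambda>n. C * real n powr (- (m - M))) \<longlonglongrightarrow> 0" by simp
qed

lemma unif_o_geometric:
  fixes r :: real
  assumes r: "0 < r" "r < 1" and b: "\<And>n x. norm (h n x) \<le> K * r ^ n"
  shows "unif_o M h X"
proof (rule unif_o_of_null_bound)
  define s where "s = - ln r"
  have s: "s > 0" using r by (simp add: s_def)
  have rn: "r ^ n = exp (- (s * real n))" for n :: nat using r by (simp add: s_def exp_of_nat2_mult)
  show "\<forall>\<^sub>F n in sequentially. \<forall>x. X n x \<longrightarrow> norm (h n x) \<le> (K * exp (- (s * real n)) * real n powr M) * real n powr (- M)"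
  proof (rule eventually_sequentiallyI[of 1], intro allI impI)
    fix n :: nat and x assume "1 \<le> n"
    then have "real n powr M * real n powr (- M) = 1" by (simp add: powr_add[symmetric])
    then show "norm (h n x) \<le> (K * exp (- (s * real n)) * real n powr M) * real n powr (- M)"
      using b[of n x] unfolding rn mult.assoc by simp
  qed
  have "(\<lambda>n. exp (- (s * real n)) * real n powr M) \<longlonglongrightarrow> 0" using s by real_asymp
  from tendsto_mult_left[OF this, of K]
  show "(\<lambda>n. K * exp (- (s * real n)) * real n powr M) \<longlonglongrightarrow> 0" by (simp add: mult.assoc)
qed

text \<open>Each point of \<open>Omega\<close> is replaced by its attractor term on its own small
  neighbourhood. Terms of order above \<open>M\<close> are first subtracted with the local errors
  and then added back as one sum, which is itself o(n^-M).\<close>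

lemma convpow_asym:
  fixes \<phi> :: "int^'n \<Rightarrow> complex" and T :: "real^'n \<Rightarrow> nat \<Rightarrow> int^'n \<Rightarrow> complex"
  assumes Sd: "in_Sd \<phi>" and le1: "\<And>\<xi>. norm (fhat \<phi> \<xi>) \<le> 1" and fin: "finite (Omega \<phi>)"
    and loc: "\<And>\<xi>. \<xi> \<in> Omega \<phi> \<Longrightarrow> local_asym \<phi> \<xi> (m \<xi>) (T \<xi>) X" and M: "\<And>\<xi>. \<xi> \<in> Omega \<phi> \<Longrightarrow> M \<le> m \<xi>"
  shows "unif_o M (\<lambda>n x. convpow \<phi> n x - (\<Sum>\<xi>\<in>{\<xi>\<in>Omega \<phi>. m \<xi> = M}. T \<xi> n x)) X"
proof -
  let ?O = "Omega \<phi>"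
  define \<kappa> :: complex where "\<kappa> = 1 / (2 * pi) ^ CARD('n)"
  obtain c where c: "\<And>\<xi>. \<xi> \<in> torus_box c \<Longrightarrow> norm (fhat \<phi> \<xi>) = 1 \<Longrightarrow> \<xi> \<in> ?O" "?O \<subseteq> interior (torus_box c)"
    by (rule torus_box_choice[OF fin]) (rule that)
  \<comment> \<open>The factor 2 makes balls of these radii around different points
    disjoint.\<close>
  have "\<exists>e>0. ball \<xi> e \<subseteq> torus_box c \<and> (\<forall>\<xi>'\<in>?O. \<xi>' \<noteq> \<xi> \<longrightarrow> 2 * e \<le> dist \<xi> \<xi>')" if "\<xi> \<in> ?O" for \<xi>
  proof -
    have "\<xi> \<in> interior (torus_box c)" using c(2) that by blast
    then obtain e1 where e1: "e1 > 0" "ball \<xi> e1 \<subseteq> torus_box c" using mem_interior by blast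
    obtain e2 where e2: "e2 > 0" "\<forall>x\<in>?O. x \<noteq> \<xi> \<longrightarrow> e2 \<le> dist \<xi> x" using finite_set_avoid[OF fin] by blast
    show ?thesis
    proof (intro exI[of _ "min e1 (e2 / 2)"] conjI)
      show "min e1 (e2 / 2) > 0" using e1 e2 by simp
      have "ball \<xi> (min e1 (e2 / 2)) \<subseteq> ball \<xi> e1" by (rule subset_ball) simp
      then show "ball \<xi> (min e1 (e2 / 2)) \<subseteq> torus_box c" using e1 by blast
      show "\<forall>\<xi>'\<in>?O. \<xi>' \<noteq> \<xi> \<longrightarrow> 2 * min e1 (e2 / 2) \<le> dist \<xi> \<xi>'" using e2 by fastforce
    qed
  qed
  then have "\<forall>\<xi>\<in>?O. \<exists>e. e > 0 \<and> ball \<xi> e \<subseteq> torus_box c \<and> (\<forall>\<xi>'\<in>?O. \<xi>' \<noteq> \<xi> \<longrightarrow> 2 * e \<le> dist \<xi> \<xi>')"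
    by (rule ballI)
  from bchoice[OF this] obtain e where e': "\<forall>\<xi>\<in>?O. e \<xi> > 0 \<and> ball \<xi> (e \<xi>) \<subseteq> torus_box c \<and> (\<forall>\<xi>'\<in>?O. \<xi>' \<noteq> \<xi> \<longrightarrow> 2 * e \<xi> \<le> dist \<xi> \<xi>')" ..
  have e: "e \<xi> > 0" "ball \<xi> (e \<xi>) \<subseteq> torus_box c" "\<And>\<xi>'. \<xi>' \<in> ?O \<Longrightarrow> \<xi>' \<noteq> \<xi> \<Longrightarrow> 2 * e \<xi> \<le> dist \<xi> \<xi>'"
    if "\<xi> \<in> ?O" for \<xi>
    using bspec[OF e' that] by blast+
  define e0 where "e0 = Min (insert 1 (e ` ?O))"
  have e0: "e0 > 0" unfolding e0_def using fin e(1) by (subst Min_gr_iff) auto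
  have e0_le: "e0 \<le> e \<xi>" if "\<xi> \<in> ?O" for \<xi> unfolding e0_def using fin that by (intro Min_le) auto
  have "\<exists>N. open N \<and> 0 \<in> N \<and> N \<subseteq> ball 0 e0 \<and>
     unif_o (m \<xi>) (\<lambda>n x. \<kappa> * integral ((+) \<xi> ` N) (fourier_integrand \<phi> n x) - T \<xi> n x) X" if "\<xi> \<in> ?O" for \<xi>
    using loc[OF that] e0 unfolding local_asym_def \<kappa>_def by (elim conjE allE[of _ "ball 0 e0"]) auto
  then have "\<forall>\<xi>\<in>?O. \<exists>N. open N \<and> 0 \<in> N \<and> N \<subseteq> ball 0 e0 \<and>
     unif_o (m \<xi>) (\<lambda>n x. \<kappa> * integral ((+) \<xi> ` N) (fourier_integrand \<phi> n x) - T \<xi> n x) X"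
    by (rule ballI)
  from bchoice[OF this] obtain N where N': "\<forall>\<xi>\<in>?O. open (N \<xi>) \<and> 0 \<in> N \<xi> \<and> N \<xi> \<subseteq> ball 0 e0 \<and>
     unif_o (m \<xi>) (\<lambda>n x. \<kappa> * integral ((+) \<xi> ` N \<xi>) (fourier_integrand \<phi> n x) - T \<xi> n x) X" ..
  have N: "open (N \<xi>)" "0 \<in> N \<xi>" "N \<xi> \<subseteq> ball 0 e0"
    "unif_o (m \<xi>) (\<lambda>n x. \<kappa> * integral ((+) \<xi> ` N \<xi>) (fourier_integrand \<phi> n x) - T \<xi> n x) X" if "\<xi> \<in> ?O" for \<xi>
    using bspec[OF N' that] by blast+
  define S where "S = (\<lambda>\<xi>. (+) \<xi> ` N \<xi>)"
  have So: "open (S \<xi>)" if "\<xi> \<in> ?O" for \<xi> unfolding S_def using N(1)[OF that] by (rule open_translation)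
  have Sx: "\<xi> \<in> S \<xi>" if "\<xi> \<in> ?O" for \<xi> unfolding S_def using N(2)[OF that] by (intro image_eqI[of _ _ 0]) auto
  have Sb: "S \<xi> \<subseteq> ball \<xi> e0" if "\<xi> \<in> ?O" for \<xi>
  proof -
    have "dist \<xi> (\<xi> + v) < e0" if "v \<in> N \<xi>" for v
    proof -
      have "v \<in> ball 0 e0" using N(3)[OF \<open>\<xi> \<in> ?O\<close>] that by blast
      then show ?thesis by (simp add: dist_norm)
    qed
    then show ?thesis unfolding S_def by auto
  qed
  have Sbox: "S \<xi> \<subseteq> torus_box c" if "\<xi> \<in> ?O" for \<xi>
    using Sb[OF that] e(2)[OF that] subset_ball[OF e0_le[OF that], of \<xi>] by blast
  have disj: "S \<xi> \<inter> S \<xi>' = {}" if xx: "\<xi> \<in> ?O" "\<xi>' \<in> ?O" "\<xi> \<noteq> \<xi>'" for \<xi> \<xi>'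
  proof (rule ccontr)
    assume "S \<xi> \<inter> S \<xi>' \<noteq> {}"
    then obtain v where "v \<in> ball \<xi> e0" "v \<in> ball \<xi>' e0" using Sb[OF xx(1)] Sb[OF xx(2)] by blast
    then have "dist \<xi> \<xi>' < 2 * e0" using dist_triangle2[of \<xi> \<xi>' v] by (simp add: dist_commute)
    then show False using e(3)[OF xx(1,2)] xx(3) e0_le[OF xx(1)] by force
  qed
  define Rest where "Rest = torus_box c - (\<Union>\<xi>\<in>?O. S \<xi>)"
  have cbx: "compact (torus_box c :: (real^'n) set)" by (simp add: torus_box_def)
  have Rc: "compact Rest" unfolding Rest_def using So by (intro compact_diff cbx open_UN) auto
  have lt1: "norm (fhat \<phi> \<xi>) < 1" if "\<xi> \<in> Rest" for \<xi>
  proof (rule ccontr)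
    assume "\<not> ?thesis"
    then have "norm (fhat \<phi> \<xi>) = 1" using le1[of \<xi>] by simp
    then have "\<xi> \<in> ?O" using c(1) that by (auto simp: Rest_def)
    then show False using Sx that by (auto simp: Rest_def)
  qed
  \<comment> \<open>The rate must be strictly positive, since its logarithm is taken later: hence
    the maximum with 1/2, and 1/2 itself when nothing is left of the cube.\<close>
  obtain r where r: "0 < r" "r < 1" "\<And>\<xi>. \<xi> \<in> Rest \<Longrightarrow> norm (fhat \<phi> \<xi>) \<le> r"
  proof (cases "Rest = {}")
    case False
    have "continuous_on Rest (\<lambda>\<xi>. norm (fhat \<phi> \<xi>))"
      by (intro continuous_intros continuous_on_subset[OF continuous_fhat[OF Sd]]) auto
    then obtain z where z: "z \<in> Rest" "\<And>\<xi>. \<xi> \<in> Rest \<Longrightarrow> norm (fhat \<phi> \<xi>) \<le> norm (fhat \<phi> z)"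
      using continuous_attains_sup[OF Rc False] by blast
    show thesis
      by (rule that[of "max (1/2) (norm (fhat \<phi> z))"]) (use z lt1[OF z(1)] in \<open>auto simp: le_max_iff_disj\<close>)
  qed (use that[of "1/2"] in auto)
  have ai: "fourier_integrand \<phi> n x absolutely_integrable_on A" if "bounded A" "A \<in> sets borel" for n x A
    by (rule absolutely_integrable_continuous_bounded[OF continuous_fourier_integrand[OF Sd] that])
  have bx: "bounded (torus_box c :: (real^'n) set)" using cbx by (rule compact_imp_bounded)
  have split: "integral (torus_box c) (fourier_integrand \<phi> n x) = (\<Sum>\<xi>\<in>?O. integral (S \<xi>) (fourier_integrand \<phi> n x)) + integral Rest (fourier_integrand \<phi> n x)" for n x
  proof -
    let ?g = "fourier_integrand \<phi> n x"
    have "(?g has_integral integral (S \<xi>) ?g) (S \<xi>)" if "\<xi> \<in> ?O" for \<xi>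
      using ai[of "S \<xi>"] bounded_subset[OF bx Sbox[OF that]] So[OF that]
      by (auto simp: absolutely_integrable_on_def integrable_integral)
    then have 1: "(?g has_integral (\<Sum>\<xi>\<in>?O. integral (S \<xi>) ?g)) (\<Union>\<xi>\<in>?O. S \<xi>)"
      using disj by (intro has_integral_UN fin) (auto simp: pairwise_def)
    have "(?g has_integral integral Rest ?g) Rest"
      using ai[of Rest n x] compact_imp_bounded[OF Rc] compact_imp_closed[OF Rc]
      by (auto simp: absolutely_integrable_on_def integrable_integral)
    from Henstock_Kurzweil_Integration.has_integral_Un[OF 1 this]
    have "(?g has_integral ((\<Sum>\<xi>\<in>?O. integral (S \<xi>) ?g) + integral Rest ?g)) ((\<Union>\<xi>\<in>?O. S \<xi>) \<union> Rest)"
      by (simp add: Rest_def)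
    moreover have "(\<Union>\<xi>\<in>?O. S \<xi>) \<union> Rest = torus_box c" using Sbox by (auto simp: Rest_def)
    ultimately show ?thesis by (simp add: integral_unique)
  qed
  have Rm: "Rest \<in> lmeasurable" using Rc by (rule lmeasurable_compact)
  have rest: "unif_o M (\<lambda>n x. \<kappa> * integral Rest (fourier_integrand \<phi> n x)) X"
  proof (rule unif_o_geometric[OF r(1,2)])
    fix n and x :: "int^'n"
    have "norm (integral Rest (fourier_integrand \<phi> n x)) \<le> integral Rest (\<lambda>_. r ^ n)"
    proof (rule integral_norm_bound_integral)
      show "fourier_integrand \<phi> n x integrable_on Rest"
        using ai[of Rest n x] compact_imp_bounded[OF Rc] compact_imp_closed[OF Rc] by (auto simp: absolutely_integrable_on_def)
      show "(\<lambda>_. r ^ n) integrable_on Rest" using integrable_on_const[OF Rm] .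
      show "norm (fourier_integrand \<phi> n x \<xi>) \<le> r ^ n" if "\<xi> \<in> Rest" for \<xi>
        using r(3)[OF that] by (simp add: fourier_integrand_def norm_mult norm_power power_mono)
    qed
    also have "\<dots> = r ^ n * measure lebesgue Rest"
      using lmeasure_integral[OF Rm] integral_mult_right[of Rest "r ^ n" "\<lambda>_. 1"] by simp
    finally have "norm \<kappa> * norm (integral Rest (fourier_integrand \<phi> n x)) \<le> norm \<kappa> * (r ^ n * measure lebesgue Rest)"
      by (intro mult_left_mono) auto
    then show "norm (\<kappa> * integral Rest (fourier_integrand \<phi> n x)) \<le> (norm \<kappa> * measure lebesgue Rest) * r ^ n"
      by (simp add: norm_mult mult_ac)
  qed
  have near: "unif_o M (\<lambda>n x. \<Sum>\<xi>\<in>?O. \<kappa> * integral (S \<xi>) (fourier_integrand \<phi> n x) - T \<xi> n x) X"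
    by (rule unif_o_sum[OF fin]) (use N(4) M in \<open>auto simp: S_def intro: unif_o_weaken\<close>)
  have small: "unif_o M (\<lambda>n x. \<Sum>\<xi>\<in>?O - {\<xi>\<in>?O. m \<xi> = M}. T \<xi> n x) X"
  proof (rule unif_o_sum)
    fix \<xi> assume x: "\<xi> \<in> ?O - {\<xi>\<in>?O. m \<xi> = M}"
    then have "M < m \<xi>" using M[of \<xi>] by auto
    moreover obtain C where "\<forall>\<^sub>F n in sequentially. \<forall>x. X n x \<longrightarrow> norm (T \<xi> n x) \<le> C * real n powr (- m \<xi>)"
      using loc[of \<xi>] x unfolding local_asym_def by blast
    ultimately show "unif_o M (T \<xi>) X" using unif_o_of_bound by blast
  qed (use fin in auto)
  have "convpow \<phi> n x - (\<Sum>\<xi>\<in>{\<xi>\<in>?O. m \<xi> = M}. T \<xi> n x)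
     = ((\<Sum>\<xi>\<in>?O. \<kappa> * integral (S \<xi>) (fourier_integrand \<phi> n x) - T \<xi> n x) + (\<Sum>\<xi>\<in>?O - {\<xi>\<in>?O. m \<xi> = M}. T \<xi> n x))
       + \<kappa> * integral Rest (fourier_integrand \<phi> n x)" for n x
  proof -
    have cp: "convpow \<phi> n x = \<kappa> * integral (torus_box c) (fourier_integrand \<phi> n x)"
      unfolding convpow_integral[OF Sd, of n x c] \<kappa>_def fourier_integrand_def[abs_def] by simp
    have "(\<Sum>\<xi>\<in>?O. T \<xi> n x) = (\<Sum>\<xi>\<in>?O - {\<xi>\<in>?O. m \<xi> = M}. T \<xi> n x) + (\<Sum>\<xi>\<in>{\<xi>\<in>?O. m \<xi> = M}. T \<xi> n x)"
      using fin by (intro sum.subset_diff) auto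
    then show ?thesis
      unfolding cp split by (simp add: sum_subtractf sum_distrib_left algebra_simps)
  qed
  then show ?thesis
    using unif_o_add[OF unif_o_add[OF near small] rest] by simp
qed

text \<open>Uniformity on every ball is upgraded to uniformity on a slowly growing sequence of balls.\<close>

lemma exhaustion_of_local_uniformity:
  fixes h :: "nat \<Rightarrow> int^'n \<Rightarrow> complex"
  assumes loc: "\<And>\<rho>. \<rho> > 0 \<Longrightarrow> unif_o M h (\<lambda>n x. norm (realv x - real n *\<^sub>R \<alpha>) \<le> \<rho>)" and K: "compact K"
  shows "\<exists>Kn. exhaustion K Kn \<and> unif_o M h (\<lambda>n x. realv x - real n *\<^sub>R \<alpha> \<in> Kn n)"
proof -
  obtain \<rho>0 where \<rho>0: "\<rho>0 > 0" "\<And>y. y \<in> K \<Longrightarrow> norm y \<le> \<rho>0"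
    using compact_imp_bounded[OF K] unfolding bounded_pos by blast
  have "\<exists>N. \<forall>n\<ge>N. \<forall>x. norm (realv x - real n *\<^sub>R \<alpha>) \<le> \<rho>0 + real j \<longrightarrow> norm (h n x) \<le> 1 / (real j + 1) * real n powr (- M)" for j
  proof -
    have "unif_o M h (\<lambda>n x. norm (realv x - real n *\<^sub>R \<alpha>) \<le> \<rho>0 + real j)"
      using \<rho>0(1) by (intro loc) simp
    then have "\<forall>\<epsilon>>0. \<exists>N. \<forall>n\<ge>N. \<forall>x. norm (realv x - real n *\<^sub>R \<alpha>) \<le> \<rho>0 + real j \<longrightarrow> norm (h n x) \<le> \<epsilon> * real n powr (- M)"
      unfolding unif_o_def eventually_sequentially .
    then show ?thesis by (elim allE[of _ "1 / (real j + 1)"] impE) simp_all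
  qed
  then have "\<forall>j. \<exists>N. \<forall>n\<ge>N. \<forall>x. norm (realv x - real n *\<^sub>R \<alpha>) \<le> \<rho>0 + real j \<longrightarrow> norm (h n x) \<le> 1 / (real j + 1) * real n powr (- M)"
    by (rule allI)
  from choice[OF this] obtain N where N': "\<forall>j. \<forall>n\<ge>N j. \<forall>x. norm (realv x - real n *\<^sub>R \<alpha>) \<le> \<rho>0 + real j \<longrightarrow> norm (h n x) \<le> 1 / (real j + 1) * real n powr (- M)" ..
  have N: "norm (h n x) \<le> 1 / (real j + 1) * real n powr (- M)"
    if "N j \<le> n" "norm (realv x - real n *\<^sub>R \<alpha>) \<le> \<rho>0 + real j" for j n x
    using N'[rule_format, OF that] .
  \<comment> \<open>The radii j whose thresholds have been passed at time \<open>n\<close>. The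
    condition \<open>j \<le> n\<close> keeps the set finite and 0 keeps it nonempty; for early
    \<open>n\<close> the value 0 may lack its threshold, which is harmless because the claim is
    eventual.\<close>
  define A where "A = (\<lambda>n. insert 0 {j. j \<le> n \<and> (\<forall>i\<le>j. N i \<le> n)})"
  define J where "J = (\<lambda>n. Max (A n))"
  have fA: "finite (A n)" "A n \<noteq> {}" for n by (auto simp: A_def)
  have JA: "J n \<in> A n" for n unfolding J_def using fA by (rule Max_in)
  have J_ge: "j \<le> J n" if "j \<in> A n" for j n unfolding J_def using fA(1) that by (rule Max_ge)
  have Jmono: "J n \<le> J n'" if "n \<le> n'" for n n'
    using JA[of n] that by (intro J_ge) (fastforce simp: A_def)
  have J_large: "\<exists>n0. \<forall>n\<ge>n0. j \<le> J n \<and> N (J n) \<le> n" for j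
  proof (intro exI allI impI)
    \<comment> \<open>This instantiates the witness left open by \<open>exI\<close>: the sum is a
      crude common bound for the thresholds up to \<open>j\<close>.\<close>
    fix n assume n: "n \<ge> j + (\<Sum>i\<le>j. N i)"
    have "N i \<le> n" if "i \<le> j" for i
    proof -
      have "N i \<le> (\<Sum>i\<le>j. N i)" using that by (intro member_le_sum) auto
      then show ?thesis using n by linarith
    qed
    then have "j \<in> A n" using n by (auto simp: A_def)
    then have jJ: "j \<le> J n" by (rule J_ge)
    have "N 0 \<le> n" using \<open>\<And>i. i \<le> j \<Longrightarrow> N i \<le> n\<close>[of 0] by simp
    then have "N (J n) \<le> n" using JA[of n] by (auto simp: A_def)
    with jJ show "j \<le> J n \<and> N (J n) \<le> n" ..
  qed
  define Kn where "Kn = (\<lambda>n. cball (0::real^'n) (\<rho>0 + real (J n)))"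
  have "exhaustion K Kn"
    unfolding exhaustion_def
  proof (intro conjI allI)
    show "compact (Kn n)" for n by (simp add: Kn_def)
    show "K \<subseteq> Kn n" for n using \<rho>0(2) by (force simp: Kn_def)
    show "incseq Kn" unfolding incseq_def Kn_def using Jmono by (auto intro!: subset_cball)
    show "(\<Union>n. Kn n) = UNIV"
    proof (intro equalityI subsetI UNIV_I)
      fix y :: "real^'n"
      obtain j :: nat where j: "norm y \<le> real j" using real_arch_simple by blast
      obtain n where "j \<le> J n" using J_large[of j] by blast
      then have "norm y \<le> \<rho>0 + real (J n)" using j \<rho>0(1) by linarith
      then have "y \<in> Kn n" by (simp add: Kn_def)
      then show "y \<in> (\<Union>n. Kn n)" by blast
    qed
  qed
  moreover have "unif_o M h (\<lambda>n x. realv x - real n *\<^sub>R \<alpha> \<in> Kn n)"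
    unfolding unif_o_def
  proof (intro allI impI)
    fix \<epsilon> :: real assume \<epsilon>: "\<epsilon> > 0"
    obtain j :: nat where j: "1 / \<epsilon> \<le> real j" using real_arch_simple by blast
    obtain n0 where n0: "\<And>n. n \<ge> n0 \<Longrightarrow> j \<le> J n \<and> N (J n) \<le> n" using J_large[of j] by blast
    show "\<forall>\<^sub>F n in sequentially. \<forall>x. realv x - real n *\<^sub>R \<alpha> \<in> Kn n \<longrightarrow> norm (h n x) \<le> \<epsilon> * real n powr (- M)"
    proof (rule eventually_sequentiallyI[of n0], intro allI impI)
      fix n x assume n: "n0 \<le> n" and x: "realv x - real n *\<^sub>R \<alpha> \<in> Kn n"
      have "norm (h n x) \<le> 1 / (real (J n) + 1) * real n powr (- M)"
        using n0[OF n] x by (intro N) (auto simp: Kn_def)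
      also have "\<dots> \<le> \<epsilon> * real n powr (- M)"
      proof (rule mult_right_mono)
        have "1 / \<epsilon> \<le> real (J n) + 1" using j n0[OF n] by linarith
        then show "1 / (real (J n) + 1) \<le> \<epsilon>" using \<epsilon> by (simp add: field_simps)
      qed simp
      finally show "norm (h n x) \<le> \<epsilon> * real n powr (- M)" .
    qed
  qed
  ultimately show ?thesis by blast
qed

lemma local_asym_mono:
  assumes "local_asym \<phi> \<xi>0 m T X" "\<And>n x. Y n x \<Longrightarrow> X n x"
  shows "local_asym \<phi> \<xi>0 m T Y"
proof -
  have mono: "\<forall>\<^sub>F n in sequentially. \<forall>x. Y n x \<longrightarrow> P n x"
    if "\<forall>\<^sub>F n in sequentially. \<forall>x. X n x \<longrightarrow> P n x" for P
    using that by eventually_elim (use assms(2) in blast)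
  have u: "unif_o m h Y" if "unif_o m h X" for h
    unfolding unif_o_def
  proof (intro allI impI)
    fix \<epsilon> :: real assume "\<epsilon> > 0"
    with that show "\<forall>\<^sub>F n in sequentially. \<forall>x. Y n x \<longrightarrow> norm (h n x) \<le> \<epsilon> * real n powr (- m)"
      unfolding unif_o_def by (intro mono) blast
  qed
  show ?thesis
    unfolding local_asym_def
  proof (intro conjI allI impI)
    fix W :: "(real^'a) set" assume "open W \<and> 0 \<in> W"
    with assms(1) obtain N where "open N" "0 \<in> N" "N \<subseteq> W"
      "unif_o m (\<lambda>n x. (1 / (2 * pi) ^ CARD('a)) * integral ((+) \<xi>0 ` N) (fourier_integrand \<phi> n x) - T n x) X"
      unfolding local_asym_def by blast
    then show "\<exists>N. open N \<and> 0 \<in> N \<and> N \<subseteq> W \<and>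
        unif_o m (\<lambda>n x. (1 / (2 * pi) ^ CARD('a)) * integral ((+) \<xi>0 ` N) (fourier_integrand \<phi> n x) - T n x) Y"
      using u by blast
  next
    from assms(1) obtain C where "\<forall>\<^sub>F n in sequentially. \<forall>x. X n x \<longrightarrow> norm (T n x) \<le> C * real n powr (- m)"
      unfolding local_asym_def by blast
    from mono[OF this] show "\<exists>C. \<forall>\<^sub>F n in sequentially. \<forall>x. Y n x \<longrightarrow> norm (T n x) \<le> C * real n powr (- m)" ..
  qed
qed

theorem mainTheorem13:
  fixes \<phi> :: "int^'n \<Rightarrow> complex"
    and Op Oi :: "(real^'n) set"
    and alphaP alphaI :: "real^'n \<Rightarrow> real^'n"
    and RP QP RI QI :: "real^'n \<Rightarrow> real^'n \<Rightarrow> real"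
    and muP muI :: "real^'n \<Rightarrow> real"
    and muphi :: real
  assumes Sd: "in_Sd \<phi>"
    and sup1: "(SUP \<xi>. norm (fhat \<phi> \<xi>)) = 1"
    and Op_def: "Op = {\<xi>\<in>Omega \<phi>. \<exists>\<alpha> R Q. pos_type \<phi> \<xi> \<alpha> R Q}"
    and Oi_def: "Oi = {\<xi>\<in>Omega \<phi>. \<exists>\<alpha> R Q. imag_type \<phi> \<xi> \<alpha> R Q}"
    and all_typed: "Omega \<phi> \<subseteq> Op \<union> Oi"
    and dataP: "\<forall>\<xi>\<in>Op. pos_type \<phi> \<xi> (alphaP \<xi>) (RP \<xi>) (QP \<xi>)"
    and dataI: "\<forall>\<xi>\<in>Oi. imag_type \<phi> \<xi> (alphaI \<xi>) (RI \<xi>) (QI \<xi>)"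
    and muP_def: "muP = (\<lambda>\<xi>. hom_order (RP \<xi>))"
    and muI_def: "muI = (\<lambda>\<xi>. hom_order (\<lambda>\<eta>. \<bar>QI \<xi> \<eta>\<bar>))"
    and muphi_def: "muphi = Inf (muP ` Op \<union> muI ` Oi)"
    and imag_hyps: "Oi \<noteq> {} \<Longrightarrow>
        (\<forall>\<xi>\<in>Oi. muI \<xi> < 1) \<and> (\<exists>\<xi>\<in>Oi. muI \<xi> = muphi) \<and> (\<exists>\<alpha>. \<forall>\<xi>\<in>Oi. alphaI \<xi> = \<alpha>)"
  shows
    "(Omega \<phi> = Op \<longrightarrow>
        finite {\<xi>\<in>Op. muP \<xi> = muphi} \<and>
        unif_o muphi
          (\<lambda>n x. convpow \<phi> n x -
             (\<Sum>\<xi>\<in>{\<xi>\<in>Op. muP \<xi> = muphi}.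
                pos_term \<phi> \<xi> (\<lambda>\<eta>. of_real (RP \<xi> \<eta>) + \<i> * of_real (QP \<xi> \<eta>)) (alphaP \<xi>) n x))
          (\<lambda>n x. True))
   \<and> (Oi \<noteq> {} \<and> (Omega \<phi> = Oi \<or> (\<forall>\<xi>\<in>Op. muP \<xi> > muphi)) \<longrightarrow>
        finite {\<xi>\<in>Oi. muI \<xi> = muphi} \<and>
        (\<forall>\<alpha>. (\<forall>\<xi>\<in>Oi. alphaI \<xi> = \<alpha>) \<longrightarrow>
          (\<forall>K. compact K \<longrightarrow> (\<exists>Kn. exhaustion K Kn \<and>
             unif_o muphi
               (\<lambda>n x. convpow \<phi> n x -
                  (\<Sum>\<xi>\<in>{\<xi>\<in>Oi. muI \<xi> = muphi}. imag_term \<phi> \<xi> (QI \<xi>) \<alpha> n x))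
               (\<lambda>n x. realv x - real n *\<^sub>R \<alpha> \<in> Kn n)))))
   \<and> ((\<exists>\<xi>\<in>Oi. muI \<xi> = muphi) \<and> (\<exists>\<zeta>\<in>Op. muP \<zeta> = muphi) \<longrightarrow>
        finite {\<xi>\<in>Oi. muI \<xi> = muphi} \<and> finite {\<zeta>\<in>Op. muP \<zeta> = muphi} \<and>
        (\<forall>\<alpha>. (\<forall>\<xi>\<in>Oi. alphaI \<xi> = \<alpha>) \<longrightarrow>
          (\<forall>K. compact K \<longrightarrow> (\<exists>Kn. exhaustion K Kn \<and>
             unif_o muphi
               (\<lambda>n x. convpow \<phi> n x -
                  (\<Sum>\<xi>\<in>{\<xi>\<in>Oi. muI \<xi> = muphi}. imag_term \<phi> \<xi> (QI \<xi>) \<alpha> n x) -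
                  (\<Sum>\<zeta>\<in>{\<zeta>\<in>Op. muP \<zeta> = muphi}.
                     pos_term \<phi> \<zeta> (\<lambda>\<eta>. of_real (RP \<zeta> \<eta>) + \<i> * of_real (QP \<zeta> \<eta>)) (alphaP \<zeta>) n x))
               (\<lambda>n x. realv x - real n *\<^sub>R \<alpha> \<in> Kn n)))))"
proof -
  \<comment> \<open>A supremum of reals bounds its family only if the family is bounded above;
    absolute summability of \<open>\<phi>\<close> provides that.\<close>
  have le1: "norm (fhat \<phi> \<xi>) \<le> 1" for \<xi>
    unfolding sup1[symmetric] using norm_fhat_bounded[OF Sd] by (intro cSUP_upper bdd_aboveI2) auto
  have O: "Omega \<phi> = Op \<union> Oi" using all_typed by (auto simp: Op_def Oi_def)
  have mu1: "hom_order (\<lambda>\<eta>. \<bar>QI \<xi> \<eta>\<bar>) < 1" if "\<xi> \<in> Oi" for \<xi>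
    using imag_hyps that unfolding muI_def by blast
  \<comment> \<open>Membership in \<open>Op\<close> and in \<open>Oi\<close> only asks for some
    decomposition, so disjointness is a theorem. It prevents a point from contributing two
    terms.\<close>
  have disj: "Op \<inter> Oi = {}"
    using types_exclusive dataP dataI mu1 by blast
  have OpO: "\<xi> \<in> Omega \<phi>" if "\<xi> \<in> Op" for \<xi> using that O by blast
  have OiO: "\<xi> \<in> Omega \<phi>" if "\<xi> \<in> Oi" for \<xi> using that O by blast
  define TP where "TP = (\<lambda>\<xi>. pos_term \<phi> \<xi> (\<lambda>\<eta>. of_real (RP \<xi> \<eta>) + \<i> * of_real (QP \<xi> \<eta>)) (alphaP \<xi>))"
  have locP: "local_asym \<phi> \<xi> (muP \<xi>) (TP \<xi>) (\<lambda>n x. True)"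
    and isoP: "\<exists>W. open W \<and> 0 \<in> W \<and> (\<forall>\<eta>\<in>W - {0}. norm (fhat \<phi> (\<xi> + \<eta>)) < 1)" if "\<xi> \<in> Op" for \<xi>
    unfolding muP_def TP_def using pos_type_local[OF Sd OpO[OF that] dataP[rule_format, OF that]] .
  have locI: "local_asym \<phi> \<xi> (muI \<xi>) (imag_term \<phi> \<xi> (QI \<xi>) (alphaI \<xi>)) (\<lambda>n x. norm (realv x - real n *\<^sub>R alphaI \<xi>) \<le> \<rho>)"
    if "\<xi> \<in> Oi" "\<rho> > 0" for \<xi> \<rho>
    unfolding muI_def using imag_type_local(1)[OF Sd OiO[OF that(1)] dataI[rule_format, OF that(1)] mu1[OF that(1)] that(2)] .
  have isoI: "\<exists>W. open W \<and> 0 \<in> W \<and> (\<forall>\<eta>\<in>W - {0}. norm (fhat \<phi> (\<xi> + \<eta>)) < 1)" if "\<xi> \<in> Oi" for \<xi>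
    by (rule imag_type_local(2)[OF Sd OiO[OF that] dataI[rule_format, OF that] mu1[OF that]])
  have fin: "finite (Omega \<phi>)"
    using finite_Omega[OF Sd] isoP isoI O by blast
  then have finP: "finite Op" and finI: "finite Oi" unfolding O by auto
  \<comment> \<open>A single order function on \<open>Omega\<close>; by \<open>disj\<close> the
    branch taken is the type of the point.\<close>
  define m where "m = (\<lambda>\<xi>. if \<xi> \<in> Oi then muI \<xi> else muP \<xi>)"
  have m_ge: "muphi \<le> m \<xi>" if "\<xi> \<in> Omega \<phi>" for \<xi>
    unfolding muphi_def
  proof (rule cInf_lower)
    show "m \<xi> \<in> muP ` Op \<union> muI ` Oi" using that O by (auto simp: m_def)
    show "bdd_below (muP ` Op \<union> muI ` Oi)" using finP finI by (intro bdd_below_finite) auto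
  qed
  have split: "{\<xi>\<in>Omega \<phi>. m \<xi> = muphi} = {\<xi>\<in>Oi. muI \<xi> = muphi} \<union> {\<xi>\<in>Op. muP \<xi> = muphi}"
    using disj unfolding O by (auto simp: m_def)
  have case1: "unif_o muphi (\<lambda>n x. convpow \<phi> n x - (\<Sum>\<xi>\<in>{\<xi>\<in>Op. muP \<xi> = muphi}. TP \<xi> n x)) (\<lambda>n x. True)" if "Omega \<phi> = Op"
  proof -
    have Oi: "Oi = {}" using that O disj by blast
    have "unif_o muphi (\<lambda>n x. convpow \<phi> n x - (\<Sum>\<xi>\<in>{\<xi>\<in>Omega \<phi>. m \<xi> = muphi}. TP \<xi> n x)) (\<lambda>n x. True)"
      by (rule convpow_asym[OF Sd le1 fin _ m_ge]) (use locP Oi that in \<open>simp add: m_def\<close>)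
    then show ?thesis unfolding split Oi by simp
  qed
  have case2: "\<exists>Kn. exhaustion K Kn \<and> unif_o muphi (\<lambda>n x. convpow \<phi> n x
      - (\<Sum>\<xi>\<in>{\<xi>\<in>Oi. muI \<xi> = muphi}. imag_term \<phi> \<xi> (QI \<xi>) \<alpha> n x) - (\<Sum>\<xi>\<in>{\<xi>\<in>Op. muP \<xi> = muphi}. TP \<xi> n x))
      (\<lambda>n x. realv x - real n *\<^sub>R \<alpha> \<in> Kn n)" if \<alpha>: "\<forall>\<xi>\<in>Oi. alphaI \<xi> = \<alpha>" and K: "compact K" for \<alpha> K
  proof (rule exhaustion_of_local_uniformity[OF _ K])
    fix \<rho> :: real assume \<rho>: "\<rho> > 0"
    \<comment> \<open>The common drift replaces the individual ones, so that one ball around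
      \<open>n \<alpha>\<close> serves all imaginary points.\<close>
    define T where "T = (\<lambda>\<xi>. if \<xi> \<in> Oi then imag_term \<phi> \<xi> (QI \<xi>) \<alpha> else TP \<xi>)"
    have "local_asym \<phi> \<xi> (m \<xi>) (T \<xi>) (\<lambda>n x. norm (realv x - real n *\<^sub>R \<alpha>) \<le> \<rho>)" if x: "\<xi> \<in> Omega \<phi>" for \<xi>
    proof (cases "\<xi> \<in> Oi")
      case True
      then show ?thesis using locI[OF True \<rho>] \<alpha> by (simp add: m_def T_def)
    next
      case False
      then have "\<xi> \<in> Op" using x O by blast
      from local_asym_mono[OF locP[OF this] TrueI] show ?thesis using False by (simp add: m_def T_def)
    qed
    from convpow_asym[OF Sd le1 fin this m_ge]
    have u: "unif_o muphi (\<lambda>n x. convpow \<phi> n x - (\<Sum>\<xi>\<in>{\<xi>\<in>Omega \<phi>. m \<xi> = muphi}. T \<xi> n x)) (\<lambda>n x. norm (realv x - real n *\<^sub>R \<alpha>) \<le> \<rho>)" .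
    have "(\<Sum>\<xi>\<in>{\<xi>\<in>Omega \<phi>. m \<xi> = muphi}. T \<xi> n x)
       = (\<Sum>\<xi>\<in>{\<xi>\<in>Oi. muI \<xi> = muphi}. imag_term \<phi> \<xi> (QI \<xi>) \<alpha> n x) + (\<Sum>\<xi>\<in>{\<xi>\<in>Op. muP \<xi> = muphi}. TP \<xi> n x)" for n x
    proof -
      have "(\<Sum>\<xi>\<in>{\<xi>\<in>Omega \<phi>. m \<xi> = muphi}. T \<xi> n x)
        = (\<Sum>\<xi>\<in>{\<xi>\<in>Oi. muI \<xi> = muphi}. T \<xi> n x) + (\<Sum>\<xi>\<in>{\<xi>\<in>Op. muP \<xi> = muphi}. T \<xi> n x)"
        unfolding split using finP finI disj by (intro sum.union_disjoint) auto
      also have "(\<Sum>\<xi>\<in>{\<xi>\<in>Oi. muI \<xi> = muphi}. T \<xi> n x) = (\<Sum>\<xi>\<in>{\<xi>\<in>Oi. muI \<xi> = muphi}. imag_term \<phi> \<xi> (QI \<xi>) \<alpha> n x)"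
        by (rule sum.cong) (auto simp: T_def)
      also have "(\<Sum>\<xi>\<in>{\<xi>\<in>Op. muP \<xi> = muphi}. T \<xi> n x) = (\<Sum>\<xi>\<in>{\<xi>\<in>Op. muP \<xi> = muphi}. TP \<xi> n x)"
        using disj by (intro sum.cong) (auto simp: T_def)
      finally show ?thesis .
    qed
    with u show "unif_o muphi (\<lambda>n x. convpow \<phi> n x
      - (\<Sum>\<xi>\<in>{\<xi>\<in>Oi. muI \<xi> = muphi}. imag_term \<phi> \<xi> (QI \<xi>) \<alpha> n x) - (\<Sum>\<xi>\<in>{\<xi>\<in>Op. muP \<xi> = muphi}. TP \<xi> n x))
      (\<lambda>n x. norm (realv x - real n *\<^sub>R \<alpha>) \<le> \<rho>)"
      by (simp add: diff_diff_eq)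
  qed
  have case2a: "\<exists>Kn. exhaustion K Kn \<and> unif_o muphi (\<lambda>n x. convpow \<phi> n x
      - (\<Sum>\<xi>\<in>{\<xi>\<in>Oi. muI \<xi> = muphi}. imag_term \<phi> \<xi> (QI \<xi>) \<alpha> n x))
      (\<lambda>n x. realv x - real n *\<^sub>R \<alpha> \<in> Kn n)"
    if h: "Omega \<phi> = Oi \<or> (\<forall>\<xi>\<in>Op. muP \<xi> > muphi)" and \<alpha>: "\<forall>\<xi>\<in>Oi. alphaI \<xi> = \<alpha>" and K: "compact K" for \<alpha> K
  proof -
    \<comment> \<open>If all points are imaginary, disjointness leaves \<open>Op\<close> empty;
      otherwise the strict inequality excludes its points.\<close>
    have "{\<xi>\<in>Op. muP \<xi> = muphi} = {}" using h O disj by auto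
    from case2[OF \<alpha> K, unfolded this] show ?thesis by simp
  qed
  have f: "finite {\<xi>\<in>Op. muP \<xi> = muphi}" "finite {\<xi>\<in>Oi. muI \<xi> = muphi}" using finP finI by auto
  show ?thesis
    by (intro conjI allI impI f case2a case1[unfolded TP_def] case2[unfolded TP_def]) (assumption | erule conjunct2)+
qed

end
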